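(* Suppose there exists an algorithm $A''$ for $n$-vertex fully dynamic graphs of arboricity $\alpha$ that maintains an orientation of the edges with out-degree at most $D$ at all times and performs amortized $F(n)$ edge flips per update. Then there is a deterministic algorithm that maintains, for a fully dynamic $n$-vertex graph of arboricity $\alpha$, a layered data structure with parameters $k=O(\log n)$ and $\Delta=O(D+\alpha\log n)$, together with the subgraph induced by each layer, in amortized time $O(F(n))$ per update.
   Context: A fully dynamic graph is a sequence $(G_0,\dots,G_M)$ of graphs on a fixed vertex set $V$ with $|V|=n$, where $G_0=(V,\emptyset)$ and each $G_i$ is obtained from $G_{i-1}$ by inserting or deleting a single edge. A graph $G=(V,E)$ has arboricity $\alpha$ if $\alpha=\max_{U\subseteq V}\lceil |E(U)|/(|U|-1)\rceil$, where $E(U)$ is the set of edges with both endpoints in $U$; a dynamic graph of arboricity $\alpha$ is one in which every $G_i$ has arboricity at most $\alpha$. An edge flip is a reversal of the orientation of one edge. Given a dynamic graph of arboricity $\alpha$, a layered data structure (LDS) with parameters $k$ and $\Delta$ is a partition of the vertices into $k$ layers $L_1,\dots,L_k$ such that every vertex $v$ has at most $\Delta$ neighbors in layers $L_j$ with $j\ge i$, where $L_i$ is the layer containing $v$. Maintaining it means that after every update the current partition satisfies this property.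
   Formalization: The amortized time per update is O(max(1, F(n))) instead of O(F(n)), since F counts only flips and may be 0 while every update takes at least constant time; n is at least 2, and initialization of the empty graph takes O(n) time, counted separately. *)

theory Defs
  imports Complex_Main
begin

section \<open>Dynamic graphs of bounded arboricity\<close>

text \<open>
  The vertex set is \<open>{..<n}\<close>; a graph is given by its set of edges, each edge being a
  two-element set of vertices.  A fully dynamic graph is given by its list of updates; the graph
  \<open>G\<^sub>i\<close> is \<open>graph_after (take i us)\<close>.
\<close>

datatype update = Insert nat nat | Delete nat nat

fun apply_update :: "nat set set \<Rightarrow> update \<Rightarrow> nat set set" where
  "apply_update E (Insert u v) = insert {u, v} E"
| "apply_update E (Delete u v) = E - {{u, v}}"

definition graph_after :: "update list \<Rightarrow> nat set set" where
  "graph_after us = foldl apply_update {} us"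

fun legal_update :: "nat \<Rightarrow> nat set set \<Rightarrow> update \<Rightarrow> bool" where
  "legal_update n E (Insert u v) \<longleftrightarrow> u < n \<and> v < n \<and> u \<noteq> v \<and> {u, v} \<notin> E"
| "legal_update n E (Delete u v) \<longleftrightarrow> {u, v} \<in> E"

definition induced :: "nat set set \<Rightarrow> nat set \<Rightarrow> nat set set" where
  "induced E U = {e \<in> E. e \<subseteq> U}"

text \<open>The maximum ranges over the \<open>U\<close> with at least two vertices, where the quotient makes sense;
  it is only used for \<open>n \<ge> 2\<close>.\<close>

definition arboricity :: "nat \<Rightarrow> nat set set \<Rightarrow> nat" where
  "arboricity n E =
    Max ((\<lambda>U. nat \<lceil>real (card (induced E U)) / (real (card U) - 1)\<rceil>)
         ` {U. U \<subseteq> {..<n} \<and> 2 \<le> card U})"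

definition dynamic_graph :: "nat \<Rightarrow> nat \<Rightarrow> update list \<Rightarrow> bool" where
  "dynamic_graph n \<alpha> us \<longleftrightarrow>
    (\<forall>i < length us. legal_update n (graph_after (take i us)) (us ! i)) \<and>
    (\<forall>i \<le> length us. arboricity n (graph_after (take i us)) \<le> \<alpha>)"


section \<open>Maintaining an orientation\<close>

definition is_orientation :: "(nat \<times> nat) set \<Rightarrow> nat set set \<Rightarrow> bool" where
  "is_orientation Arcs E \<longleftrightarrow>
    (\<forall>(u, v) \<in> Arcs. {u, v} \<in> E) \<and>
    (\<forall>u v. {u, v} \<in> E \<longrightarrow> ((u, v) \<in> Arcs \<longleftrightarrow> (v, u) \<notin> Arcs))"

definition out_degree :: "(nat \<times> nat) set \<Rightarrow> nat \<Rightarrow> nat" where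
  "out_degree Arcs v = card {w. (v, w) \<in> Arcs}"

definition flips :: "(nat \<times> nat) set \<Rightarrow> (nat \<times> nat) set \<Rightarrow> nat" where
  "flips Arcs Arcs' = card {(u, v). (u, v) \<in> Arcs \<and> (v, u) \<in> Arcs'}"

text \<open>
  Only the number of flips of the given algorithm matters, so it is an arbitrary online rule: a
  function from the updates seen so far to the current orientation.
\<close>

definition maintains_orientation ::
  "(update list \<Rightarrow> (nat \<times> nat) set) \<Rightarrow> nat \<Rightarrow> nat \<Rightarrow> nat \<Rightarrow> real \<Rightarrow> bool" where
  "maintains_orientation orient n \<alpha> D F \<longleftrightarrow>
    (\<forall>us. dynamic_graph n \<alpha> us \<longrightarrow>
      is_orientation (orient us) (graph_after us) \<and>
      (\<forall>v < n. out_degree (orient us) v \<le> D) \<and>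
      real (\<Sum>i < length us. flips (orient (take i us)) (orient (take (Suc i) us)))
        \<le> F * real (length us))"


section \<open>Deterministic algorithms: a word RAM\<close>

text \<open>
  Programs of a word RAM with \<open>w\<close>-bit words, written in structured form.  The memory and the
  registers hold words, arithmetic is modulo \<open>2 ^ w\<close> (subtraction is truncated at zero), and every
  operation, memory access, test and assignment takes one unit of time.
\<close>

datatype exp =
    Lit nat
  | Reg nat
  | Mem exp
  | Add exp exp
  | Sub exp exp
  | Mul exp exp
  | Quo exp exp
  | Rem exp exp

datatype test = Less exp exp | Equal exp exp | Neg test | And test test

datatype com =
    Skip
  | Assign nat exp
  | Store exp exp
  | Seq com com
  | Cond test com com
  | While test com

type_synonym state = "(nat \<Rightarrow> nat) \<times> (nat \<Rightarrow> nat)"  \<comment> \<open>registers and memory\<close>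

fun val :: "nat \<Rightarrow> state \<Rightarrow> exp \<Rightarrow> nat" where
  "val w s (Lit c) = c mod 2 ^ w"
| "val w s (Reg i) = fst s i"
| "val w s (Mem a) = snd s (val w s a)"
| "val w s (Add a b) = (val w s a + val w s b) mod 2 ^ w"
| "val w s (Sub a b) = val w s a - val w s b"
| "val w s (Mul a b) = (val w s a * val w s b) mod 2 ^ w"
| "val w s (Quo a b) = val w s a div val w s b"
| "val w s (Rem a b) = val w s a mod val w s b"

fun holds :: "nat \<Rightarrow> state \<Rightarrow> test \<Rightarrow> bool" where
  "holds w s (Less a b) \<longleftrightarrow> val w s a < val w s b"
| "holds w s (Equal a b) \<longleftrightarrow> val w s a = val w s b"
| "holds w s (Neg p) \<longleftrightarrow> \<not> holds w s p"
| "holds w s (And p q) \<longleftrightarrow> holds w s p \<and> holds w s q"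

fun exp_cost :: "exp \<Rightarrow> nat" where
  "exp_cost (Lit c) = 1"
| "exp_cost (Reg i) = 1"
| "exp_cost (Mem a) = 1 + exp_cost a"
| "exp_cost (Add a b) = 1 + exp_cost a + exp_cost b"
| "exp_cost (Sub a b) = 1 + exp_cost a + exp_cost b"
| "exp_cost (Mul a b) = 1 + exp_cost a + exp_cost b"
| "exp_cost (Quo a b) = 1 + exp_cost a + exp_cost b"
| "exp_cost (Rem a b) = 1 + exp_cost a + exp_cost b"

fun test_cost :: "test \<Rightarrow> nat" where
  "test_cost (Less a b) = 1 + exp_cost a + exp_cost b"
| "test_cost (Equal a b) = 1 + exp_cost a + exp_cost b"
| "test_cost (Neg p) = 1 + test_cost p"
| "test_cost (And p q) = 1 + test_cost p + test_cost q"

text \<open>\<open>exec w c s t s'\<close>: started in \<open>s\<close>, the program \<open>c\<close> halts in \<open>s'\<close> after time \<open>t\<close>.\<close>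

inductive exec :: "nat \<Rightarrow> com \<Rightarrow> state \<Rightarrow> nat \<Rightarrow> state \<Rightarrow> bool" for w where
  Skip: "exec w Skip s 1 s"
| Assign: "exec w (Assign i e) s (1 + exp_cost e) ((fst s)(i := val w s e), snd s)"
| Store: "exec w (Store a e) s (1 + exp_cost a + exp_cost e)
    (fst s, (snd s)(val w s a := val w s e))"
| Seq: "exec w c1 s t1 s1 \<Longrightarrow> exec w c2 s1 t2 s2 \<Longrightarrow> exec w (Seq c1 c2) s (t1 + t2) s2"
| CondTrue: "holds w s p \<Longrightarrow> exec w c1 s t s' \<Longrightarrow>
    exec w (Cond p c1 c2) s (1 + test_cost p + t) s'"
| CondFalse: "\<not> holds w s p \<Longrightarrow> exec w c2 s t s' \<Longrightarrow>
    exec w (Cond p c1 c2) s (1 + test_cost p + t) s'"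
| WhileFalse: "\<not> holds w s p \<Longrightarrow> exec w (While p c) s (1 + test_cost p) s"
| WhileTrue: "holds w s p \<Longrightarrow> exec w c s t1 s1 \<Longrightarrow> exec w (While p c) s1 t2 s2 \<Longrightarrow>
    exec w (While p c) s (1 + test_cost p + t1 + t2) s2"

inductive_cases exec_SkipE: "exec w Skip s t s'"
inductive_cases exec_AssignE: "exec w (Assign i e) s t s'"
inductive_cases exec_StoreE: "exec w (Store a e) s t s'"
inductive_cases exec_SeqE: "exec w (Seq c1 c2) s t s'"
inductive_cases exec_CondE: "exec w (Cond p c1 c2) s t s'"
inductive_cases exec_WhileE: "exec w (While p c) s t s'"

lemma exec_deterministic:
  "exec w c s t s' \<Longrightarrow> exec w c s t2 s2 \<Longrightarrow> t2 = t \<and> s2 = s'"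
proof (induction arbitrary: t2 s2 rule: exec.induct)
  case Skip then show ?case by (auto elim: exec_SkipE)
next
  case Assign then show ?case by (auto elim: exec_AssignE)
next
  case Store then show ?case by (auto elim: exec_StoreE)
next
  case Seq from Seq.prems show ?case by (rule exec_SeqE) (metis Seq.IH)
next
  case CondTrue from CondTrue.prems show ?case
    by (rule exec_CondE) (metis CondTrue.IH CondTrue.hyps(1) plus_1_eq_Suc add_Suc)+
next
  case CondFalse from CondFalse.prems show ?case
    by (rule exec_CondE) (metis CondFalse.IH CondFalse.hyps(1) plus_1_eq_Suc add_Suc)+
next
  case WhileFalse from WhileFalse.prems show ?case
    by (rule exec_WhileE) (auto simp: WhileFalse.hyps)
next
  case WhileTrue from WhileTrue.prems show ?case
    by (rule exec_WhileE) (metis WhileTrue.IH WhileTrue.hyps(1) plus_1_eq_Suc add_Suc)+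
qed

text \<open>Arguments are passed in the registers \<open>0, 1, \<dots>\<close>; everything else is kept.\<close>

definition with_args :: "nat list \<Rightarrow> state \<Rightarrow> state" where
  "with_args xs s = ((\<lambda>i. if i < length xs then xs ! i else fst s i), snd s)"

definition zero_state :: state where
  "zero_state = ((\<lambda>_. 0), (\<lambda>_. 0))"

fun update_args :: "update \<Rightarrow> nat list" where
  "update_args (Insert u v) = [1, u, v]"
| "update_args (Delete u v) = [0, u, v]"

text \<open>\<open>run w c s us t s'\<close>: processing the updates \<open>us\<close> one after the other with the program \<open>c\<close>
  leads from \<open>s\<close> to \<open>s'\<close> in total time \<open>t\<close>.\<close>

inductive run :: "nat \<Rightarrow> com \<Rightarrow> state \<Rightarrow> update list \<Rightarrow> nat \<Rightarrow> state \<Rightarrow> bool" for w c where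
  Nil: "run w c s [] 0 s"
| Cons: "exec w c (with_args (update_args u) s) t1 s1 \<Longrightarrow> run w c s1 us t2 s2 \<Longrightarrow>
    run w c s (u # us) (t1 + t2) s2"


section \<open>Maintaining a layered data structure\<close>

text \<open>The partition into layers \<open>1, \<dots>, k\<close> is given by the layer \<open>l v\<close> of each vertex \<open>v\<close>.\<close>

definition layer :: "nat \<Rightarrow> (nat \<Rightarrow> nat) \<Rightarrow> nat \<Rightarrow> nat set" where
  "layer n l i = {v. v < n \<and> l v = i}"

definition is_lds :: "nat \<Rightarrow> nat set set \<Rightarrow> nat \<Rightarrow> nat \<Rightarrow> (nat \<Rightarrow> nat) \<Rightarrow> bool" where
  "is_lds n E k \<Delta> l \<longleftrightarrow>
    (\<forall>v < n. l v \<in> {1..k}) \<and>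
    (\<forall>v < n. card {u. u < n \<and> {v, u} \<in> E \<and> l v \<le> l u} \<le> \<Delta>)"

text \<open>
  A dynamic algorithm consists of two programs and of expressions through which the maintained
  structure is read off the current state.  Being fixed loop-free expressions, the latter take
  constant time and leave the state unchanged.
  \<^item> \<open>init\<close>: initialisation, with arguments \<open>n\<close>, \<open>\<alpha>\<close>, \<open>D\<close>;
  \<^item> \<open>step\<close>: one update, with arguments the kind of the update (1 for an insertion, 0 for a
    deletion) and the two endpoints of the edge;
  \<^item> \<open>layer_of\<close>: the layer of vertex \<open>v\<close> (argument \<open>v\<close>);
  \<^item> \<open>layer_size\<close>, \<open>layer_elem\<close>: the number of vertices of layer \<open>i\<close> and its \<open>j\<close>-th vertex
    (arguments \<open>i\<close> and \<open>i\<close>, \<open>j\<close>);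
  \<^item> \<open>degree\<close>, \<open>neighbor\<close>: the degree of \<open>v\<close> and its \<open>j\<close>-th neighbor in the subgraph induced by
    the layer of \<open>v\<close> (arguments \<open>v\<close> and \<open>v\<close>, \<open>j\<close>).
\<close>

record algorithm =
  init :: com
  step :: com
  layer_of :: exp
  layer_size :: exp
  layer_elem :: exp
  degree :: exp
  neighbor :: exp

definition read :: "nat \<Rightarrow> state \<Rightarrow> exp \<Rightarrow> nat list \<Rightarrow> nat" where
  "read w s e xs = val w (with_args xs s) e"

text \<open>The state holds an LDS of the graph, and for each layer the list of its vertices and the
  adjacency lists of the subgraph it induces.\<close>

definition represents_lds ::
  "nat \<Rightarrow> algorithm \<Rightarrow> state \<Rightarrow> nat \<Rightarrow> nat set set \<Rightarrow> nat \<Rightarrow> nat \<Rightarrow> bool" where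
  "represents_lds w A s n E k \<Delta> \<longleftrightarrow>
    (let l = (\<lambda>v. read w s (layer_of A) [v]) in
      is_lds n E k \<Delta> l \<and>
      (\<forall>i \<in> {1..k}.
        bij_betw (\<lambda>j. read w s (layer_elem A) [i, j])
          {..<read w s (layer_size A) [i]} (layer n l i) \<and>
        (\<forall>v \<in> layer n l i.
          bij_betw (\<lambda>j. read w s (neighbor A) [v, j])
            {..<read w s (degree A) [v]} {u. {v, u} \<in> induced E (layer n l i)})))"

text \<open>\<open>T0\<close> bounds the time for the initialisation (the empty graph) and \<open>T\<close> the amortized time per
  update.\<close>

definition maintains_lds ::
  "nat \<Rightarrow> algorithm \<Rightarrow> nat \<Rightarrow> nat \<Rightarrow> nat \<Rightarrow> nat \<Rightarrow> nat \<Rightarrow> real \<Rightarrow> real \<Rightarrow> bool" where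
  "maintains_lds w A n \<alpha> D k \<Delta> T0 T \<longleftrightarrow>
    (\<exists>t0 s0. exec w (init A) (with_args [n, \<alpha>, D] zero_state) t0 s0 \<and> real t0 \<le> T0 \<and>
      (\<forall>us. dynamic_graph n \<alpha> us \<longrightarrow>
        (\<exists>t s. run w (step A) s0 us t s \<and> real t \<le> T * real (length us) \<and>
          represents_lds w A s n (graph_after us) k \<Delta>)))"

end

theory Submission
  imports Defs
begin

text \<open>
  Only edges that have been recorded count for the layers; the others wait on a stack of pending
  edges, which an update processes until it is empty.  When recording an edge gives a vertex \<open>v\<close> more
  than \<open>\<Delta> = 4D + 9\<alpha>K\<close> recorded neighbours in its own or higher layers, where \<open>n < 2\<^sup>K\<^sup>-\<^sup>1\<close>, all these
  edges become pending again and \<open>v\<close> is promoted to the top layer \<open>K\<close>.  Since \<open>n < 2\<^sup>K\<^sup>-\<^sup>1\<close>, the number of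
  vertices above some layer \<open>i\<close> then exceeds the number of vertices in layer \<open>i\<close>; for the highest such
  \<open>i\<close>, all layers from \<open>i\<close> upwards are collapsed into layer \<open>i\<close>, and the edges inside become pending.

  The given orientation is used in the analysis only.  Call an arc bad if its tail is not in a lower
  layer than its head.  A promotion makes at least \<open>\<Delta> + 1 - D\<close> arcs good and at most \<open>D\<close> arcs bad.
  A collapse that lowers \<open>g\<close> vertices affects fewer than \<open>2g\<close> vertices, hence at most \<open>2\<alpha>g\<close> edges, and
  is paid for by a credit of order \<open>\<alpha>\<close> per vertex and layer; the promotions provide this credit, which
  is where the summand \<open>\<alpha> log n\<close> of \<open>\<Delta>\<close> comes from.  A flip changes the number of bad arcs by at most one.
\<close>

section \<open>Weakest preconditions and array-backed sets\<close>

text \<open>The rule that supplies the orientation is an arbitrary function and not a program, so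
  the data structure cannot consult it; it can enter only through a potential. A vertex may have far
  more than \<Delta> neighbours below it, and a promotion must not pay for them. Hence an edge
  between two layers is listed at its lower endpoint only, and what a vertex lists is exactly what
  counts for its bound. A collapse could leave many vertices over the bound at once. Taking every
  edge inside the collapsed part out of the record restores the bound for these vertices trivially,
  and since edges return one at a time, a vertex ever exceeds the bound by exactly one. The price is
  that a round may undo much earlier recording, so the number of pending edges is no termination
  measure. The potential takes its place: it bounds the running time and proves termination at the
  same time.\<close>

definition wp :: "nat \<Rightarrow> com \<Rightarrow> state \<Rightarrow> (nat \<Rightarrow> state \<Rightarrow> bool) \<Rightarrow> bool" where
  "wp w c s Post \<longleftrightarrow> (\<exists>t s'. exec w c s t s' \<and> Post t s')"

lemma wp_Skip: "wp w Skip s Post \<longleftrightarrow> Post 1 s"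
  unfolding wp_def by (metis exec.Skip exec_SkipE)

lemma wp_Assign: "wp w (Assign i e) s Post \<longleftrightarrow>
    Post (1 + exp_cost e) ((fst s)(i := val w s e), snd s)"
  by (force simp: wp_def intro: exec.Assign elim: exec_AssignE)

lemma wp_Store: "wp w (Store a e) s Post \<longleftrightarrow>
    Post (1 + exp_cost a + exp_cost e) (fst s, (snd s)(val w s a := val w s e))"
  by (force simp: wp_def intro: exec.Store elim: exec_StoreE)

lemma wp_Seq: "wp w (Seq c1 c2) s Post \<longleftrightarrow>
    wp w c1 s (\<lambda>t1 s1. wp w c2 s1 (\<lambda>t2. Post (t1 + t2)))"
  unfolding wp_def by (blast intro: exec.Seq elim: exec_SeqE)

lemma wp_Cond: "wp w (Cond p c1 c2) s Post \<longleftrightarrow>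
    wp w (if holds w s p then c1 else c2) s (\<lambda>t. Post (1 + test_cost p + t))"
proof -
  have "exec w (Cond p c1 c2) s t s' \<longleftrightarrow>
      (\<exists>t'. t = 1 + test_cost p + t' \<and> exec w (if holds w s p then c1 else c2) s t' s')" for t s'
    by (auto intro: exec.CondTrue[simplified] exec.CondFalse[simplified] elim!: exec_CondE)
  then show ?thesis unfolding wp_def by (simp only:) blast
qed

lemmas wp_simps = wp_Skip wp_Assign wp_Store wp_Seq wp_Cond

lemma wp_mono: "wp w c s Post \<Longrightarrow> (\<And>t s'. Post t s' \<Longrightarrow> Post' t s') \<Longrightarrow> wp w c s Post'"
  unfolding wp_def by blast

text \<open>The number \<open>m\<close> is a potential: it pays for every round of the loop.\<close>

lemma wp_While:
  assumes inv: "Inv s m"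
    and body: "\<And>s m. Inv s m \<Longrightarrow> holds w s p \<Longrightarrow>
      wp w c s (\<lambda>t s'. \<exists>m'. Inv s' m' \<and> 1 + test_cost p + t + m' \<le> m)"
  shows "wp w (While p c) s
    (\<lambda>t s'. \<exists>m'. Inv s' m' \<and> \<not> holds w s' p \<and> t + m' \<le> m + 1 + test_cost p)"
  using inv
proof (induction m arbitrary: s rule: less_induct)
  case (less m)
  show ?case
  proof (cases "holds w s p")
    case True
    from body[OF less.prems True] obtain t s' m' where
      1: "exec w c s t s'" "Inv s' m'" "1 + test_cost p + t + m' \<le> m" unfolding wp_def by blast
    from less.IH[of m' s'] 1 obtain t2 s2 m2 where
      2: "exec w (While p c) s' t2 s2" "Inv s2 m2" "\<not> holds w s2 p" "t2 + m2 \<le> m' + 1 + test_cost p"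
      unfolding wp_def by auto
    have "exec w (While p c) s (1 + test_cost p + t + t2) s2"
      by (rule exec.WhileTrue[OF True 1(1) 2(1)])
    moreover have "1 + test_cost p + t + t2 + m2 \<le> m + 1 + test_cost p"
      using 1(3) 2(4) by simp
    ultimately show ?thesis unfolding wp_def using 2 by blast
  next
    case False
    from exec.WhileFalse[OF this] less.prems False show ?thesis
      unfolding wp_def by (intro exI[of _ "1 + test_cost p"] exI[of _ s]) auto
  qed
qed

text \<open>The first \<open>c\<close> entries of the array \<open>el\<close> enumerate \<open>A\<close>; the array \<open>ps\<close> holds their positions, shifted
  by one, so that memory filled with zeros represents the empty set.\<close>

definition slist :: "nat \<Rightarrow> nat \<Rightarrow> (nat \<Rightarrow> nat) \<Rightarrow> (nat \<Rightarrow> nat) \<Rightarrow> nat set \<Rightarrow> bool" where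
  "slist n c el ps A \<longleftrightarrow> A \<subseteq> {..<n} \<and> c = card A \<and>
    (\<forall>j<c. el j \<in> A \<and> ps (el j) = Suc j) \<and>
    (\<forall>v\<in>A. 1 \<le> ps v \<and> ps v \<le> c \<and> el (ps v - 1) = v) \<and>
    (\<forall>v<n. v \<notin> A \<longrightarrow> ps v = 0)"

lemma slist_finite: "slist n c el ps A \<Longrightarrow> finite A"
  unfolding slist_def using finite_subset by blast

lemma slist_card_le: "slist n c el ps A \<Longrightarrow> c \<le> n"
  unfolding slist_def using card_mono[of "{..<n}" A] by auto

lemma slist_insert:
  assumes "slist n c el ps A" "v < n" "v \<notin> A"
  shows "slist n (Suc c) (el(c := v)) (ps(v := Suc c)) (insert v A)"
  using assms slist_finite[OF assms(1)] unfolding slist_def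
  by (auto simp: less_Suc_eq)

text \<open>The last entry of \<open>el\<close> fills the hole. The position of \<open>v\<close> is
  cleared last, so the same formula is right when \<open>v\<close> is itself the last entry.\<close>

lemma slist_remove:
  assumes sl: "slist n c el ps A" and v: "v \<in> A"
  shows "slist n (c - 1) (el(ps v - 1 := el (c - 1))) (ps(el (c - 1) := ps v, v := 0)) (A - {v})"
proof -
  define p where "p = ps v - 1"
  define l where "l = el (c - 1)"
  have fin: "finite A" by (rule slist_finite[OF sl])
  have c: "c = card A" "c > 0" using sl v fin unfolding slist_def by (auto simp: card_gt_0_iff)
  have e: "el j \<in> A" "ps (el j) = Suc j" if "j < c" for j using sl that unfolding slist_def by auto
  have q: "1 \<le> ps u" "ps u \<le> c" "el (ps u - 1) = u" if "u \<in> A" for u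
    using sl that unfolding slist_def by auto
  have p: "ps v = Suc p" "p < c" "el p = v" using q[OF v] by (auto simp: p_def)
  have l: "l \<in> A" "ps l = c" using e[of "c - 1"] c by (auto simp: l_def)
  have 1: "(el(p := l)) j \<in> A - {v} \<and> (ps(l := ps v, v := 0)) ((el(p := l)) j) = Suc j"
    if j: "j < c - 1" for j
  proof (cases "j = p")
    case True
    then have "l \<noteq> v" using j l p by auto
    then show ?thesis using True l p by auto
  next
    case False
    have jc: "j < c" using j by simp
    have "el j \<noteq> v" using e[OF jc] p False by auto
    moreover have "el j \<noteq> l" using e[OF jc] l j by auto
    ultimately show ?thesis using e[OF jc] j False by auto
  qed
  have 2: "1 \<le> (ps(l := ps v, v := 0)) u \<and> (ps(l := ps v, v := 0)) u \<le> c - 1 \<and>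
      (el(p := l)) ((ps(l := ps v, v := 0)) u - 1) = u" if u: "u \<in> A - {v}" for u
  proof (cases "u = l")
    case True
    then have "ps v \<noteq> c" using u l p by (metis DiffD2 l_def diff_Suc_1 singletonI)
    then show ?thesis using True u p by auto
  next
    case False
    have "ps u \<noteq> ps v" using q[of u] q[OF v] u by auto
    moreover have "ps u \<noteq> c" using q[of u] u False by (auto simp: l_def)
    ultimately show ?thesis using q[of u] u False p by auto
  qed
  have 3: "A - {v} \<subseteq> {..<n}" "c - 1 = card (A - {v})"
    "\<forall>u<n. u \<notin> A - {v} \<longrightarrow> (ps(l := ps v, v := 0)) u = 0"
    using sl v fin c l unfolding slist_def by auto
  show ?thesis unfolding slist_def p_def[symmetric] l_def[symmetric]
    using 1 2 3 by blast
qed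

section \<open>Memory layout and set operations\<close>

abbreviation seqs (infixr ";;" 60) where "c1 ;; c2 \<equiv> Seq c1 c2"

text \<open>
  Cell \<open>(x, y)\<close> of array \<open>a < 16\<close> is stored at \<open>a + 16 (x + Q y)\<close>, where \<open>x < Q\<close>.  A family of sets takes
  three consecutive arrays: sizes (at \<open>y = 0\<close>), elements and positions.  Arrays \<open>0\<close>--\<open>2\<close> hold the recorded
  neighbours of \<open>x\<close> in the layer of \<open>x\<close>, \<open>3\<close>--\<open>5\<close> those in higher layers, \<open>6\<close>--\<open>8\<close> the vertices of
  layer \<open>x\<close>, \<open>9\<close> the layer of each vertex, \<open>10\<close> and \<open>11\<close> the endpoints of the pending edges.
  Registers \<open>3\<close>, \<open>4\<close>, \<open>5\<close>, \<open>6\<close> permanently hold \<open>Q\<close>, \<open>K\<close>, \<open>\<Delta>\<close> and the number of pending edges.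
\<close>

definition AddrE :: "nat \<Rightarrow> exp \<Rightarrow> exp \<Rightarrow> exp" where
  "AddrE a x y = Add (Lit a) (Mul (Lit 16) (Add x (Mul (Reg 3) y)))"

lemma exp_cost_AddrE: "exp_cost (AddrE a x y) = 7 + exp_cost x + exp_cost y"
  by (simp add: AddrE_def)

abbreviation CellE :: "nat \<Rightarrow> exp \<Rightarrow> exp \<Rightarrow> exp" where
  "CellE a x y \<equiv> Mem (AddrE a x y)"

abbreviation sizeE :: "nat \<Rightarrow> exp \<Rightarrow> exp" where
  "sizeE a x \<equiv> CellE a x (Lit 0)"

definition ins_com :: "nat \<Rightarrow> nat \<Rightarrow> nat \<Rightarrow> com" where
  "ins_com a i j =
    Store (AddrE (a + 1) (Reg i) (sizeE a (Reg i))) (Reg j) ;;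
    Store (AddrE (a + 2) (Reg i) (Reg j)) (Add (sizeE a (Reg i)) (Lit 1)) ;;
    Store (AddrE a (Reg i) (Lit 0)) (Add (sizeE a (Reg i)) (Lit 1))"

text \<open>Position zero marks absence, so removing an absent element is a no-op and callers need
  not know whether it is present. Registers 16 and 17 keep the position and the last element, since
  the stores overwrite the cells they come from.\<close>

definition rmv_com :: "nat \<Rightarrow> nat \<Rightarrow> nat \<Rightarrow> com" where
  "rmv_com a i j =
    Cond (Equal (CellE (a + 2) (Reg i) (Reg j)) (Lit 0)) Skip
     (Assign 16 (CellE (a + 2) (Reg i) (Reg j)) ;;
      Assign 17 (CellE (a + 1) (Reg i) (Sub (sizeE a (Reg i)) (Lit 1))) ;;
      Store (AddrE (a + 1) (Reg i) (Sub (Reg 16) (Lit 1))) (Reg 17) ;;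
      Store (AddrE (a + 2) (Reg i) (Reg 17)) (Reg 16) ;;
      Store (AddrE (a + 2) (Reg i) (Reg j)) (Lit 0) ;;
      Store (AddrE a (Reg i) (Lit 0)) (Sub (sizeE a (Reg i)) (Lit 1)))"

definition set_list :: "(nat \<Rightarrow> nat \<Rightarrow> nat set) \<Rightarrow> nat \<Rightarrow> nat \<Rightarrow> nat set \<Rightarrow> nat \<Rightarrow> nat \<Rightarrow> nat set" where
  "set_list A a x B = A(a := (A a)(x := B))"

text \<open>Columns are indexed by vertices as well as by layers, so \<open>Q\<close> exceeds both.
  The second coordinate goes up to \<open>n * n\<close> because the stack of pending edges may hold
  that many entries; \<open>big\<close> says that the 16 arrays of this size have addresses that fit
  into a word.\<close>

locale ram =
  fixes w n Q K \<Delta> :: nat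
  assumes n2: "2 \<le> n" and nQ: "n \<le> Q" and KQ: "K < Q" and K2: "n < 2 ^ (K - 1)"
    and big: "16 * Q * (n * n + 1) \<le> 2 ^ w"
begin

section \<open>Addresses and absence of overflow\<close>

definition addr :: "nat \<Rightarrow> nat \<Rightarrow> nat \<Rightarrow> nat" where
  "addr a x y = a + 16 * (x + Q * y)"

definition cell :: "state \<Rightarrow> nat \<Rightarrow> nat \<Rightarrow> nat \<Rightarrow> nat" where
  "cell s a x y = snd s (addr a x y)"

lemma addr_eq_iff: "a < 16 \<Longrightarrow> a' < 16 \<Longrightarrow> x < Q \<Longrightarrow> x' < Q \<Longrightarrow>
    addr a x y = addr a' x' y' \<longleftrightarrow> a = a' \<and> x = x' \<and> y = y'"
proof
  assume a: "a < 16" "a' < 16" "x < Q" "x' < Q" and e: "addr a x y = addr a' x' y'"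
  have 1: "addr a x y mod 16 = a" "addr a' x' y' mod 16 = a'" using a
    by (simp_all only: addr_def mod_mult_self2 mod_less)
  have 2: "addr a x y div 16 = x + Q * y" "addr a' x' y' div 16 = x' + Q * y'"
    using a by (simp_all only: addr_def div_mult_self2 div_less numeral_neq_zero if_True simp_thms)
  have 3: "(x + Q * y) mod Q = x" "(x' + Q * y') mod Q = x'"
    "(x + Q * y) div Q = y" "(x' + Q * y') div Q = y'" using a by auto
  show "a = a' \<and> x = x' \<and> y = y'" using 1 2 3 e by metis
qed auto

lemma addr_less: "a < 16 \<Longrightarrow> x < Q \<Longrightarrow> y \<le> n * n \<Longrightarrow> addr a x y < 2 ^ w"
proof -
  assume a: "a < 16" "x < Q" "y \<le> n * n"
  then have "Suc x + Q * y \<le> Q + Q * (n * n)" by (intro add_le_mono) auto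
  then have "16 * Suc (x + Q * y) \<le> 16 * (Q + Q * (n * n))" by (intro mult_le_mono2) simp
  then have "addr a x y < 16 * (Q + Q * (n * n))" unfolding addr_def using a
    by (elim less_le_trans[rotated]) simp
  also have "\<dots> = 16 * Q * (n * n + 1)" by simp
  finally have "addr a x y < 16 * Q * (n * n + 1)" .
  with big show ?thesis by linarith
qed

lemma small: "(c :: nat) < 16 * (n * n + 1) \<Longrightarrow> c mod 2 ^ w = c"
proof -
  assume "c < 16 * (n * n + 1)"
  also have "\<dots> \<le> 16 * Q * (n * n + 1)" using n2 nQ by (intro mult_le_mono) auto
  finally show ?thesis using big by simp
qed

text \<open>80 is the bound of \<open>small\<close> at the least admissible \<open>n\<close>, namely
  16 * (2 * 2 + 1).\<close>

lemma small_lit: "(c :: nat) < 80 \<Longrightarrow> c mod 2 ^ w = c"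
proof -
  assume "c < 80"
  moreover have "2 * 2 \<le> n * n" using n2 by (intro mult_le_mono)
  ultimately show ?thesis by (intro small) simp
qed

lemma small_n: "c \<le> n \<Longrightarrow> Suc c mod 2 ^ w = Suc c"
proof (rule small)
  assume "c \<le> n"
  also have "n \<le> n * n" by (rule le_square)
  finally show "Suc c < 16 * (n * n + 1)" by simp
qed

lemma val_Lit: "c < 80 \<Longrightarrow> val w s (Lit c) = c"
  using small_lit by simp

lemma val_AddrE:
  assumes "fst s 3 = Q" "a < 16" "val w s x < Q" "val w s y \<le> n * n"
  shows "val w s (AddrE a x y) = addr a (val w s x) (val w s y)"
proof -
  let ?x = "val w s x" and ?y = "val w s y"
  have "addr a ?x ?y < 2 ^ w" using assms by (intro addr_less)
  then show ?thesis using assms unfolding addr_def AddrE_def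
    by (simp add: small_lit)
qed

lemma cell_store:
  "a < 16 \<Longrightarrow> b < 16 \<Longrightarrow> x < Q \<Longrightarrow> x' < Q \<Longrightarrow>
    cell (r, m(addr b x' y' := v)) a x y = (if a = b \<and> x = x' \<and> y = y' then v else cell (r, m) a x y)"
  by (auto simp: cell_def addr_eq_iff)

lemma cell_fst: "cell (r, snd s) = cell s"
  by (simp add: cell_def fun_eq_iff)

lemma val_CellE:
  assumes "fst s 3 = Q" "a < 16" "val w s x < Q" "val w s y \<le> n * n"
  shows "val w s (CellE a x y) = cell s a (val w s x) (val w s y)"
  using val_AddrE[OF assms] by (simp add: cell_def)

lemma le_nn: "c \<le> n \<Longrightarrow> c \<le> n * n"
  using n2 by (meson le_trans le_square)

text \<open>The families \<open>A\<close> are left arbitrary, so that the states in the middle of an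
  operation, where the lists match no set of recorded edges, can be described as well.\<close>

definition rep :: "state \<Rightarrow> (nat \<Rightarrow> nat \<Rightarrow> nat set) \<Rightarrow> (nat \<Rightarrow> nat) \<Rightarrow> (nat \<times> nat) list \<Rightarrow> bool" where
  "rep s A lev P \<longleftrightarrow> fst s 3 = Q \<and> fst s 4 = K \<and> fst s 5 = \<Delta> \<and> fst s 6 = length P \<and>
    (\<forall>a\<in>{0,3,6}. \<forall>x<Q. slist n (cell s a x 0) (cell s (a + 1) x) (cell s (a + 2) x) (A a x)) \<and>
    (\<forall>v<n. cell s 9 v 0 = lev v) \<and>
    (\<forall>j<length P. cell s 10 0 j = fst (P ! j) \<and> cell s 11 0 j = snd (P ! j))"

text \<open>Symbolic execution, stated for all sixteen arrays at once so that the frame conditions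
  of \<open>rep_set_list\<close> can be read off.\<close>

lemma ins_low:
  assumes "fst s 3 = Q" "a \<le> 6" "fst s i < Q" "fst s j < n" "cell s a (fst s i) 0 \<le> n"
  shows "wp w (ins_com a i j) s (\<lambda>t s'. t \<le> 90 \<and> fst s' = fst s \<and>
    (\<forall>b<16. \<forall>y<Q. cell s' b y =
      (if b = a + 1 \<and> y = fst s i then (cell s b y)(cell s a (fst s i) 0 := fst s j)
       else if b = a + 2 \<and> y = fst s i then (cell s b y)(fst s j := Suc (cell s a (fst s i) 0))
       else if b = a \<and> y = fst s i then (cell s b y)(0 := Suc (cell s a (fst s i) 0))
       else cell s b y)))"
  using assms unfolding ins_com_def
  by (auto simp: wp_simps val_AddrE val_CellE val_Lit cell_store cell_fst le_nn small_n exp_cost_AddrE fun_eq_iff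
      simp del: val.simps(1,3))

lemma rep_D:
  assumes "rep s A lev P"
  shows "fst s 3 = Q" "fst s 4 = K" "fst s 5 = \<Delta>" "fst s 6 = length P"
    "a \<in> {0,3,6} \<Longrightarrow> x < Q \<Longrightarrow> slist n (cell s a x 0) (cell s (a + 1) x) (cell s (a + 2) x) (A a x)"
    "v < n \<Longrightarrow> cell s 9 v 0 = lev v"
    "j < length P \<Longrightarrow> cell s 10 0 j = fst (P ! j)"
    "j < length P \<Longrightarrow> cell s 11 0 j = snd (P ! j)"
  using assms unfolding rep_def by blast+

lemma Q0: "0 < Q" using n2 nQ by simp

lemma rep_set_list:
  assumes rep: "rep s A lev P" and a: "a \<in> {0,3,6}" and x: "x < Q"
    and r: "\<And>r. r \<in> {3,4,5,6} \<Longrightarrow> fst s' r = fst s r"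
    and m: "\<And>b y. b < 16 \<Longrightarrow> y < Q \<Longrightarrow> b \<notin> {a, a+1, a+2} \<or> y \<noteq> x \<Longrightarrow> cell s' b y = cell s b y"
    and l: "slist n (cell s' a x 0) (cell s' (a + 1) x) (cell s' (a + 2) x) B"
  shows "rep s' (set_list A a x B) lev P"
proof -
  have "slist n (cell s' b y 0) (cell s' (b + 1) y) (cell s' (b + 2) y) (set_list A a x B b y)"
    if b: "b \<in> {0,3,6}" and y: "y < Q" for b y
  proof (cases "b = a \<and> y = x")
    case True
    then show ?thesis using l by (simp add: set_list_def)
  next
    case False
    have "cell s' b y = cell s b y" "cell s' (b + 1) y = cell s (b + 1) y" "cell s' (b + 2) y = cell s (b + 2) y"
      using False a b y by (auto intro!: m)
    then show ?thesis using False rep_D(5)[OF rep b y] by (auto simp: set_list_def)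
  qed
  moreover have "cell s' 9 v 0 = lev v" if "v < n" for v
    using m[of 9 v] that a nQ rep_D(6)[OF rep that] by auto
  moreover have "cell s' 10 0 = cell s 10 0" "cell s' 11 0 = cell s 11 0"
    using m[of 10 0] m[of 11 0] a Q0 by auto
  ultimately show ?thesis using rep r unfolding rep_def by auto
qed

lemma ins_wp:
  assumes rep: "rep s A lev P" and a: "a \<in> {0,3,6}" and x: "fst s i < Q" and v: "fst s j < n"
    and nin: "fst s j \<notin> A a (fst s i)"
  shows "wp w (ins_com a i j) s (\<lambda>t s'. t \<le> 90 \<and> fst s' = fst s \<and>
    rep s' (set_list A a (fst s i) (insert (fst s j) (A a (fst s i)))) lev P)"
proof -
  note sl = rep_D(5)[OF rep a x]
  have "cell s a (fst s i) 0 \<le> n" by (rule slist_card_le[OF sl])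
  from ins_low[OF rep_D(1)[OF rep] _ x v this] a
  have "wp w (ins_com a i j) s (\<lambda>t s'. t \<le> 90 \<and> fst s' = fst s \<and>
    (\<forall>b<16. \<forall>y<Q. cell s' b y =
      (if b = a + 1 \<and> y = fst s i then (cell s b y)(cell s a (fst s i) 0 := fst s j)
       else if b = a + 2 \<and> y = fst s i then (cell s b y)(fst s j := Suc (cell s a (fst s i) 0))
       else if b = a \<and> y = fst s i then (cell s b y)(0 := Suc (cell s a (fst s i) 0))
       else cell s b y)))" by fastforce
  then show ?thesis
  proof (rule wp_mono, elim conjE, intro conjI)
    fix t s'
    assume f: "fst s' = fst s" and m: "\<forall>b<16. \<forall>y<Q. cell s' b y =
      (if b = a + 1 \<and> y = fst s i then (cell s b y)(cell s a (fst s i) 0 := fst s j)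
       else if b = a + 2 \<and> y = fst s i then (cell s b y)(fst s j := Suc (cell s a (fst s i) 0))
       else if b = a \<and> y = fst s i then (cell s b y)(0 := Suc (cell s a (fst s i) 0))
       else cell s b y)"
    show "rep s' (set_list A a (fst s i) (insert (fst s j) (A a (fst s i)))) lev P"
    proof (rule rep_set_list[OF rep a x])
      show "slist n (cell s' a (fst s i) 0) (cell s' (a + 1) (fst s i)) (cell s' (a + 2) (fst s i))
          (insert (fst s j) (A a (fst s i)))"
      proof -
        have a6: "a \<le> 6" using a by auto
        have "cell s' a (fst s i) 0 = Suc (cell s a (fst s i) 0)" using m a6 x by simp
        moreover have "cell s' (a + 1) (fst s i) = (cell s (a + 1) (fst s i))
          (cell s a (fst s i) 0 := fst s j)"
          using m a6 x by simp
        moreover have "cell s' (a + 2) (fst s i) = (cell s (a + 2) (fst s i))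
          (fst s j := Suc (cell s a (fst s i) 0))"
          using m a6 x by simp
        ultimately show ?thesis using slist_insert[OF sl v nin] by (simp only:)
      qed
    qed (use f m in auto)
  qed auto
qed

lemma rmv_low:
  assumes "fst s 3 = Q" "a \<le> 6" "fst s i < Q" "fst s j < n" "i \<notin> {16,17}" "j \<notin> {16,17}"
    "cell s a (fst s i) 0 \<le> n" "cell s (a+2) (fst s i) (fst s j) \<le> n" "cell s (a+2) (fst s i) (fst s j) \<noteq> 0"
    "cell s (a+1) (fst s i) (cell s a (fst s i) 0 - 1) < n"
  shows "wp w (rmv_com a i j) s (\<lambda>t s'. t \<le> 150 \<and> (\<forall>r. r \<notin> {16,17} \<longrightarrow> fst s' r = fst s r) \<and>
    (\<forall>b<16. \<forall>y<Q. cell s' b y =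
      (if b = a + 1 \<and> y = fst s i then (cell s b y)(cell s (a+2) (fst s i) (fst s j) - 1
          := cell s (a+1) (fst s i) (cell s a (fst s i) 0 - 1))
       else if b = a + 2 \<and> y = fst s i then (cell s b y)
         (cell s (a+1) (fst s i) (cell s a (fst s i) 0 - 1) := cell s (a+2) (fst s i) (fst s j),
          fst s j := 0)
       else if b = a \<and> y = fst s i then (cell s b y)(0 := cell s a (fst s i) 0 - 1)
       else cell s b y)))"
  using assms unfolding rmv_com_def
  by (auto simp: wp_simps val_AddrE val_CellE val_Lit cell_store cell_fst le_nn small_n exp_cost_AddrE fun_eq_iff
      simp del: val.simps(1,3))

lemma rmv_low_Skip:
  assumes "fst s 3 = Q" "a \<le> 6" "fst s i < Q" "fst s j < n"
    "cell s (a+2) (fst s i) (fst s j) = 0"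
  shows "wp w (rmv_com a i j) s (\<lambda>t s'. t \<le> 150 \<and> s' = s)"
  using assms unfolding rmv_com_def
  by (simp add: wp_simps val_AddrE val_CellE val_Lit cell_store cell_fst le_nn small_n exp_cost_AddrE fun_eq_iff
      del: val.simps(1,3))

lemma set_list_same: "set_list A a x (A a x) = A"
  by (simp add: set_list_def)

lemma rmv_wp:
  assumes rep: "rep s A lev P" and a: "a \<in> {0,3,6}" and x: "fst s i < Q" and v: "fst s j < n"
    and ij: "i \<notin> {16,17}" "j \<notin> {16,17}"
  shows "wp w (rmv_com a i j) s (\<lambda>t s'. t \<le> 150 \<and> (\<forall>r. r \<notin> {16,17} \<longrightarrow> fst s' r = fst s r) \<and>
    rep s' (set_list A a (fst s i) (A a (fst s i) - {fst s j})) lev P)"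
proof (cases "fst s j \<in> A a (fst s i)")
  case False
  note sl = rep_D(5)[OF rep a x]
  have "cell s (a+2) (fst s i) (fst s j) = 0" using sl False v unfolding slist_def by auto
  moreover have "set_list A a (fst s i) (A a (fst s i) - {fst s j}) = A" using False
    by (simp add: set_list_same)
  moreover have "a \<le> 6" using a by auto
  ultimately show ?thesis using rep
    by (intro wp_mono[OF rmv_low_Skip[OF rep_D(1)[OF rep] _ x v]]) auto
next
  case True
  note sl = rep_D(5)[OF rep a x]
  let ?c = "cell s a (fst s i) 0"
  have 1: "?c \<le> n" by (rule slist_card_le[OF sl])
  have 2: "1 \<le> cell s (a+2) (fst s i) (fst s j)" "cell s (a+2) (fst s i) (fst s j) \<le> ?c"
    using sl True unfolding slist_def by auto
  have "?c - 1 < ?c" using 2 by linarith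
  then have "cell s (a+1) (fst s i) (?c - 1) \<in> A a (fst s i)" using sl unfolding slist_def by blast
  then have 3: "cell s (a+1) (fst s i) (?c - 1) < n" using sl unfolding slist_def by blast
  have "a \<le> 6" using a by auto
  have 4: "cell s (a+2) (fst s i) (fst s j) \<le> n" "cell s (a+2) (fst s i) (fst s j) \<noteq> 0"
    using 1 2 by linarith+
  show ?thesis
  proof (rule wp_mono[OF rmv_low[OF rep_D(1)[OF rep] \<open>a \<le> 6\<close> x v ij 1 4 3]])
    fix t s'
    let ?l = "cell s (a+1) (fst s i) (?c - 1)" and ?p = "cell s (a+2) (fst s i) (fst s j)"
    assume *: "t \<le> 150 \<and> (\<forall>r. r \<notin> {16,17} \<longrightarrow> fst s' r = fst s r) \<and>
     (\<forall>b<16. \<forall>y<Q. cell s' b y =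
      (if b = a + 1 \<and> y = fst s i then (cell s b y)(?p - 1 := ?l)
       else if b = a + 2 \<and> y = fst s i then (cell s b y)(?l := ?p, fst s j := 0)
       else if b = a \<and> y = fst s i then (cell s b y)(0 := ?c - 1)
       else cell s b y))"
    then have f: "fst s' r = fst s r" if "r \<notin> {16,17}" for r using that by blast
    have m: "cell s' b y =
      (if b = a + 1 \<and> y = fst s i then (cell s b y)(?p - 1 := ?l)
       else if b = a + 2 \<and> y = fst s i then (cell s b y)(?l := ?p, fst s j := 0)
       else if b = a \<and> y = fst s i then (cell s b y)(0 := ?c - 1)
       else cell s b y)" if "b < 16" "y < Q" for b y using * that by blast
    have "rep s' (set_list A a (fst s i) (A a (fst s i) - {fst s j})) lev P"
    proof (rule rep_set_list[OF rep a x])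
      show "slist n (cell s' a (fst s i) 0) (cell s' (a + 1) (fst s i)) (cell s' (a + 2) (fst s i))
          (A a (fst s i) - {fst s j})"
      proof -
        have "cell s' a (fst s i) 0 = ?c - 1" using m[of a "fst s i"] \<open>a \<le> 6\<close> x by simp
        moreover have "cell s' (a + 1) (fst s i) = (cell s (a + 1) (fst s i)) (?p - 1 := ?l)"
          using m[of "a + 1" "fst s i"] \<open>a \<le> 6\<close> x by simp
        moreover have "cell s' (a + 2) (fst s i) = (cell s (a + 2) (fst s i)) (?l := ?p, fst s j := 0)"
          using m[of "a + 2" "fst s i"] \<open>a \<le> 6\<close> x by simp
        ultimately show ?thesis using slist_remove[OF sl True] by (simp only:)
      qed
    next
      show "fst s' r = fst s r" if "r \<in> {3,4,5,6}" for r using f that by auto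
    next
      show "cell s' b y = cell s b y" if "b < 16" "y < Q" "b \<notin> {a, a+1, a+2} \<or> y \<noteq> fst s i" for b y
        unfolding m[OF that(1,2)] using that(3) by auto
    qed
    then show "t \<le> 150 \<and> (\<forall>r. r \<notin> {16,17} \<longrightarrow> fst s' r = fst s r) \<and>
      rep s' (set_list A a (fst s i) (A a (fst s i) - {fst s j})) lev P" using * by blast
  qed
qed

end

section \<open>The edge lists\<close>

text \<open>An edge stands either in two lists of family 0 or in one list of family 3. Trying all
  four places avoids inspecting the layers and is harmless because absent elements are
  skipped.\<close>

definition unrecord_com :: com where
  "unrecord_com = rmv_com 0 9 10 ;; rmv_com 0 10 9 ;; rmv_com 3 9 10 ;; rmv_com 3 10 9"

definition record_com :: com where
  "record_com =
    Cond (Less (CellE 9 (Reg 7) (Lit 0)) (CellE 9 (Reg 8) (Lit 0))) (ins_com 3 7 8)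
      (Cond (Less (CellE 9 (Reg 8) (Lit 0)) (CellE 9 (Reg 7) (Lit 0))) (ins_com 3 8 7)
        (ins_com 0 7 8 ;; ins_com 0 8 7))"

definition push_com :: "nat \<Rightarrow> nat \<Rightarrow> com" where
  "push_com i j =
    Store (AddrE 10 (Lit 0) (Reg 6)) (Reg i) ;;
    Store (AddrE 11 (Lit 0) (Reg 6)) (Reg j) ;;
    Assign 6 (Add (Reg 6) (Lit 1))"

definition pop_com :: com where
  "pop_com =
    Assign 6 (Sub (Reg 6) (Lit 1)) ;;
    Assign 7 (CellE 10 (Lit 0) (Reg 6)) ;;
    Assign 8 (CellE 11 (Lit 0) (Reg 6))"

definition last_com :: "nat \<Rightarrow> nat \<Rightarrow> nat \<Rightarrow> com" where
  "last_com a i j = Assign j (CellE (a + 1) (Reg i) (Sub (sizeE a (Reg i)) (Lit 1)))"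

definition setlev_com :: "nat \<Rightarrow> com" where
  "setlev_com j =
    Assign 14 (CellE 9 (Reg 9) (Lit 0)) ;;
    rmv_com 6 14 9 ;;
    ins_com 6 j 9 ;;
    Store (AddrE 9 (Reg 9) (Lit 0)) (Reg j)"

definition edges_ok :: "nat \<Rightarrow> nat set set \<Rightarrow> bool" where
  "edges_ok n E \<longleftrightarrow> (\<forall>e\<in>E. \<exists>u v. e = {u, v} \<and> u < n \<and> v < n \<and> u \<noteq> v)"

text \<open>The contents that the three families must have when \<open>R\<close> is recorded. The
  fixed default for other indices allows updates by \<open>set_list\<close> to be proved equal to
  \<open>lists_of\<close> as functions.\<close>

definition lists_of :: "nat \<Rightarrow> (nat \<Rightarrow> nat) \<Rightarrow> nat set set \<Rightarrow> nat \<Rightarrow> nat \<Rightarrow> nat set" where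
  "lists_of n lev R a x =
    (if a = 0 then {u. {x, u} \<in> R \<and> lev u = lev x}
     else if a = 3 then {u. {x, u} \<in> R \<and> lev x < lev u}
     else if a = 6 then {v. v < n \<and> lev v = x}
     else {})"

lemma edges_okD: "edges_ok n E \<Longrightarrow> {u, v} \<in> E \<Longrightarrow> u < n \<and> v < n \<and> u \<noteq> v"
  unfolding edges_ok_def by (fastforce simp: doubleton_eq_iff)

lemma edges_ok_subset: "edges_ok n E \<Longrightarrow> R \<subseteq> E \<Longrightarrow> edges_ok n R"
  unfolding edges_ok_def by blast

text \<open>Counting ordered pairs is crude but gives exactly the room reserved for the
  stack.\<close>

lemma edges_ok_finite_card:
  assumes "edges_ok n E"
  shows "finite E" "card E \<le> n * n"
proof -
  have sub: "E \<subseteq> (\<lambda>(u, v). {u, v}) ` ({..<n} \<times> {..<n})"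
  proof
    fix e assume "e \<in> E"
    then obtain u v where "e = {u, v}" "u < n" "v < n" using assms unfolding edges_ok_def by blast
    then show "e \<in> (\<lambda>(u, v). {u, v}) ` ({..<n} \<times> {..<n})"
      by (intro image_eqI[of _ _ "(u, v)"]) auto
  qed
  then show "finite E" by (rule finite_subset) simp
  have "card E \<le> card ({..<n} \<times> {..<n})" by (rule surj_card_le[OF _ sub]) simp
  then show "card E \<le> n * n" by simp
qed

context ram begin

lemma rep_reg: "r \<notin> {3,4,5,6} \<Longrightarrow> rep ((fst s)(r := v), snd s) A lev P \<longleftrightarrow> rep s A lev P"
  by (auto simp: rep_def cell_fst)

lemma unrecord_wp:
  assumes rep: "rep s (lists_of n lev R) lev P" and v: "fst s 9 = v" "v < n" and u: "fst s 10 = u" "u < n"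
  shows "wp w unrecord_com s (\<lambda>t s'. t \<le> 600 \<and> (\<forall>r. r \<notin> {16,17} \<longrightarrow> fst s' r = fst s r) \<and>
    rep s' (lists_of n lev (R - {{v, u}})) lev P)"
proof -
  let ?A0 = "lists_of n lev R"
  let ?A1 = "set_list ?A0 0 v (?A0 0 v - {u})"
  let ?A2 = "set_list ?A1 0 u (?A1 0 u - {v})"
  let ?A3 = "set_list ?A2 3 v (?A2 3 v - {u})"
  let ?A4 = "set_list ?A3 3 u (?A3 3 u - {v})"
  have A4: "?A4 = lists_of n lev (R - {{v, u}})"
    by (auto simp: fun_eq_iff set_list_def lists_of_def doubleton_eq_iff insert_commute)
  have Q: "v < Q" "u < Q" using u v nQ by auto
  show ?thesis unfolding unrecord_com_def wp_Seq
    apply (rule wp_mono[OF rmv_wp[OF rep]]; (simp add: u v Q)?)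
    apply (elim conjE)
    apply (rule wp_mono[OF rmv_wp], assumption; (simp add: u v Q)?)
    apply (elim conjE)
    apply (rule wp_mono[OF rmv_wp], assumption; (simp add: u v Q)?)
    apply (elim conjE)
    apply (rule wp_mono[OF rmv_wp], assumption; (simp add: u v Q)?)
    apply (simp add: A4)
    done
qed

lemma record_wp:
  assumes rep: "rep s (lists_of n lev R) lev P" and a: "fst s 7 = a" "a < n" and b: "fst s 8 = b" "b < n"
    and ab: "a \<noteq> b" "{a, b} \<notin> R"
  shows "wp w record_com s (\<lambda>t s'. t \<le> 300 \<and> fst s' = fst s \<and>
    rep s' (lists_of n lev (insert {a, b} R)) lev P)"
proof -
  let ?A0 = "lists_of n lev R"
  have Q: "a < Q" "b < Q" "0 < Q" using a b nQ by auto
  have ba: "{b, a} \<notin> R" using ab by (simp add: insert_commute)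
  have lev: "val w s (CellE 9 (Reg 7) (Lit 0)) = lev a" "val w s (CellE 9 (Reg 8) (Lit 0)) = lev b"
    using rep_D(1,6)[OF rep] a b Q by (simp_all add: val_CellE val_Lit del: val.simps(1,3))
  consider "lev a < lev b" | "lev b < lev a" | "lev a = lev b" by linarith
  then show ?thesis
  proof cases
    case 1
    have "set_list ?A0 3 a (insert b (?A0 3 a)) = lists_of n lev (insert {a, b} R)" using 1
      by (auto simp: fun_eq_iff set_list_def lists_of_def doubleton_eq_iff)
    then show ?thesis unfolding record_com_def
      using 1 ins_wp[OF rep, of 3 7 8] a b Q ab lev
      by (auto simp: wp_Cond exp_cost_AddrE lists_of_def simp del: val.simps(1,3) elim!: wp_mono)
  next
    case 2
    have "set_list ?A0 3 b (insert a (?A0 3 b)) = lists_of n lev (insert {a, b} R)" using 2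
      by (auto simp: fun_eq_iff set_list_def lists_of_def doubleton_eq_iff insert_commute)
    then show ?thesis unfolding record_com_def
      using 2 ins_wp[OF rep, of 3 8 7] a b Q ba lev
      by (auto simp: wp_Cond exp_cost_AddrE lists_of_def simp del: val.simps(1,3) elim!: wp_mono)
  next
    case 3
    let ?A1 = "set_list ?A0 0 a (insert b (?A0 0 a))"
    let ?A2 = "set_list ?A1 0 b (insert a (?A1 0 b))"
    have A: "?A2 = lists_of n lev (insert {a, b} R)" using 3 ab
      by (auto simp: fun_eq_iff set_list_def lists_of_def doubleton_eq_iff insert_commute)
    have "wp w (ins_com 0 7 8 ;; ins_com 0 8 7) s (\<lambda>t s'. t \<le> 180 \<and> fst s' = fst s \<and> rep s' ?A2 lev P)"
      unfolding wp_Seq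
      apply (rule wp_mono[OF ins_wp[OF rep]]; (simp add: a b Q)?)
      using ab apply (simp add: lists_of_def)
      apply (elim conjE)
      apply (rule wp_mono[OF ins_wp], assumption; (simp add: a b Q)?)
      using ba ab apply (simp add: lists_of_def set_list_def)
      done
    then show ?thesis unfolding record_com_def A
      using 3 lev by (auto simp: wp_Cond exp_cost_AddrE simp del: val.simps(1,3) elim!: wp_mono)
  qed
qed

lemma push_wp:
  assumes rep: "rep s A lev P" and P: "length P < n * n" and ij: "i \<noteq> 6" "j \<noteq> 6"
  shows "wp w (push_com i j) s (\<lambda>t s'. t \<le> 60 \<and> (\<forall>r. r \<noteq> 6 \<longrightarrow> fst s' r = fst s r) \<and>
    rep s' A lev (P @ [(fst s i, fst s j)]))"
proof -
  note D = rep_D(1-4)[OF rep]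
  have sm: "Suc (length P) mod 2 ^ w = Suc (length P)" using P by (intro small) simp
  have "wp w (push_com i j) s (\<lambda>t s'. t \<le> 60 \<and> fst s' = (fst s)(6 := Suc (length P)) \<and>
    (\<forall>b<16. \<forall>y<Q. \<forall>z. cell s' b y z = (if b = 10 \<and> y = 0 \<and> z = length P then fst s i
       else if b = 11 \<and> y = 0 \<and> z = length P then fst s j else cell s b y z)))"
    unfolding push_com_def using D P ij Q0
    by (auto simp: wp_simps val_AddrE val_Lit cell_store cell_fst exp_cost_AddrE sm simp del: val.simps(1,3))
  then show ?thesis
  proof (rule wp_mono, elim conjE, intro conjI)
    fix t s' assume f: "fst s' = (fst s)(6 := Suc (length P))" and
      m: "\<forall>b<16. \<forall>y<Q. \<forall>z. cell s' b y z = (if b = 10 \<and> y = 0 \<and> z = length P then fst s i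
       else if b = 11 \<and> y = 0 \<and> z = length P then fst s j else cell s b y z)"
    then have e: "cell s' b y = cell s b y" if "b < 10" "y < Q" for b y using that by (auto simp: fun_eq_iff)
    have 1: "slist n (cell s' a x 0) (cell s' (a + 1) x) (cell s' (a + 2) x) (A a x)"
      if "a \<in> {0,3,6}" "x < Q" for a x
      using rep_D(5)[OF rep that] e[of a x] e[of "a+1" x] e[of "a+2" x] that by auto
    have 2: "cell s' 9 v 0 = lev v" if "v < n" for v
      using rep_D(6)[OF rep that] e[of 9 v] nQ that by auto
    have 3: "cell s' 10 0 j' = fst ((P @ [(fst s i, fst s j)]) ! j')"
      "cell s' 11 0 j' = snd ((P @ [(fst s i, fst s j)]) ! j')"
      if "j' < length (P @ [(fst s i, fst s j)])" for j'
      using m rep_D(7,8)[OF rep, of j'] that Q0 by (auto simp: nth_append)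
    show "rep s' A lev (P @ [(fst s i, fst s j)])"
      unfolding rep_def using 1 2 3 f D by simp
  qed auto
qed

lemma pop_wp:
  assumes rep: "rep s A lev (P @ [(a, b)])" and P: "length P < n * n"
  shows "wp w pop_com s (\<lambda>t s'. t \<le> 60 \<and> (\<forall>r. r \<notin> {6,7,8} \<longrightarrow> fst s' r = fst s r) \<and>
    fst s' 7 = a \<and> fst s' 8 = b \<and> rep s' A lev P)"
proof -
  note D = rep_D(1-4)[OF rep]
  have 1: "cell s 10 0 (length P) = a" "cell s 11 0 (length P) = b"
    using rep_D(7,8)[OF rep, of "length P"] by auto
  have "\<forall>j<length P. cell s 10 0 j = fst (P ! j) \<and> cell s 11 0 j = snd (P ! j)"
    using rep_D(7,8)[OF rep] by (auto simp: nth_append dest: less_SucI)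
  then have 2: "rep ((fst s)(6 := length P, 7 := a, 8 := b), snd s) A lev P"
    using rep unfolding rep_def by (simp add: cell_fst)
  show ?thesis unfolding pop_com_def using D P Q0 1 2
    by (simp add: wp_simps val_AddrE val_CellE val_Lit cell_fst exp_cost_AddrE del: val.simps(1,3))
qed

lemma last_wp:
  assumes rep: "rep s A lev P" and a: "a \<in> {0,3,6}" and x: "fst s i < Q" and ne: "A a (fst s i) \<noteq> {}"
    and j: "j \<notin> {3,4,5,6}"
  shows "wp w (last_com a i j) s (\<lambda>t s'. t \<le> 60 \<and> (\<forall>r. r \<noteq> j \<longrightarrow> fst s' r = fst s r) \<and>
    fst s' j \<in> A a (fst s i) \<and> rep s' A lev P)"
proof -
  note sl = rep_D(5)[OF rep a x]
  let ?c = "cell s a (fst s i) 0"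
  have c: "?c \<le> n" by (rule slist_card_le[OF sl])
  have "?c = card (A a (fst s i))" using sl unfolding slist_def by blast
  then have "?c > 0" using ne slist_finite[OF sl] by (simp add: card_gt_0_iff)
  then have "?c - 1 < ?c" by linarith
  then have el: "cell s (a + 1) (fst s i) (?c - 1) \<in> A a (fst s i)" using sl unfolding slist_def by blast
  have a6: "a \<le> 6" using a by auto
  have "?c - Suc 0 \<le> n * n" "?c \<le> n * n" using c le_nn[of ?c] by auto
  then show ?thesis unfolding last_com_def using el j a6 x rep rep_D(1)[OF rep]
    by (simp add: wp_simps val_CellE val_Lit exp_cost_AddrE rep_reg le_nn del: val.simps(1,3))
qed

lemma size_val:
  assumes rep: "rep s A lev P" and a: "a \<in> {0,3,6}" and x: "val w s e < Q"
  shows "val w s (sizeE a e) = card (A a (val w s e))"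
proof -
  have "a < 16" using a by auto
  then have "val w s (sizeE a e) = cell s a (val w s e) 0"
    using rep_D(1)[OF rep] x by (simp add: val_CellE val_Lit del: val.simps(1,3))
  then show ?thesis using rep_D(5)[OF rep a x] unfolding slist_def by simp
qed

lemma rep_store_lev:
  assumes rep': "rep s A lev P" and v: "v < n"
  shows "rep (fst s, (snd s)(addr 9 v 0 := m)) A (lev(v := m)) P"
proof -
  let ?s = "(fst s, (snd s)(addr 9 v 0 := m))"
  have Q: "v < Q" using v nQ by simp
  have l: "cell ?s b y z = (if b = 9 \<and> y = v \<and> z = 0 then m else cell s b y z)"
    if "b < 16" "y < Q" for b y z
    using that Q by (simp add: cell_store cell_fst)
  have 0: "\<forall>b<16. b \<noteq> 9 \<longrightarrow> (\<forall>y<Q. cell ?s b y = cell s b y)" using l by (auto simp: fun_eq_iff)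
  have 1: "slist n (cell ?s a x 0) (cell ?s (a + 1) x) (cell ?s (a + 2) x) (A a x)"
    if "a \<in> {0,3,6}" "x < Q" for a x
    using rep_D(5)[OF rep' that] 0 that by auto
  have 2: "cell ?s 9 y 0 = (lev(v := m)) y" if "y < n" for y
    using rep_D(6)[OF rep' that] l[of 9 y 0] that nQ by simp
  have 3: "cell ?s 10 0 = cell s 10 0" "cell ?s 11 0 = cell s 11 0" using 0 Q0 by auto
  show ?thesis using rep' unfolding rep_def 3 using 1 2 by simp
qed

text \<open>Hypothesis \<open>up\<close> bounds the recorded neighbours by the old and by the new
  layer, since the move may go up or down. Then the lists of \<open>v\<close> in families 0 and 3
  are empty before and after, and \<open>v\<close> stays in the family 3 lists of its neighbours, so
  only family 6 changes.\<close>

lemma setlev_wp: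
  assumes rep: "rep s (lists_of n lev R) lev P" and R: "edges_ok n R"
    and v: "fst s 9 = v" "v < n" "lev v < Q" and m: "fst s j = m" "m < Q" and j: "j \<notin> {14,16,17}"
    and up: "\<And>u. {v, u} \<in> R \<Longrightarrow> lev u < lev v \<and> lev u < m"
  shows "wp w (setlev_com j) s (\<lambda>t s'. t \<le> 400 \<and> (\<forall>r. r \<notin> {14,16,17} \<longrightarrow> fst s' r = fst s r) \<and>
    rep s' (lists_of n (lev(v := m)) R) (lev(v := m)) P)"
proof -
  let ?A0 = "lists_of n lev R"
  let ?A1 = "set_list ?A0 6 (lev v) (?A0 6 (lev v) - {v})"
  let ?A2 = "set_list ?A1 6 m (insert v (?A1 6 m))"
  have up': "lev u < lev v" "lev u < m" "v \<noteq> u" if "{u, v} \<in> R" for u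
    using that up[of u] edges_okD[OF R] by (auto simp: insert_commute)
  have up'': "lev u < lev v" "lev u < m" "v \<noteq> u" if "{v, u} \<in> R" for u
    using that up[of u] edges_okD[OF R] by (auto simp: insert_commute)
  have A2: "?A2 = lists_of n (lev(v := m)) R"
    using v(2) by (auto simp: fun_eq_iff set_list_def lists_of_def dest: up' up'')
  have lev: "val w s (CellE 9 (Reg 9) (Lit 0)) = lev v"
    using rep_D(1,6)[OF rep] v nQ by (simp add: val_CellE val_Lit del: val.simps(1,3))
  have Q: "v < Q" using v nQ by simp
  have J1: "rep ((fst s)(14 := lev v), snd s) ?A0 lev P" using rep by (simp add: rep_reg)
  have J3: "rep (f, (snd s')(addr 9 v 0 := m)) ?A2 (lev(v := m)) P"
    if "rep s' ?A2 lev P" "fst s' = f" for s' f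
    using rep_store_lev[OF that(1) v(2)] that(2) by simp
  have ins: "wp w (ins_com 6 j 9) s1 (\<lambda>t s'. t \<le> 90 \<and> fst s' = fst s1 \<and> rep s' ?A2 lev P)"
    if "rep s1 ?A1 lev P" "fst s1 j = m" "fst s1 9 = v" for s1
    using ins_wp[OF that(1), of 6 j 9] that(2,3) v m by (simp add: lists_of_def set_list_def)
  show ?thesis unfolding setlev_com_def wp_Seq
    apply (simp add: wp_Assign lev exp_cost_AddrE v del: val.simps(1,3))
    apply (rule wp_mono[OF rmv_wp[OF J1]]; (use v Q in simp)?)
    apply (elim conjE)
    apply (rule wp_mono[OF ins]; (use v m j in simp)?)
    apply (elim conjE)
    apply (frule rep_D(1))
    apply (simp add: wp_Store exp_cost_AddrE val_AddrE val_Lit v m j Q del: val.simps(1,3))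
    using J3 A2 v m j by simp
qed

end

section \<open>Detaching a vertex\<close>

definition up_edges :: "(nat \<Rightarrow> nat) \<Rightarrow> nat \<Rightarrow> nat set set" where
  "up_edges lev v = {e. \<exists>u. e = {v, u} \<and> lev v \<le> lev u}"

definition degE :: "nat \<Rightarrow> exp" where
  "degE i = Add (sizeE 0 (Reg i)) (sizeE 3 (Reg i))"

definition detach_com :: com where
  "detach_com = While (Less (Lit 0) (degE 9))
    (Cond (Less (Lit 0) (sizeE 0 (Reg 9))) (last_com 0 9 10) (last_com 3 9 10) ;;
     unrecord_com ;; push_com 9 10)"

text \<open>Without recorded edges to its own or a higher layer, a vertex occurs only in lists of lower vertices,
  which stay correct when it changes its layer; hence the detaching first.\<close>

definition moveall_com :: "nat \<Rightarrow> nat \<Rightarrow> com" where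
  "moveall_com x y = While (Less (Lit 0) (sizeE 6 (Reg x)))
    (last_com 6 x 9 ;; detach_com ;; setlev_com y)"

text \<open>Register \<open>13\<close> holds the target layer.  Its own vertices are first moved up by one layer, so that their
  edges are detached by the same loop.\<close>

definition collapse_com :: com where
  "collapse_com =
    Assign 11 (Add (Reg 13) (Lit 1)) ;;
    moveall_com 13 11 ;;
    While (Neg (Less (Reg 4) (Reg 11)))
      (moveall_com 11 13 ;; Assign 11 (Add (Reg 11) (Lit 1)))"

text \<open>Register \<open>12\<close> holds the number of vertices in the layers from register \<open>11\<close> upwards; it starts with the
  vertex just promoted and at least doubles in each round, so the search ends above layer \<open>1\<close>.\<close>

definition find_com :: com where
  "find_com =
    Assign 11 (Reg 4) ;;
    Assign 12 (Lit 1) ;;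
    While (Neg (Less (sizeE 6 (Sub (Reg 11) (Lit 1))) (Reg 12)))
      (Assign 12 (Add (Reg 12) (sizeE 6 (Sub (Reg 11) (Lit 1)))) ;;
       Assign 11 (Sub (Reg 11) (Lit 1))) ;;
    Assign 13 (Sub (Reg 11) (Lit 1))"

context ram begin

text \<open>The condition on \<open>length P\<close> says that no pending edge is stacked twice, in
  either order of its endpoints; hence popping an edge really removes it.\<close>

definition stores :: "nat set set \<Rightarrow> (nat \<Rightarrow> nat) \<Rightarrow> nat set set \<Rightarrow> state \<Rightarrow> bool" where
  "stores E lev R s \<longleftrightarrow> edges_ok n E \<and> R \<subseteq> E \<and>
    (\<exists>P. rep s (lists_of n lev R) lev P \<and> length P = card (E - R) \<and> (\<lambda>(a, b). {a, b}) ` set P = E - R)"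

lemma stores_E:
  assumes "stores E lev R s"
  obtains P where "edges_ok n E" "R \<subseteq> E" "edges_ok n R" "finite E" "finite R"
    "rep s (lists_of n lev R) lev P" "length P = card (E - R)" "(\<lambda>(a, b). {a, b}) ` set P = E - R"
  using assms edges_ok_subset edges_ok_finite_card unfolding stores_def by (metis finite_subset)

lemma stores_reg: "r \<notin> {3,4,5,6} \<Longrightarrow> stores E lev R ((fst s)(r := v), snd s) \<longleftrightarrow> stores E lev R s"
  by (simp add: stores_def rep_reg)

lemma stores_size:
  assumes "stores E lev R s" "a \<in> {0,3,6}" "val w s e < Q"
  shows "val w s (sizeE a e) = card (lists_of n lev R a (val w s e))"
  using stores_E[OF assms(1)] size_val[OF _ assms(2,3)] by metis

lemma lists_of_finite: "edges_ok n R \<Longrightarrow> finite (lists_of n lev R a x)"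
  by (rule finite_subset[of _ "{..<n}"]) (auto simp: lists_of_def dest: edges_okD)

lemma n_less: "n < 2 ^ w"
  using small_n[of n] mod_less_divisor[of "2 ^ w" "Suc n"] by simp

text \<open>The two lists are disjoint sets of vertices, so the sum of their sizes is at most
  \<open>n\<close> and does not overflow.\<close>

lemma degE_val:
  assumes "stores E lev R s" "fst s i = v" "v < n"
  shows "val w s (degE i) = card {u. {v, u} \<in> R \<and> lev v \<le> lev u}"
proof -
  obtain P where R: "edges_ok n R" using stores_E[OF assms(1)] by metis
  let ?A = "lists_of n lev R"
  have vQ: "v < Q" using assms nQ by simp
  have e: "{u. {v, u} \<in> R \<and> lev v \<le> lev u} = ?A 0 v \<union> ?A 3 v" by (auto simp: lists_of_def)
  have "card (?A 0 v \<union> ?A 3 v) = card (?A 0 v) + card (?A 3 v)"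
    by (intro card_Un_disjoint lists_of_finite[OF R]) (auto simp: lists_of_def)
  moreover have "card (?A 0 v \<union> ?A 3 v) \<le> card {..<n}"
    by (intro card_mono) (auto simp: lists_of_def dest: edges_okD[OF R])
  ultimately have "card (?A 0 v) + card (?A 3 v) \<le> n" by simp
  then have "(card (?A 0 v) + card (?A 3 v)) mod 2 ^ w = card (?A 0 v) + card (?A 3 v)"
    using n_less by simp
  moreover have "val w s (sizeE a (Reg i)) = card (?A a v)" if "a \<in> {0,3,6}" for a
    using stores_size[OF assms(1) that, of "Reg i"] assms(2) vQ by simp
  ultimately show ?thesis unfolding degE_def e
    using \<open>card (?A 0 v \<union> ?A 3 v) = card (?A 0 v) + card (?A 3 v)\<close> by simp
qed

lemma pick_wp:
  assumes stores: "stores E lev R s" and v: "fst s 9 = v" "v < n" and ne: "{u. {v, u} \<in> R \<and> lev v \<le> lev u} \<noteq> {}"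
  shows "wp w (Cond (Less (Lit 0) (sizeE 0 (Reg 9))) (last_com 0 9 10) (last_com 3 9 10)) s
    (\<lambda>t s'. t \<le> 100 \<and> (\<forall>r. r \<noteq> 10 \<longrightarrow> fst s' r = fst s r) \<and>
      {v, fst s' 10} \<in> R \<and> lev v \<le> lev (fst s' 10) \<and> stores E lev R s')"
proof -
  obtain P where P: "edges_ok n E" "R \<subseteq> E" "edges_ok n R"
    "rep s (lists_of n lev R) lev P" "length P = card (E - R)" "(\<lambda>(a, b). {a, b}) ` set P = E - R"
    using stores_E[OF stores] by metis
  let ?A = "lists_of n lev R"
  have vQ: "v < Q" using v nQ by simp
  have sz: "val w s (sizeE 0 (Reg 9)) = card (?A 0 v)" using size_val[OF P(4), of 0 "Reg 9"] v vQ by simp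
  have fin: "finite (?A 0 v)" by (rule lists_of_finite[OF P(3)])
  show ?thesis
  proof (cases "?A 0 v = {}")
    case True
    then have "?A 3 v \<noteq> {}" using ne by (force simp: lists_of_def)
    from last_wp[OF P(4), of 3 9 10] this vQ v True sz show ?thesis
      unfolding stores_def using P
      by (auto simp: wp_Cond val_Lit exp_cost_AddrE simp del: val.simps(1,3) elim!: wp_mono) (auto simp: lists_of_def)
  next
    case False
    then have "card (?A 0 v) > 0" using fin by (simp add: card_gt_0_iff)
    with last_wp[OF P(4), of 0 9 10] False vQ v sz show ?thesis
      unfolding stores_def using P
      by (auto simp: wp_Cond val_Lit exp_cost_AddrE simp del: val.simps(1,3) elim!: wp_mono) (auto simp: lists_of_def)
  qed
qed

lemma unrecord_stores_wp:
  assumes stores: "stores E lev R s" and v: "fst s 9 = v" and u: "fst s 10 = u" and e: "{v, u} \<in> R"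
  shows "wp w (unrecord_com ;; push_com 9 10) s
    (\<lambda>t s'. t \<le> 660 \<and> (\<forall>r. r \<notin> {6,16,17} \<longrightarrow> fst s' r = fst s r) \<and> stores E lev (R - {{v, u}}) s')"
proof -
  obtain P where P: "edges_ok n E" "R \<subseteq> E" "edges_ok n R" "finite E"
    "rep s (lists_of n lev R) lev P" "length P = card (E - R)" "(\<lambda>(a, b). {a, b}) ` set P = E - R"
    using stores_E[OF stores] by metis
  have vu: "v < n" "u < n" using edges_okD[OF P(3) e] by auto
  have E: "E - (R - {{v, u}}) = insert {v, u} (E - R)" using e P(2) by auto
  have c: "card (E - (R - {{v, u}})) = Suc (card (E - R))" unfolding E using e P(4) by simp
  have "card (E - (R - {{v, u}})) \<le> card E" using P(4) by (intro card_mono) auto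
  then have len: "length P < n * n" using c P(6) edges_ok_finite_card(2)[OF P(1)] by simp
  show ?thesis unfolding wp_Seq
    apply (rule wp_mono[OF unrecord_wp[OF P(5) v vu(1) u vu(2)]], elim conjE)
    apply (rule wp_mono[OF push_wp], assumption, use len in \<open>simp_all add: stores_def\<close>)
    apply (elim conjE)
    apply (intro conjI exI[of _ "P @ [(v, u)]"])
    using P c v u by (auto simp: E)
qed

text \<open>Every recorded edge carries 1000 steps, which pay for the round that unrecords it. With
  the edges still recorded on the left-hand side, bounds of this form add up along a sequence of
  programs.\<close>

lemma detach_wp:
  assumes stores: "stores E lev R s" and v: "fst s 9 = v" "v < n"
  shows "wp w detach_com s (\<lambda>t s'. (\<forall>r. r \<notin> {6,10,16,17} \<longrightarrow> fst s' r = fst s r) \<and>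
    stores E lev (R - up_edges lev v) s' \<and>
    t + 1000 * card (R - up_edges lev v) \<le> 1000 * card R + 100)"
proof -
  define Inv where "Inv s' m \<longleftrightarrow> (\<exists>R'. R' \<subseteq> R \<and> R - R' \<subseteq> up_edges lev v \<and> stores E lev R' s' \<and>
    (\<forall>r. r \<notin> {6,10,16,17} \<longrightarrow> fst s' r = fst s r) \<and> m = 1000 * card R')" for s' m
  have finR: "finite R" using stores_E[OF stores] by metis
  have 0: "Inv s (1000 * card R)" unfolding Inv_def using stores by blast
  have tc: "test_cost (Less (Lit 0) (degE 9)) \<le> 50" by (simp add: degE_def exp_cost_AddrE)
  have "wp w detach_com s (\<lambda>t s'. \<exists>m'. Inv s' m' \<and> \<not> holds w s' (Less (Lit 0) (degE 9)) \<and>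
      t + m' \<le> 1000 * card R + 1 + test_cost (Less (Lit 0) (degE 9)))"
    unfolding detach_com_def
  proof (rule wp_While[where Inv = Inv, OF 0])
    fix s1 m assume "Inv s1 m" and h: "holds w s1 (Less (Lit 0) (degE 9))"
    then obtain R1 where R1: "R1 \<subseteq> R" "R - R1 \<subseteq> up_edges lev v" "stores E lev R1 s1"
      "\<forall>r. r \<notin> {6,10,16,17} \<longrightarrow> fst s1 r = fst s r" "m = 1000 * card R1" unfolding Inv_def by blast
    have v1: "fst s1 9 = v" using R1(4) v by simp
    have finR1: "finite R1" using R1(1) finR finite_subset by blast
    have "card {u. {v, u} \<in> R1 \<and> lev v \<le> lev u} \<noteq> 0" using h degE_val[OF R1(3) v1 v(2)] by simp
    then have ne: "{u. {v, u} \<in> R1 \<and> lev v \<le> lev u} \<noteq> {}" by (metis card.empty)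
    show "wp w (Cond (Less (Lit 0) (sizeE 0 (Reg 9))) (last_com 0 9 10) (last_com 3 9 10) ;;
        unrecord_com ;; push_com 9 10) s1
        (\<lambda>t s'. \<exists>m'. Inv s' m' \<and> 1 + test_cost (Less (Lit 0) (degE 9)) + t + m' \<le> m)"
      unfolding wp_Seq[of w "Cond p q r" for p q r]
    proof (rule wp_mono[OF pick_wp[OF R1(3) v1 v(2) ne]], elim conjE)
      fix t2 :: nat and s2
      assume t2: "t2 \<le> 100" and s2: "\<forall>r. r \<noteq> 10 \<longrightarrow> fst s2 r = fst s1 r"
        "{v, fst s2 10} \<in> R1" "lev v \<le> lev (fst s2 10)" "stores E lev R1 s2"
      let ?u = "fst s2 10"
      have v2: "fst s2 9 = v" using s2(1) v1 by simp
      show "wp w (unrecord_com ;; push_com 9 10) s2 (\<lambda>t s'. \<exists>m'. Inv s' m' \<and>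
          1 + test_cost (Less (Lit 0) (degE 9)) + (t2 + t) + m' \<le> m)"
      proof (rule wp_mono[OF unrecord_stores_wp[OF s2(4) v2 refl s2(2)]], elim conjE, intro exI conjI)
        fix t3 :: nat and s3
        assume s3: "\<forall>r. r \<notin> {6,16,17} \<longrightarrow> fst s3 r = fst s2 r" "stores E lev (R1 - {{v, ?u}}) s3"
        show "Inv s3 (1000 * card (R1 - {{v, ?u}}))"
          unfolding Inv_def
        proof (intro exI[of _ "R1 - {{v, ?u}}"] conjI)
          show "R - (R1 - {{v, ?u}}) \<subseteq> up_edges lev v" using R1(2) s2(3) by (auto simp: up_edges_def)
          show "\<forall>r. r \<notin> {6,10,16,17} \<longrightarrow> fst s3 r = fst s r" using s3(1) s2(1) R1(4) by simp
        qed (use R1 s3 in auto)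
        assume "t3 \<le> 660"
        moreover have "card R1 = Suc (card (R1 - {{v, ?u}}))" using s2(2) finR1
          by (metis card.remove)
        ultimately show "1 + test_cost (Less (Lit 0) (degE 9)) + (t2 + t3) +
            1000 * card (R1 - {{v, ?u}}) \<le> m"
          using t2 tc R1(5) by linarith
      qed
    qed
  qed
  then show ?thesis
  proof (rule wp_mono, elim exE conjE)
    fix t s1 m
    assume "Inv s1 m" and h: "\<not> holds w s1 (Less (Lit 0) (degE 9))" and
      t: "t + m \<le> 1000 * card R + 1 + test_cost (Less (Lit 0) (degE 9))"
    then obtain R1 where R1: "R1 \<subseteq> R" "R - R1 \<subseteq> up_edges lev v" "stores E lev R1 s1"
      "\<forall>r. r \<notin> {6,10,16,17} \<longrightarrow> fst s1 r = fst s r" "m = 1000 * card R1" unfolding Inv_def by blast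
    have v1: "fst s1 9 = v" using R1(4) v by simp
    have ok: "edges_ok n R1" using stores_E[OF R1(3)] by metis
    have "finite {u. {v, u} \<in> R1 \<and> lev v \<le> lev u}"
      by (rule finite_subset[of _ "{..<n}"]) (auto dest: edges_okD[OF ok])
    moreover have "card {u. {v, u} \<in> R1 \<and> lev v \<le> lev u} = 0"
      using h degE_val[OF R1(3) v1 v(2)] by (simp add: small_lit)
    ultimately have "{u. {v, u} \<in> R1 \<and> lev v \<le> lev u} = {}" by simp
    then have "R1 = R - up_edges lev v" using R1(1,2) by (auto simp: up_edges_def)
    then show "(\<forall>r. r \<notin> {6,10,16,17} \<longrightarrow> fst s1 r = fst s r) \<and> stores E lev (R - up_edges lev v) s1 \<and>
      t + 1000 * card (R - up_edges lev v) \<le> 1000 * card R + 100"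
      using R1 t tc by auto
  qed
qed

lemma setlev_stores_wp:
  assumes stores: "stores E lev R s"
    and v: "fst s 9 = v" "v < n" "lev v < Q" and m: "fst s j = m" "m < Q" and j: "j \<notin> {14,16,17}"
    and up: "\<And>u. {v, u} \<in> R \<Longrightarrow> lev u < lev v \<and> lev u < m"
  shows "wp w (setlev_com j) s (\<lambda>t s'. t \<le> 400 \<and> (\<forall>r. r \<notin> {14,16,17} \<longrightarrow> fst s' r = fst s r) \<and>
    stores E (lev(v := m)) R s')"
proof -
  obtain P where P: "edges_ok n E" "R \<subseteq> E" "edges_ok n R"
    "rep s (lists_of n lev R) lev P" "length P = card (E - R)" "(\<lambda>(a, b). {a, b}) ` set P = E - R"
    using stores_E[OF stores] by metis
  show ?thesis
    by (rule wp_mono[OF setlev_wp[OF P(4,3) v m j up]]) (use P in \<open>auto simp: stores_def\<close>)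
qed

lemma last_stores_wp:
  assumes stores: "stores E lev R s" and x: "fst s i < Q" and ne: "{v. v < n \<and> lev v = fst s i} \<noteq> {}"
    and j: "j \<notin> {3,4,5,6}"
  shows "wp w (last_com 6 i j) s (\<lambda>t s'. t \<le> 60 \<and> (\<forall>r. r \<noteq> j \<longrightarrow> fst s' r = fst s r) \<and>
    fst s' j < n \<and> lev (fst s' j) = fst s i \<and> stores E lev R s')"
proof -
  obtain P where P: "edges_ok n E" "R \<subseteq> E"
    "rep s (lists_of n lev R) lev P" "length P = card (E - R)" "(\<lambda>(a, b). {a, b}) ` set P = E - R"
    using stores_E[OF stores] by metis
  show ?thesis
    by (rule wp_mono[OF last_wp[OF P(3) _ x _ j]]) (use P ne in \<open>auto simp: stores_def lists_of_def\<close>)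
qed

end

section \<open>Collapsing the top layers\<close>

context ram begin

text \<open>Condition \<open>Z\<close> is what a move down needs: once detached, a vertex has
  recorded neighbours below layer \<open>m\<close> only, and \<open>Z\<close> puts them below
  \<open>tg\<close> too, as \<open>setlev_com\<close> requires. For a move up it holds
  automatically.\<close>

lemma moveall_wp:
  assumes stores: "stores E lev R s" and x: "fst s x = m" "m \<le> K" and y: "fst s y = tg" "tg \<le> K" and mt: "m \<noteq> tg"
    and xy: "x \<in> {11,13}" "y \<in> {11,13}"
    and Z: "\<And>u v. {u, v} \<in> R \<Longrightarrow> lev v = m \<Longrightarrow> lev u < m \<Longrightarrow> lev u < tg"
  shows "wp w (moveall_com x y) s (\<lambda>t s'. (\<forall>r. r \<notin> {6,9,10,14,16,17} \<longrightarrow> fst s' r = fst s r) \<and>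
    (\<exists>R'. R' = R - {e. \<exists>u v. e = {u, v} \<and> lev v = m \<and> m \<le> lev u} \<and>
      stores E (\<lambda>v. if v < n \<and> lev v = m then tg else lev v) R' s' \<and>
      t + 1000 * card R' \<le> 1000 * card R + 1000 * card {v. v < n \<and> lev v = m} + 100))"
proof -
  let ?p = "Less (Lit 0) (sizeE 6 (Reg x))"
  \<comment> \<open>\<open>W\<close> is the set of vertices moved so far; \<open>lv W\<close> and
    \<open>RW W\<close> are the layers and the record at that moment.\<close>
  define lv where "lv W v = (if v \<in> W then tg else lev v)" for W v
  define RW where "RW W = R - {e. \<exists>u v. e = {u, v} \<and> v \<in> W \<and> m \<le> lev u}" for W
  let ?L = "{v. v < n \<and> lev v = m}"
  define Inv where "Inv s' k \<longleftrightarrow> (\<exists>W \<subseteq> ?L. stores E (lv W) (RW W) s' \<and>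
    (\<forall>r. r \<notin> {6,9,10,14,16,17} \<longrightarrow> fst s' r = fst s r) \<and>
    k = 1000 * card (RW W) + 1000 * card (?L - W))" for s' k
  have okR: "edges_ok n R" and finR: "finite R" using stores_E[OF stores] by metis+
  have tc: "test_cost ?p \<le> 50" by (simp add: exp_cost_AddrE)
  have mQ: "m < Q" "tg < Q" using x y KQ by auto
  have e: "lv {} = lev" "RW {} = R" by (auto simp: lv_def RW_def)
  have 0: "Inv s (1000 * card R + 1000 * card ?L)"
    unfolding Inv_def using stores e by (intro exI[of _ "{}"]) simp
  have L: "{v. v < n \<and> lv W v = m} = ?L - W" if "W \<subseteq> ?L" for W using mt that by (auto simp: lv_def)
  have sz: "val w s' (sizeE 6 (Reg x)) = card (?L - W)"
    if "stores E (lv W) (RW W) s'" "W \<subseteq> ?L" "fst s' x = m" for s' W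
    using stores_size[OF that(1), of 6 "Reg x"] that(3) mQ L[OF that(2)] by (simp add: lists_of_def)
  have "wp w (moveall_com x y) s (\<lambda>t s'. \<exists>m'. Inv s' m' \<and> \<not> holds w s' ?p \<and>
      t + m' \<le> 1000 * card R + 1000 * card ?L + 1 + test_cost ?p)"
    unfolding moveall_com_def
  proof (rule wp_While[where Inv = Inv, OF 0])
    fix s1 k assume "Inv s1 k" and h: "holds w s1 ?p"
    then obtain W where W: "W \<subseteq> ?L" "stores E (lv W) (RW W) s1"
      "\<forall>r. r \<notin> {6,9,10,14,16,17} \<longrightarrow> fst s1 r = fst s r"
      "k = 1000 * card (RW W) + 1000 * card (?L - W)" unfolding Inv_def by blast
    have r1: "fst s1 x = m" "fst s1 y = tg" using W(3) xy x y by auto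
    have "card (?L - W) \<noteq> 0" using h sz[OF W(2,1) r1(1)] by (simp del: card_0_eq val.simps(3))
    then have ne: "{v. v < n \<and> lv W v = fst s1 x} \<noteq> {}" unfolding r1 L[OF W(1)] by (metis card.empty)
    show "wp w (last_com 6 x 9 ;; detach_com ;; setlev_com y) s1
        (\<lambda>t s'. \<exists>m'. Inv s' m' \<and> 1 + test_cost ?p + t + m' \<le> k)"
      unfolding wp_Seq
    proof (rule wp_mono[OF last_stores_wp[OF W(2) _ ne]], goal_cases)
      case (3 t2 s2)
      define v where "v = fst s2 9"
      from 3 have t2: "t2 \<le> 60" and s2: "\<forall>r. r \<noteq> 9 \<longrightarrow> fst s2 r = fst s1 r"
        "v < n" "lv W v = m" "stores E (lv W) (RW W) s2" unfolding v_def r1 by auto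
      have vW: "v \<in> ?L" "v \<notin> W" using s2 L[OF W(1)] by auto
      let ?R = "RW W - up_edges (lv W) v"
      have RWi: "?R = RW (insert v W)"
      proof -
        \<comment> \<open>The layers of the vertices in \<open>W\<close> have changed, but no edge
          between \<open>W\<close> and \<open>v\<close> is recorded any more, so the layers before
          the loop may be used.\<close>
        have "{v, u} \<in> RW W \<and> m \<le> lv W u \<longleftrightarrow> {v, u} \<in> RW W \<and> m \<le> lev u" for u
        proof (cases "u \<in> W")
          case True
          then have "{v, u} \<notin> RW W" using vW by (auto simp: RW_def)
          then show ?thesis by simp
        qed (simp add: lv_def)
        then have "?R = RW W - {e. \<exists>u. e = {v, u} \<and> m \<le> lev u}" unfolding up_edges_def s2(3) by blast
        also have "\<dots> = RW (insert v W)" unfolding RW_def by (auto simp: insert_commute)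
        finally show ?thesis .
      qed
      have fin: "finite (RW W)" using finR by (simp add: RW_def)
      show ?case
      proof (rule wp_mono[OF detach_wp[OF s2(4) v_def[symmetric] s2(2)]], elim conjE)
        fix t3 :: nat and s3
        assume s3: "\<forall>r. r \<notin> {6,10,16,17} \<longrightarrow> fst s3 r = fst s2 r" "stores E (lv W) ?R s3"
          and t3: "t3 + 1000 * card ?R \<le> 1000 * card (RW W) + 100"
        have v3: "fst s3 9 = v" using s3 v_def by simp
        have y3: "fst s3 y = tg" using s3 s2 r1 xy by auto
        have up: "lv W u < lv W v \<and> lv W u < tg" if u: "{v, u} \<in> ?R" for u
        proof -
          have 1: "lv W u < m" using u s2(3) by (auto simp: up_edges_def not_le[symmetric])
          have R: "{u, v} \<in> R" using u by (auto simp: RW_def insert_commute)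
          have "u \<notin> W" using u vW by (auto simp: RW_def)
          then have "lev u < m" "lv W u = lev u" using 1 by (auto simp: lv_def)
          then show ?thesis using Z[OF R] vW s2(3) by auto
        qed
        show "wp w (setlev_com y) s3 (\<lambda>t s'. \<exists>m'. Inv s' m' \<and> 1 + test_cost ?p + (t2 + (t3 + t)) + m' \<le> k)"
        proof (rule wp_mono[OF setlev_stores_wp[OF s3(2) v3 s2(2) _ y3 mQ(2) _ up]], goal_cases)
          case (4 t4 s4)
          have lvi: "(lv W)(v := tg) = lv (insert v W)" by (auto simp: lv_def fun_eq_iff)
          have c: "card (?L - W) = Suc (card (?L - insert v W))"
          proof -
            have "?L - insert v W = (?L - W) - {v}" by auto
            moreover have "v \<in> ?L - W" using vW by auto
            ultimately show ?thesis using card_Suc_Diff1[of "?L - W" v] by simp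
          qed
          show ?case
          proof (intro exI conjI)
            show "Inv s4 (1000 * card (RW (insert v W)) + 1000 * card (?L - insert v W))"
              unfolding Inv_def
            proof (intro exI[of _ "insert v W"] conjI)
              show "stores E (lv (insert v W)) (RW (insert v W)) s4" using 4 lvi RWi by simp
              show "\<forall>r. r \<notin> {6,9,10,14,16,17} \<longrightarrow> fst s4 r = fst s r"
                using 4 s3(1) s2(1) W(3) by simp
            qed (use W vW in auto)
            show "1 + test_cost ?p + (t2 + (t3 + t4)) +
              (1000 * card (RW (insert v W)) + 1000 * card (?L - insert v W)) \<le> k"
              using t2 t3 4 tc c W(4) unfolding RWi by linarith
          qed
        qed (use s2 mQ xy in auto)
      qed
    qed (use r1 mQ in auto)
  qed
  then show ?thesis
  proof (rule wp_mono, elim exE conjE)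
    fix t s1 k
    assume "Inv s1 k" and h: "\<not> holds w s1 ?p" and
      t: "t + k \<le> 1000 * card R + 1000 * card ?L + 1 + test_cost ?p"
    then obtain W where W: "W \<subseteq> ?L" "stores E (lv W) (RW W) s1"
      "\<forall>r. r \<notin> {6,9,10,14,16,17} \<longrightarrow> fst s1 r = fst s r"
      "k = 1000 * card (RW W) + 1000 * card (?L - W)" unfolding Inv_def by blast
    have r1: "fst s1 x = m" using W(3) xy x by auto
    have "card (?L - W) = 0" using h sz[OF W(2,1) r1] by (simp add: small_lit del: card_0_eq val.simps(3))
    then have WL: "W = ?L" using W(1) by auto
    have 1: "lv W = (\<lambda>v. if v < n \<and> lev v = m then tg else lev v)"
      unfolding WL by (auto simp: lv_def fun_eq_iff)
    have 2: "RW W = R - {e. \<exists>u v. e = {u, v} \<and> lev v = m \<and> m \<le> lev u}"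
      unfolding WL RW_def by (auto dest: edges_okD[OF okR])
    show "(\<forall>r. r \<notin> {6,9,10,14,16,17} \<longrightarrow> fst s1 r = fst s r) \<and>
    (\<exists>R'. R' = R - {e. \<exists>u v. e = {u, v} \<and> lev v = m \<and> m \<le> lev u} \<and>
      stores E (\<lambda>v. if v < n \<and> lev v = m then tg else lev v) R' s1 \<and>
      t + 1000 * card R' \<le> 1000 * card R + 1000 * card {v. v < n \<and> lev v = m} + 100)"
    proof (intro conjI exI[of _ "RW W"] 2)
      show "stores E (\<lambda>v. if v < n \<and> lev v = m then tg else lev v) (RW W) s1" using W(2) unfolding 1 .
      show "t + 1000 * card (RW W) \<le> 1000 * card R + 1000 * card ?L + 100" using t tc W(4) by linarith
    qed (rule W(3))
  qed
qed

lemma K_pos: "2 \<le> K"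
proof -
  have "K - 1 \<noteq> 0" using K2 n2 by (metis One_nat_def not_less_eq_eq numeral_2_eq_2 power_0 le_0_eq less_one not_less zero_less_numeral less_le_trans)
  then show ?thesis by simp
qed

text \<open>The vertices of layer \<open>i\<close> move twice, up and back down, and those above it
  once; hence 2000 steps per affected vertex. The summand \<open>1000 * K\<close> pays for the
  rounds of the outer loop, including those at empty layers.\<close>

lemma collapse_wp:
  assumes stores: "stores E lev R s" and i: "fst s 13 = i" "1 \<le> i" "i < K" and lev: "\<And>v. v < n \<Longrightarrow> lev v \<le> K"
  shows "wp w collapse_com s (\<lambda>t s'. (\<forall>r. r \<notin> {6,9,10,11,14,16,17} \<longrightarrow> fst s' r = fst s r) \<and>
    (\<exists>R'. R' \<subseteq> R \<and> (\<forall>e \<in> R - R'. \<exists>u v. e = {u, v} \<and> i \<le> lev u \<and> i \<le> lev v) \<and>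
      (\<forall>u v. {u, v} \<in> R' \<longrightarrow> \<not> (i \<le> lev u \<and> i \<le> lev v)) \<and>
      stores E (\<lambda>v. if v < n \<and> i \<le> lev v then i else lev v) R' s' \<and>
      t + 1000 * card R' \<le> 1000 * card R + 2000 * card {v. v < n \<and> i \<le> lev v} + 1000 * K))"
proof -
  let ?U = "{v. v < n \<and> i \<le> lev v}"
  \<comment> \<open>\<open>lev1\<close> gives the layers after layer \<open>i\<close> has been
    emptied into the next one. Below, \<open>lv m\<close> describes the moment when the layers from
    \<open>i\<close> up to but not including \<open>m\<close> have been merged into layer
    \<open>i\<close>.\<close>
  define lev1 where "lev1 v = (if v < n \<and> lev v = i then i + 1 else lev v)" for v
  have U1: "v < n \<Longrightarrow> i \<le> lev1 v \<longleftrightarrow> i \<le> lev v" for v by (auto simp: lev1_def)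
  have lev1K: "v < n \<Longrightarrow> lev1 v \<le> K" for v using lev[of v] i by (auto simp: lev1_def)
  have lev1_ne: "v < n \<Longrightarrow> lev1 v \<noteq> i" for v by (auto simp: lev1_def)
  have okR: "edges_ok n R" using stores_E[OF stores] by metis
  define lv where "lv m v = (if v < n \<and> i \<le> lev1 v \<and> lev1 v < m then i else lev1 v)" for m v
  \<comment> \<open>The second clause on edges says that the vertices merged so far have no recorded
    edge to a vertex of \<open>lev1\<close>-layer \<open>i\<close> or higher. This yields condition
    \<open>Z\<close> for the next layer, and at the end the absence of recorded edges inside the
    collapsed part.\<close>
  define Inv where "Inv s' k \<longleftrightarrow> (\<exists>m R'. i < m \<and> m \<le> K + 1 \<and> fst s' 11 = m \<and> R' \<subseteq> R \<and>
    (\<forall>e \<in> R - R'. \<exists>u v. e = {u, v} \<and> i \<le> lev u \<and> i \<le> lev v) \<and>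
    (\<forall>u v. {u, v} \<in> R' \<and> i \<le> lev1 u \<and> lev1 u < m \<longrightarrow> \<not> i \<le> lev1 v) \<and>
    stores E (lv m) R' s' \<and> (\<forall>r. r \<notin> {6,9,10,11,14,16,17} \<longrightarrow> fst s' r = fst s r) \<and>
    k = 1000 * card R' + 1000 * card {v. v < n \<and> m \<le> lev1 v} + 200 * (K + 1 - m))" for s' k
  let ?p = "Neg (Less (Reg 4) (Reg 11))"
  have Kmod: "Suc m mod 2 ^ w = Suc m" if "m \<le> K" for m
  proof -
    have "Suc m \<le> Q" using that KQ by simp
    also have "Q < 16 * Q * (n * n + 1)" using Q0 n2 by simp
    finally show ?thesis using big by simp
  qed
  have i1: "Suc i mod 2 ^ w = Suc i" using i by (intro Kmod) simp
  let ?s0 = "((fst s)(11 := Suc i), snd s)"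
  have I0: "stores E lev R ?s0" using stores by (simp add: stores_reg)
  have loop: "wp w (While ?p (moveall_com 11 13 ;; Assign 11 (Add (Reg 11) (Lit 1)))) s1
     (\<lambda>t s'. \<exists>m'. Inv s' m' \<and> \<not> holds w s' ?p \<and> t + m' \<le> k + 1 + test_cost ?p)"
    if "Inv s1 k" for s1 k
  proof (rule wp_While[where Inv = Inv, OF that])
    fix s2 k assume "Inv s2 k" and h: "holds w s2 ?p"
    then obtain m R' where 2: "i < m" "fst s2 11 = m" "R' \<subseteq> R"
      "\<forall>e \<in> R - R'. \<exists>u v. e = {u, v} \<and> i \<le> lev u \<and> i \<le> lev v"
      "\<forall>u v. {u, v} \<in> R' \<and> i \<le> lev1 u \<and> lev1 u < m \<longrightarrow> \<not> i \<le> lev1 v"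
      "stores E (lv m) R' s2" "\<forall>r. r \<notin> {6,9,10,11,14,16,17} \<longrightarrow> fst s2 r = fst s r"
      "k = 1000 * card R' + 1000 * card {v. v < n \<and> m \<le> lev1 v} + 200 * (K + 1 - m)"
      unfolding Inv_def by blast
    have "fst s2 4 = K" using stores_E[OF 2(6)] rep_D(2) by metis
    then have mK: "m \<le> K" using h 2(2) by simp
    have r13: "fst s2 13 = i" using 2(7) i by simp
    have okR': "edges_ok n R'" using stores_E[OF 2(6)] by metis
    have Z: "lv m u < i" if e: "{u, v} \<in> R'" and "lv m v = m" "lv m u < m" for u v
    proof (rule ccontr)
      have n: "u < n" "v < n" using edges_okD[OF okR' e] by auto
      assume "\<not> lv m u < i"
      then have "i \<le> lev1 u" using that(2) by (auto simp: lv_def split: if_splits)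
      moreover have "i \<le> lev1 v" using that(2) 2(1) by (auto simp: lv_def split: if_splits)
      moreover have "lev1 u < m" using that(3) 2(1) by (auto simp: lv_def split: if_splits)
      ultimately show False using 2(5) e by blast
    qed
    show "wp w (moveall_com 11 13 ;; Assign 11 (Add (Reg 11) (Lit 1))) s2
        (\<lambda>t s'. \<exists>m'. Inv s' m' \<and> 1 + test_cost ?p + t + m' \<le> k)"
      unfolding wp_Seq
    proof (rule wp_mono[OF moveall_wp[OF 2(6,2) mK r13 _ _ _ _ Z]], goal_cases)
      case (8 t3 s3)
      define R3 where "R3 = R' - {e. \<exists>u v. e = {u, v} \<and> lv m v = m \<and> m \<le> lv m u}"
      from 8 have s3: "\<forall>r. r \<notin> {6,9,10,14,16,17} \<longrightarrow> fst s3 r = fst s2 r"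
        "stores E (\<lambda>v. if v < n \<and> lv m v = m then i else lv m v) R3 s3" and
        t3: "t3 + 1000 * card R3 \<le> 1000 * card R' + 1000 * card {v. v < n \<and> lv m v = m} + 100"
        unfolding R3_def by auto
      have r3: "fst s3 11 = m" using s3 2 by simp
      have lvS: "(\<lambda>v. if v < n \<and> lv m v = m then i else lv m v) = lv (Suc m)"
        using 2(1) by (auto simp: lv_def fun_eq_iff less_Suc_eq)
      have lm: "{v. v < n \<and> lv m v = m} = {v. v < n \<and> lev1 v = m}" using 2(1) by (auto simp: lv_def)
      have c: "card {v. v < n \<and> m \<le> lev1 v} =
          card {v. v < n \<and> lev1 v = m} + card {v. v < n \<and> Suc m \<le> lev1 v}"
        by (subst card_Un_disjoint[symmetric]) (auto intro!: arg_cong[of _ _ card])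
      have R3R': "R3 \<subseteq> R'" by (auto simp: R3_def)
      have "Inv ((fst s3)(11 := Suc m), snd s3)
        (1000 * card R3 + 1000 * card {v. v < n \<and> Suc m \<le> lev1 v} + 200 * (K + 1 - Suc m))"
        unfolding Inv_def
      proof (rule exI[of _ "Suc m"], rule exI[of _ R3], intro conjI allI impI ballI)
        fix e assume e: "e \<in> R - R3"
        show "\<exists>u v. e = {u, v} \<and> i \<le> lev u \<and> i \<le> lev v"
        proof (cases "e \<in> R'")
          case True
          then obtain u v where uv: "e = {u, v}" "lv m v = m" "m \<le> lv m u" using e by (auto simp: R3_def)
          then have n: "u < n" "v < n" using True edges_okD[OF okR', of u v] by auto
          have "i \<le> lev1 v" "i \<le> lev1 u" using uv 2(1) by (auto simp: lv_def split: if_splits)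
          then have "i \<le> lev v" "i \<le> lev u" using U1 n by auto
          then show ?thesis using uv by blast
        qed (use e 2(4) in blast)
      next
        fix u v assume *: "{u, v} \<in> R3 \<and> i \<le> lev1 u \<and> lev1 u < Suc m"
        then have e: "{u, v} \<in> R'" and n: "u < n" "v < n" using R3R' edges_okD[OF okR'] by blast+
        show "\<not> i \<le> lev1 v"
        proof
          assume iv: "i \<le> lev1 v"
          have "\<not> lev1 u < m" using 2(5) e iv * by blast
          then have um: "lev1 u = m" using * by simp
          moreover have "\<not> lev1 v < m" using 2(5) e iv * by (metis insert_commute)
          ultimately have "lv m u = m" "m \<le> lv m v" by (auto simp: lv_def)
          moreover have "{u, v} = {v, u}" by auto
          ultimately show False using * by (auto simp: R3_def)
        qed
      next
        show "stores E (lv (Suc m)) R3 ((fst s3)(11 := Suc m), snd s3)" using s3(2) lvS by (simp add: stores_reg)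
      qed (use 2 s3 mK R3R' in auto)
      moreover have "1 + test_cost ?p + (t3 + 4) +
          (1000 * card R3 + 1000 * card {v. v < n \<and> Suc m \<le> lev1 v} + 200 * (K + 1 - Suc m)) \<le> k"
        using t3 2(8) c mK unfolding lm by simp
      ultimately show ?case
        by (intro iffD2[OF wp_Assign]) (use r3 Kmod[OF mK] small_lit[of 1] in auto)
    qed (use 2 i in auto)
  qed
  have mv: "wp w (moveall_com 13 11) ?s0 (\<lambda>t s'. \<exists>k. Inv s' k \<and>
     t + k \<le> 1000 * card R + 2000 * card ?U + 200 * K + 100)"
  proof (rule wp_mono[OF moveall_wp[OF I0, where m = i and tg = "Suc i"]], goal_cases)
    case (9 t1 s1)
    define R1 where "R1 = R - {e. \<exists>u v. e = {u, v} \<and> lev v = i \<and> i \<le> lev u}"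
    from 9 have s1: "\<forall>r. r \<notin> {6,9,10,14,16,17} \<longrightarrow> fst s1 r = fst ?s0 r"
      "stores E (\<lambda>v. if v < n \<and> lev v = i then Suc i else lev v) R1 s1" and
      t1: "t1 + 1000 * card R1 \<le> 1000 * card R + 1000 * card {v. v < n \<and> lev v = i} + 100"
      unfolding R1_def by auto
    have lv1: "(\<lambda>v. if v < n \<and> lev v = i then Suc i else lev v) = lv (Suc i)"
      by (auto simp: fun_eq_iff lv_def lev1_def)
    have "Inv s1 (1000 * card R1 + 1000 * card {v. v < n \<and> Suc i \<le> lev1 v} + 200 * (K + 1 - Suc i))"
      unfolding Inv_def
    proof (rule exI[of _ "Suc i"], rule exI[of _ R1], intro conjI allI impI ballI)
      fix e assume e: "e \<in> R - R1"
      then obtain u v where "e = {u, v}" "lev v = i" "i \<le> lev u" by (auto simp: R1_def)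
      then show "\<exists>u v. e = {u, v} \<and> i \<le> lev u \<and> i \<le> lev v" by auto
    next
      fix u v assume "{u, v} \<in> R1 \<and> i \<le> lev1 u \<and> lev1 u < Suc i"
      then have "lev1 u = i" "u < n" using edges_okD[OF okR, of u v] by (auto simp: R1_def)
      then show "\<not> i \<le> lev1 v" using lev1_ne by blast
    qed (use s1 i lv1 in \<open>auto simp: R1_def\<close>)
    moreover have "card {v. v < n \<and> lev v = i} \<le> card ?U" "card {v. v < n \<and> Suc i \<le> lev1 v} \<le> card ?U"
      by (auto intro!: card_mono simp: lev1_def split: if_splits)
    then have "t1 + (1000 * card R1 + 1000 * card {v. v < n \<and> Suc i \<le> lev1 v} + 200 * (K + 1 - Suc i))
      \<le> 1000 * card R + 2000 * card ?U + 200 * K + 100" using t1 i by simp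
    ultimately show ?case by blast
  qed (use i in auto)
  have a: "val w s (Add (Reg 13) (Lit 1)) = Suc i" using i small_lit[of 1] i1 by simp
  show ?thesis unfolding collapse_com_def wp_Seq wp_Assign a
  proof (rule wp_mono[OF mv], elim exE conjE, rule wp_mono[OF loop], assumption, elim exE conjE)
    fix t1 :: nat and s1 k1 t s' k
    assume t1: "t1 + k1 \<le> 1000 * card R + 2000 * card ?U + 200 * K + 100"
      and "Inv s' k" and h: "\<not> holds w s' ?p" and t: "t + k \<le> k1 + 1 + test_cost ?p"
    then obtain m R' where 2: "i < m" "m \<le> K + 1" "fst s' 11 = m" "R' \<subseteq> R"
      "\<forall>e \<in> R - R'. \<exists>u v. e = {u, v} \<and> i \<le> lev u \<and> i \<le> lev v"
      "\<forall>u v. {u, v} \<in> R' \<and> i \<le> lev1 u \<and> lev1 u < m \<longrightarrow> \<not> i \<le> lev1 v"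
      "stores E (lv m) R' s'" "\<forall>r. r \<notin> {6,9,10,11,14,16,17} \<longrightarrow> fst s' r = fst s r"
      "k = 1000 * card R' + 1000 * card {v. v < n \<and> m \<le> lev1 v} + 200 * (K + 1 - m)"
      unfolding Inv_def by blast
    have "fst s' 4 = K" using stores_E[OF 2(7)] rep_D(2) by metis
    then have m: "m = K + 1" using h 2(2,3) by simp
    have okR': "edges_ok n R'" using stores_E[OF 2(7)] by metis
    have lvm: "lv m = (\<lambda>v. if v < n \<and> i \<le> lev v then i else lev v)"
    proof
      fix v show "lv m v = (if v < n \<and> i \<le> lev v then i else lev v)"
      proof (cases "v < n \<and> i \<le> lev v")
        case True
        then show ?thesis using lev1K[of v] U1[of v] m by (simp add: lv_def)
      next
        case False
        then have "lev1 v = lev v" by (auto simp: lev1_def)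
        then show ?thesis using False by (auto simp: lv_def)
      qed
    qed
    show "(\<forall>r. r \<notin> {6,9,10,11,14,16,17} \<longrightarrow> fst s' r = fst s r) \<and>
      (\<exists>R'. R' \<subseteq> R \<and> (\<forall>e \<in> R - R'. \<exists>u v. e = {u, v} \<and> i \<le> lev u \<and> i \<le> lev v) \<and>
      (\<forall>u v. {u, v} \<in> R' \<longrightarrow> \<not> (i \<le> lev u \<and> i \<le> lev v)) \<and>
      stores E (\<lambda>v. if v < n \<and> i \<le> lev v then i else lev v) R' s' \<and>
      1 + exp_cost (Add (Reg 13) (Lit 1)) + (t1 + t) + 1000 * card R' \<le> 1000 * card R + 2000 * card {v. v < n \<and> i \<le> lev v} + 1000 * K)"
    proof (intro conjI, rule 2(8))
      note r6 = 2(6)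
      show "\<exists>R'. R' \<subseteq> R \<and> (\<forall>e \<in> R - R'. \<exists>u v. e = {u, v} \<and> i \<le> lev u \<and> i \<le> lev v) \<and>
        (\<forall>u v. {u, v} \<in> R' \<longrightarrow> \<not> (i \<le> lev u \<and> i \<le> lev v)) \<and>
        stores E (\<lambda>v. if v < n \<and> i \<le> lev v then i else lev v) R' s' \<and>
        1 + exp_cost (Add (Reg 13) (Lit 1)) + (t1 + t) + 1000 * card R' \<le> 1000 * card R + 2000 * card {v. v < n \<and> i \<le> lev v} + 1000 * K"
      proof (rule exI[of _ R'], intro conjI allI impI)
        fix u v assume e: "{u, v} \<in> R'"
        have n: "u < n" "v < n" using edges_okD[OF okR' e] by auto
      show "\<not> (i \<le> lev u \<and> i \<le> lev v)"
      proof
        assume "i \<le> lev u \<and> i \<le> lev v"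
        then have "i \<le> lev1 u" "i \<le> lev1 v" "lev1 u < m" using U1 n lev1K[of u] m by auto
        then show False using r6 e by blast
      qed
    next
      show "1 + exp_cost (Add (Reg 13) (Lit 1)) + (t1 + t) + 1000 * card R' \<le> 1000 * card R + 2000 * card {v. v < n \<and> i \<le> lev v} + 1000 * K"
        using t1 t 2(9) K_pos by simp
      next
        show "stores E (\<lambda>v. if v < n \<and> i \<le> lev v then i else lev v) R' s'" using 2(7) unfolding lvm .
      qed (rule 2(4,5))+
    qed
  qed
qed

end

section \<open>Promotion\<close>

text \<open>Sequences associate to the right; regrouping lets the specification of a prefix be
  applied as a whole.\<close>

lemma wp_Seq_assoc: "wp w (a ;; b ;; c) s Post \<longleftrightarrow> wp w ((a ;; b) ;; c) s Post"
  by (simp add: wp_Seq add.assoc)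

definition promote_com :: com where
  "promote_com = detach_com ;; setlev_com 4 ;; find_com ;; collapse_com"

definition body_com :: com where
  "body_com =
    pop_com ;; record_com ;;
    Assign 9 (Reg 7) ;;
    Cond (Less (Reg 5) (degE 9)) Skip (Assign 9 (Reg 8)) ;;
    Cond (Less (Reg 5) (degE 9)) promote_com Skip"

text \<open>The effect of a promotion as far as the analysis needs it, free of the machine.
  \<open>U\<close> is determined after \<open>v\<close> has been put into layer \<open>K\<close>, so
  that \<open>v\<close> belongs to it.\<close>

definition promoted ::
  "nat \<Rightarrow> nat \<Rightarrow> (nat \<Rightarrow> nat) \<Rightarrow> nat set set \<Rightarrow> nat \<Rightarrow> (nat \<Rightarrow> nat) \<Rightarrow> nat set set \<Rightarrow> nat set \<Rightarrow> nat \<Rightarrow> bool" where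
  "promoted n K lev R v lev' R' U i \<longleftrightarrow> 1 \<le> i \<and> i < K \<and>
    U = {u. u < n \<and> i \<le> (lev(v := K)) u} \<and>
    card U < 2 * card {u. u < n \<and> i < (lev(v := K)) u} \<and>
    lev' = (\<lambda>u. if u \<in> U then i else (lev(v := K)) u) \<and>
    R' \<subseteq> R - up_edges lev v \<and>
    (\<forall>e \<in> R - up_edges lev v - R'. e \<subseteq> U) \<and>
    (\<forall>e \<in> R'. \<not> e \<subseteq> U)"

context ram begin

lemma stores_cong:
  assumes "snd s' = snd s" "\<And>r. r \<in> {3,4,5,6} \<Longrightarrow> fst s' r = fst s r" "stores E lev R s"
  shows "stores E lev R s'"
proof -
  have "cell s' = cell s" using assms(1) by (auto simp: cell_def fun_eq_iff)
  then have "rep s' A lev P \<longleftrightarrow> rep s A lev P" for A P unfolding rep_def using assms(2) by simp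
  then show ?thesis using assms(3) by (simp add: stores_def)
qed

text \<open>By \<open>top\<close> the doubling starts from one vertex, so
  \<open>2 ^ (K - m) \<le> G m\<close> is invariant. Together with \<open>G m \<le> n\<close> and
  \<open>n < 2 ^ (K - 1)\<close> this keeps \<open>m\<close> at least 2, so the layer found is at
  least 1. The loop stops when layer \<open>m - 1\<close> has fewer than \<open>G m\<close>
  vertices, that is, when \<open>G (m - 1) < 2 * G m\<close>.\<close>

lemma find_wp:
  assumes stores: "stores E lev R s" and lev: "\<And>v. v < n \<Longrightarrow> 1 \<le> lev v \<and> lev v \<le> K"
    and top: "card {v. v < n \<and> lev v = K} = 1"
  shows "wp w find_com s (\<lambda>t s'. (\<forall>r. r \<notin> {11,12,13} \<longrightarrow> fst s' r = fst s r) \<and> stores E lev R s' \<and>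
    t \<le> 100 * K + 100 \<and> 1 \<le> fst s' 13 \<and> fst s' 13 < K \<and>
    card {v. v < n \<and> fst s' 13 \<le> lev v} < 2 * card {v. v < n \<and> fst s' 13 < lev v})"
proof -
  define G where "G m = card {v. v < n \<and> m \<le> lev v}" for m
  let ?sz = "sizeE 6 (Sub (Reg 11) (Lit 1))"
  let ?p = "Neg (Less ?sz (Reg 12))"
  define Inv where "Inv s' k \<longleftrightarrow> (\<exists>m. fst s' 11 = m \<and> m \<le> K \<and> fst s' 12 = G m \<and> 2 ^ (K - m) \<le> G m \<and>
    snd s' = snd s \<and> (\<forall>r. r \<notin> {11,12,13} \<longrightarrow> fst s' r = fst s r) \<and> k = 100 * m)" for s' :: state and k
  have Gn: "G m \<le> n" for m
    using card_mono[of "{..<n}" "{v. v < n \<and> m \<le> lev v}"] unfolding G_def by auto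
  have GS: "G m = card {v. v < n \<and> lev v = m} + G (Suc m)" for m
    unfolding G_def by (subst card_Un_disjoint[symmetric]) (auto intro!: arg_cong[of _ _ card])
  have GK: "G K = 1"
  proof -
    have "{v. v < n \<and> K \<le> lev v} = {v. v < n \<and> lev v = K}" using lev by (auto simp: le_antisym)
    then show ?thesis using top by (simp add: G_def)
  qed
  have m2: "2 \<le> m" if "m \<le> K" "2 ^ (K - m) \<le> G m" for m
  proof (rule ccontr)
    assume "\<not> 2 \<le> m"
    then have "K - 1 \<le> K - m" by simp
    then have "(2::nat) ^ (K - 1) \<le> 2 ^ (K - m)" by (intro power_increasing) auto
    then show False using that(2) Gn[of m] K2 by linarith
  qed
  have Isz: "stores E lev R s' \<and> val w s' ?sz = card {v. v < n \<and> lev v = m - 1}"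
    if "snd s' = snd s" "\<forall>r. r \<notin> {11,12,13} \<longrightarrow> fst s' r = fst s r" "fst s' 11 = m" "m \<le> K" for s' m
  proof -
    have stores': "stores E lev R s'" by (rule stores_cong[OF that(1) _ stores]) (use that(2) in auto)
    have v: "val w s' (Sub (Reg 11) (Lit 1)) = m - 1" using that(3) small_lit[of 1] by simp
    then have "val w s' ?sz = card (lists_of n lev R 6 (m - 1))"
      using stores_size[OF stores', of 6 "Sub (Reg 11) (Lit 1)"] that(4) KQ by (simp del: val.simps)
    then show ?thesis using stores' by (simp add: lists_of_def)
  qed
  have r4: "fst s 4 = K" using stores_E[OF stores] rep_D(2) by metis
  let ?s0 = "((fst s)(11 := K, 12 := 1), snd s)"
  have 0: "Inv ?s0 (100 * K)" unfolding Inv_def by (intro exI[of _ K]) (simp add: GK)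
  let ?c = "Assign 12 (Add (Reg 12) ?sz) ;; Assign 11 (Sub (Reg 11) (Lit 1))"
  have tc: "test_cost ?p \<le> 30" by (simp add: exp_cost_AddrE)
  have loop: "wp w (While ?p ?c) ?s0
     (\<lambda>t s'. \<exists>m'. Inv s' m' \<and> \<not> holds w s' ?p \<and> t + m' \<le> 100 * K + 1 + test_cost ?p)"
  proof (rule wp_While[where Inv = Inv, OF 0])
    fix s1 k assume "Inv s1 k" and h: "holds w s1 ?p"
    then obtain m where m: "fst s1 11 = m" "m \<le> K" "fst s1 12 = G m" "2 ^ (K - m) \<le> G m"
      "snd s1 = snd s" "\<forall>r. r \<notin> {11,12,13} \<longrightarrow> fst s1 r = fst s r" "k = 100 * m" unfolding Inv_def by blast
    have mm: "2 \<le> m" by (rule m2[OF m(2,4)])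
    have sz: "val w s1 ?sz = card {v. v < n \<and> lev v = m - 1}" using Isz[OF m(5,6,1,2)] by blast
    have GS': "G (m - 1) = card {v. v < n \<and> lev v = m - 1} + G m" using GS[of "m - 1"] mm by simp
    have "\<not> card {v. v < n \<and> lev v = m - 1} < G m" using h sz m(3) by (simp del: val.simps(3))
    then have 2: "2 * G m \<le> G (m - 1)" using GS' by simp
    have "G (m - 1) < 2 ^ w" using Gn[of "m - 1"] n_less by simp
    then have v12: "val w s1 (Add (Reg 12) ?sz) = G (m - 1)" using sz m(3) GS'
      by (simp del: val.simps(3) add: add.commute)
    let ?s2 = "((fst s1)(12 := G (m - 1), 11 := m - 1), snd s1)"
    have "K - (m - 1) = Suc (K - m)" using mm m(2) by simp
    then have "2 ^ (K - (m - 1)) \<le> G (m - 1)" using 2 m(4) by simp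
    then have "Inv ?s2 (100 * (m - 1))" unfolding Inv_def using m mm by (intro exI[of _ "m - 1"]) simp
    moreover have "wp w ?c s1 (\<lambda>t s'. t \<le> 40 \<and> s' = ?s2)"
      unfolding wp_Seq wp_Assign v12 using m(1) small_lit[of 1] by (simp add: exp_cost_AddrE)
    ultimately show "wp w ?c s1 (\<lambda>t s'. \<exists>m'. Inv s' m' \<and> 1 + test_cost ?p + t + m' \<le> k)"
      using m(7) mm tc by (elim wp_mono) (auto intro!: exI[of _ "100 * (m - 1)"])
  qed
  have v: "val w s (Reg 4) = K" "val w ((fst s)(11 := K), snd s) (Lit 1) = 1"
    using r4 small_lit[of 1] by auto
  show ?thesis unfolding find_com_def wp_Seq wp_Assign v fst_conv snd_conv
  proof (rule wp_mono[OF loop], elim exE conjE)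
    fix t s1 k assume "Inv s1 k" and h: "\<not> holds w s1 ?p" and t: "t + k \<le> 100 * K + 1 + test_cost ?p"
    then obtain m where m: "fst s1 11 = m" "m \<le> K" "fst s1 12 = G m" "2 ^ (K - m) \<le> G m"
      "snd s1 = snd s" "\<forall>r. r \<notin> {11,12,13} \<longrightarrow> fst s1 r = fst s r" "k = 100 * m" unfolding Inv_def by blast
    have mm: "2 \<le> m" by (rule m2[OF m(2,4)])
    have sz: "stores E lev R s1" "val w s1 ?sz = card {v. v < n \<and> lev v = m - 1}"
      using Isz[OF m(5,6,1,2)] by blast+
    have GS': "G (m - 1) = card {v. v < n \<and> lev v = m - 1} + G m" using GS[of "m - 1"] mm by simp
    have "card {v. v < n \<and> lev v = m - 1} < G m" using h sz m(3) by (simp del: val.simps(3))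
    then have "G (m - 1) < 2 * G m" using GS' by simp
    moreover have "{v. v < n \<and> m - 1 < lev v} = {v. v < n \<and> m \<le> lev v}" using mm by auto
    ultimately have g: "card {v. v < n \<and> m - 1 \<le> lev v} < 2 * card {v. v < n \<and> m - 1 < lev v}"
      by (simp add: G_def)
    have v1: "val w s1 (Sub (Reg 11) (Lit 1)) = m - 1" using m(1) small_lit[of 1] by simp
    show "(\<forall>r. r \<notin> {11,12,13} \<longrightarrow>
          ((fst s1)(13 := val w s1 (Sub (Reg 11) (Lit 1)))) r = fst s r) \<and>
      stores E lev R ((fst s1)(13 := val w s1 (Sub (Reg 11) (Lit 1))), snd s1) \<and>
      1 + exp_cost (Reg 4) + (1 + exp_cost (Lit 1) + (t + (1 + exp_cost (Sub (Reg 11) (Lit 1)))))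
        \<le> 100 * K + 100 \<and>
      1 \<le> ((fst s1)(13 := val w s1 (Sub (Reg 11) (Lit 1)))) 13 \<and>
      ((fst s1)(13 := val w s1 (Sub (Reg 11) (Lit 1)))) 13 < K \<and>
      card {v. v < n \<and> ((fst s1)(13 := val w s1 (Sub (Reg 11) (Lit 1)))) 13 \<le> lev v}
        < 2 * card {v. v < n \<and> ((fst s1)(13 := val w s1 (Sub (Reg 11) (Lit 1)))) 13 < lev v}"
    proof (intro conjI)
      show "stores E lev R ((fst s1)(13 := val w s1 (Sub (Reg 11) (Lit 1))), snd s1)"
        by (rule iffD2[OF stores_reg sz(1)]) simp
    next
      show "1 + exp_cost (Reg 4) + (1 + exp_cost (Lit 1) + (t + (1 + exp_cost (Sub (Reg 11) (Lit 1)))))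
        \<le> 100 * K + 100" using t tc m(2,7) by (simp del: test_cost.simps)
    qed (unfold v1, use m(2,6) mm g in simp_all)
  qed
qed

lemma promote_wp:
  assumes stores: "stores E lev R s" and v: "fst s 9 = v" "v < n" and lev: "\<And>v. v < n \<Longrightarrow> 1 \<le> lev v \<and> lev v < K"
  shows "wp w promote_com s (\<lambda>t s'. \<exists>lev' R' U i. stores E lev' R' s' \<and> promoted n K lev R v lev' R' U i \<and>
    t + 1000 * card R' \<le> 1000 * card R + 2000 * card U + 1100 * K + 1000)"
  unfolding promote_com_def wp_Seq
proof (rule wp_mono[OF detach_wp[OF stores v]], elim conjE)
  let ?R1 = "R - up_edges lev v" and ?lev1 = "lev(v := K)"
  fix t1 :: nat and s1 :: state
  assume s1: "\<forall>r. r \<notin> {6,10,16,17} \<longrightarrow> fst s1 r = fst s r" "stores E lev ?R1 s1"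
    and t1: "t1 + 1000 * card ?R1 \<le> 1000 * card R + 100"
  have r: "fst s1 9 = v" using s1(1) v by simp
  have r4: "fst s1 4 = K" using stores_E[OF s1(2)] rep_D(2) by metis
  have lv: "lev v < K" "lev v < Q" using lev[OF v(2)] KQ by auto
  have up: "lev u < lev v \<and> lev u < K" if "{v, u} \<in> ?R1" for u
    using that lv by (auto simp: up_edges_def not_le[symmetric])
  have lev1: "1 \<le> ?lev1 u \<and> ?lev1 u \<le> K" if "u < n" for u using lev[OF that] K_pos by auto
  \<comment> \<open>The top layer is empty before a promotion, so \<open>v\<close> is alone in
    it.\<close>
  have "{u. u < n \<and> ?lev1 u = K} = {v}" using v(2) lev by (auto split: if_splits)
  then have top: "card {u. u < n \<and> ?lev1 u = K} = 1" by simp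
  show "wp w (setlev_com 4) s1 (\<lambda>t2 s2. wp w find_com s2 (\<lambda>t3 s3. wp w collapse_com s3
    (\<lambda>t4 s'. \<exists>lev' R' U i. stores E lev' R' s' \<and> promoted n K lev R v lev' R' U i \<and>
      t1 + (t2 + (t3 + t4)) + 1000 * card R' \<le> 1000 * card R + 2000 * card U + 1100 * K + 1000)))"
  proof (rule wp_mono[OF setlev_stores_wp[OF s1(2) r v(2) lv(2) r4 KQ _ up]], simp, assumption, elim conjE)
    fix t2 :: nat and s2 :: state
    assume t2: "t2 \<le> 400" and s2: "stores E ?lev1 ?R1 s2"
    show "wp w find_com s2 (\<lambda>t3 s3. wp w collapse_com s3
      (\<lambda>t4 s'. \<exists>lev' R' U i. stores E lev' R' s' \<and> promoted n K lev R v lev' R' U i \<and>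
        t1 + (t2 + (t3 + t4)) + 1000 * card R' \<le> 1000 * card R + 2000 * card U + 1100 * K + 1000))"
    proof (rule wp_mono[OF find_wp[OF s2 lev1 top]], assumption, elim conjE)
      fix t3 :: nat and s3 :: state
      define i where "i = fst s3 13"
      let ?U = "{u. u < n \<and> i \<le> ?lev1 u}"
      assume t3: "t3 \<le> 100 * K + 100" and s3: "stores E ?lev1 ?R1 s3" and "1 \<le> fst s3 13" "fst s3 13 < K"
        and "card {v. v < n \<and> fst s3 13 \<le> ?lev1 v} < 2 * card {v. v < n \<and> fst s3 13 < ?lev1 v}"
      then have i: "1 \<le> i" "i < K" "card ?U < 2 * card {u. u < n \<and> i < ?lev1 u}" by (auto simp: i_def)
      show "wp w collapse_com s3
        (\<lambda>t4 s'. \<exists>lev' R' U i. stores E lev' R' s' \<and> promoted n K lev R v lev' R' U i \<and>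
          t1 + (t2 + (t3 + t4)) + 1000 * card R' \<le> 1000 * card R + 2000 * card U + 1100 * K + 1000)"
      proof (rule wp_mono[OF collapse_wp[OF s3 i_def[symmetric] i(1,2)]])
        show "?lev1 u \<le> K" if "u < n" for u using lev1[OF that] by blast
      next
        fix t4 :: nat and s4 :: state
        assume "(\<forall>r. r \<notin> {6,9,10,11,14,16,17} \<longrightarrow> fst s4 r = fst s3 r) \<and>
          (\<exists>R'. R' \<subseteq> ?R1 \<and> (\<forall>e \<in> ?R1 - R'. \<exists>u v. e = {u, v} \<and> i \<le> ?lev1 u \<and> i \<le> ?lev1 v) \<and>
            (\<forall>u v. {u, v} \<in> R' \<longrightarrow> \<not> (i \<le> ?lev1 u \<and> i \<le> ?lev1 v)) \<and>
            stores E (\<lambda>v. if v < n \<and> i \<le> ?lev1 v then i else ?lev1 v) R' s4 \<and>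
            t4 + 1000 * card R' \<le> 1000 * card ?R1 + 2000 * card ?U + 1000 * K)"
        then obtain R' where R': "R' \<subseteq> ?R1" "\<forall>e \<in> ?R1 - R'. \<exists>u v. e = {u, v} \<and> i \<le> ?lev1 u \<and> i \<le> ?lev1 v"
          "\<forall>u v. {u, v} \<in> R' \<longrightarrow> \<not> (i \<le> ?lev1 u \<and> i \<le> ?lev1 v)"
          "stores E (\<lambda>v. if v < n \<and> i \<le> ?lev1 v then i else ?lev1 v) R' s4"
          "t4 + 1000 * card R' \<le> 1000 * card ?R1 + 2000 * card ?U + 1000 * K" by blast
        let ?lev' = "\<lambda>u. if u \<in> ?U then i else ?lev1 u"
        have ok: "edges_ok n R" using stores_E[OF stores] by metis
        have "promoted n K lev R v ?lev' R' ?U i"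
          unfolding promoted_def
        proof (intro conjI refl i R'(1) ballI notI)
          fix e assume e: "e \<in> ?R1 - R'"
          then obtain x y where "e = {x, y}" "i \<le> ?lev1 x" "i \<le> ?lev1 y" using R'(2) by blast
          then show "e \<subseteq> ?U" using e edges_okD[OF ok, of x y] by auto
        next
          fix e assume e: "e \<in> R'" "e \<subseteq> ?U"
          then have "e \<in> R" using R'(1) by blast
          then obtain x y where "e = {x, y}" using ok unfolding edges_ok_def by blast
          then show False using e R'(3) by auto
        qed
        moreover have "stores E ?lev' R' s4" using R'(4) by simp
        moreover have "t1 + (t2 + (t3 + t4)) + 1000 * card R' \<le> 1000 * card R + 2000 * card ?U + 1100 * K + 1000"
          using R'(5) t1 t2 t3 by linarith
        ultimately show "\<exists>lev' R' U i. stores E lev' R' s4 \<and> promoted n K lev R v lev' R' U i \<and>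
          t1 + (t2 + (t3 + t4)) + 1000 * card R' \<le> 1000 * card R + 2000 * card U + 1100 * K + 1000" by blast
      qed
    qed
  qed
qed

section \<open>The degree invariant and one round of the main loop\<close>

definition good :: "(nat \<Rightarrow> nat) \<Rightarrow> nat set set \<Rightarrow> bool" where
  "good lev R \<longleftrightarrow> (\<forall>v<n. 1 \<le> lev v \<and> lev v < K) \<and>
    (\<forall>v<n. card {u. {v, u} \<in> R \<and> lev v \<le> lev u} \<le> \<Delta>)"

lemma up_finite: "edges_ok n R \<Longrightarrow> finite {u. {v, u} \<in> R \<and> P u}"
  by (rule finite_subset[of _ "{..<n}"]) (auto dest: edges_okD)

text \<open>No recorded edge inside \<open>U\<close> remains and all vertices outside lie below
  layer \<open>i\<close>, so a member of \<open>U\<close> has no recorded neighbour in its own or a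
  higher layer. A vertex outside \<open>U\<close> keeps its layer and gains no such neighbour:
  members of \<open>U\<close> other than \<open>v\<close> were above it before, and the edges that
  \<open>v\<close> keeps lead to vertices strictly below its old layer.\<close>

lemma promoted_good:
  assumes good: "good lev R0" and R: "R = insert {v, y} R0" "lev v \<le> lev y" and v: "v < n"
    and ok: "edges_ok n R"
    and pr: "promoted n K lev R v lev' R' U i"
  shows "good lev' R'"
proof -
  let ?lv = "lev(v := K)"
  have i: "1 \<le> i" "i < K" and U: "U = {u. u < n \<and> i \<le> ?lv u}"
    and lev'_eq: "lev' = (\<lambda>u. if u \<in> U then i else ?lv u)"
    and R': "R' \<subseteq> R - up_edges lev v" "\<forall>e \<in> R'. \<not> e \<subseteq> U" using pr unfolding promoted_def by blast+
  have lev': "lev' u = (if u \<in> U then i else ?lv u)" for u unfolding lev'_eq by simp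
  have vU: "v \<in> U" using i v U by simp
  have out: "lev' u = lev u" "lev u < i" if "u < n" "u \<notin> U" for u
  proof -
    have "u \<noteq> v" using that vU by blast
    then show "lev' u = lev u" using that(2) lev' by simp
    show "lev u < i" using that U \<open>u \<noteq> v\<close> by simp
  qed
  \<comment> \<open>The edge just recorded is itself detached, so \<open>R'\<close> can be compared
    with the good record \<open>R0\<close>.\<close>
  have "{v, y} \<in> up_edges lev v" using R(2) by (auto simp: up_edges_def)
  then have R'0: "R' \<subseteq> R0" using R'(1) R(1) by auto
  have ok0: "edges_ok n R0" using ok R(1) unfolding edges_ok_def by auto
  have 1: "1 \<le> lev' u \<and> lev' u < K" if "u < n" for u
    using good that i out[OF that] lev' unfolding good_def by (cases "u \<in> U") auto
  have 2: "card {u. {x, u} \<in> R' \<and> lev' x \<le> lev' u} \<le> \<Delta>" if x: "x < n" for x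
  proof (cases "x \<in> U")
    case True
    have uU: "u \<in> U" if "{x, u} \<in> R'" "lev' x \<le> lev' u" for u
    proof (rule ccontr)
      assume u: "u \<notin> U"
      have "u < n" using that(1) R'0 edges_okD[OF ok0] by blast
      from out[OF this u] show False using that(2) True lev' by simp
    qed
    have "\<not> ({x, u} \<in> R' \<and> lev' x \<le> lev' u)" for u
    proof
      assume *: "{x, u} \<in> R' \<and> lev' x \<le> lev' u"
      then have "{x, u} \<subseteq> U" using uU[of u] True by simp
      then show False using R'(2) * by blast
    qed
    then have "{u. {x, u} \<in> R' \<and> lev' x \<le> lev' u} = {}" by blast
    then show ?thesis by (simp only: card.empty)
  next
    case False
    have "lev x \<le> lev u" if u: "{x, u} \<in> R'" "lev' x \<le> lev' u" for u
    proof -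
      have un: "u < n" using u(1) R'0 edges_okD[OF ok0] by blast
      consider "u = v" | "u \<noteq> v" "u \<in> U" | "u \<notin> U" by blast
      then show ?thesis
      proof cases
        case 1
        have "{v, x} \<notin> up_edges lev v" using u(1) R'(1) 1 by (auto simp: insert_commute)
        then show ?thesis using 1 by (auto simp: up_edges_def)
      next
        case 2
        then show ?thesis using out(2)[OF x False] U by auto
      next
        case 3
        then show ?thesis using out(1)[OF x False] out(1)[OF un 3] u(2) by simp
      qed
    qed
    then have "card {u. {x, u} \<in> R' \<and> lev' x \<le> lev' u} \<le> card {u. {x, u} \<in> R0 \<and> lev x \<le> lev u}"
      using R'0 by (intro card_mono up_finite[OF ok0]) auto
    also have "\<dots> \<le> \<Delta>" using good x unfolding good_def by blast
    finally show ?thesis .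
  qed
  show ?thesis unfolding good_def using 1 2 by blast
qed

text \<open>A single edge raises the count by at most one, and only if its other endpoint is not
  lower. The exact value \<Delta> + 1 is needed later, since it measures both the gain of the
  promotion and its cost.\<close>

lemma good_insert:
  assumes good: "good lev R" and ok: "edges_ok n (insert {v, y} R)" and v: "v < n"
    and deg: "\<Delta> < card {u. {v, u} \<in> insert {v, y} R \<and> lev v \<le> lev u}"
  shows "lev v \<le> lev y" "card {u. {v, u} \<in> insert {v, y} R \<and> lev v \<le> lev u} = \<Delta> + 1"
proof -
  let ?A = "{u. {v, u} \<in> R \<and> lev v \<le> lev u}" and ?B = "{u. {v, u} \<in> insert {v, y} R \<and> lev v \<le> lev u}"
  have A: "card ?A \<le> \<Delta>" using good v unfolding good_def by blast
  have B: "?B \<subseteq> insert y ?A" by (auto simp: doubleton_eq_iff)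
  have fA: "finite ?A" using ok by (intro up_finite) (auto simp: edges_ok_def)
  show "lev v \<le> lev y"
  proof (rule ccontr)
    assume "\<not> lev v \<le> lev y"
    then have "?B = ?A" by (auto simp: doubleton_eq_iff)
    then show False using A deg by simp
  qed
  have "card ?B \<le> card (insert y ?A)" using B fA by (intro card_mono) auto
  also have "\<dots> \<le> Suc (card ?A)" using fA by (simp add: card_insert_if)
  finally show "card ?B = \<Delta> + 1" using A deg by simp
qed

lemma pop_record_wp:
  assumes stores: "stores E lev R s" and ne: "fst s 6 > 0"
  shows "wp w (pop_com ;; record_com) s (\<lambda>t s'. t \<le> 360 \<and> (\<exists>a b. {a, b} \<in> E - R \<and> fst s' 7 = a \<and> fst s' 8 = b \<and>
    stores E lev (insert {a, b} R) s'))"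
proof -
  obtain P where P: "edges_ok n E" "R \<subseteq> E" "edges_ok n R" "finite E"
    "rep s (lists_of n lev R) lev P" "length P = card (E - R)" "(\<lambda>(a, b). {a, b}) ` set P = E - R"
    using stores_E[OF stores] by metis
  have "P \<noteq> []" using rep_D(4)[OF P(5)] ne by auto
  then obtain P0 a b where P0: "P = P0 @ [(a, b)]" by (metis rev_exhaust surj_pair)
  have e: "{a, b} \<in> E - R" using P(7) P0 by auto
  then have ab: "a < n" "b < n" "a \<noteq> b" using edges_okD[OF P(1)] by blast+
  have E: "E - insert {a, b} R = E - R - {{a, b}}" by auto
  have c: "card (E - R) = Suc (card (E - insert {a, b} R))" unfolding E
    using e P(4) by (metis card.remove finite_Diff)
  have len: "length P0 = card (E - insert {a, b} R)" using c P(6) P0 by simp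
  \<comment> \<open>Otherwise \<open>P0\<close> would already cover \<open>E - R\<close> with one
    entry too few.\<close>
  have nin: "{a, b} \<notin> (\<lambda>(a, b). {a, b}) ` set P0"
  proof
    assume "{a, b} \<in> (\<lambda>(a, b). {a, b}) ` set P0"
    then have "(\<lambda>(a, b). {a, b}) ` set P0 = E - R" using P(7) P0 by (simp add: insert_absorb)
    then have "card (E - R) \<le> card (set P0)" by (metis List.finite_set card_image_le)
    also have "\<dots> \<le> length P0" by (rule card_length)
    finally show False using len c by simp
  qed
  have "insert {a, b} ((\<lambda>(a, b). {a, b}) ` set P0) = E - R" using P(7) P0 by simp
  then have im: "(\<lambda>(a, b). {a, b}) ` set P0 = E - insert {a, b} R" using nin E by blast
  have "card (E - R) \<le> n * n" using edges_ok_finite_card(2)[OF P(1)] card_mono[of E "E - R"] P(4) by auto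
  then have "length P0 < n * n" using c len by simp
  note pop = pop_wp[OF P(5)[unfolded P0] this]
  show ?thesis unfolding wp_Seq
  proof (rule wp_mono[OF pop], elim conjE)
    fix t1 :: nat and s1 :: state
    assume t1: "t1 \<le> 60" and s1: "fst s1 7 = a" "fst s1 8 = b" "rep s1 (lists_of n lev R) lev P0"
    show "wp w record_com s1 (\<lambda>t s'. t1 + t \<le> 360 \<and> (\<exists>a b. {a, b} \<in> E - R \<and> fst s' 7 = a \<and> fst s' 8 = b \<and>
        stores E lev (insert {a, b} R) s'))"
    proof (rule wp_mono[OF record_wp[OF s1(3,1) ab(1) s1(2) ab(2,3)]])
      show "{a, b} \<notin> R" using e by blast
    next
      fix t :: nat and s' :: state
      assume *: "t \<le> 300 \<and> fst s' = fst s1 \<and> rep s' (lists_of n lev (insert {a, b} R)) lev P0"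
      then have "stores E lev (insert {a, b} R) s'" unfolding stores_def using P(1,2) e len im by blast
      then show "t1 + t \<le> 360 \<and> (\<exists>a b. {a, b} \<in> E - R \<and> fst s' 7 = a \<and> fst s' 8 = b \<and>
        stores E lev (insert {a, b} R) s')" using * e s1 t1 by auto
    qed
  qed
qed

text \<open>If both endpoints are in the same layer, both may exceed the bound at once. Promoting
  one of them suffices, because it makes the new edge pending again and so relieves the other
  endpoint too.\<close>

lemma body_wp:
  assumes stores: "stores E lev R s" and good: "good lev R" and ne: "fst s 6 > 0"
  shows "wp w body_com s (\<lambda>t s'. \<exists>e \<in> E - R.
    (good lev (insert e R) \<and> stores E lev (insert e R) s' \<and> t \<le> 900) \<or>
    (\<exists>v lev' R' U i. v < n \<and> card {u. {v, u} \<in> insert e R \<and> lev v \<le> lev u} = \<Delta> + 1 \<and>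
      good lev' R' \<and> stores E lev' R' s' \<and> promoted n K lev (insert e R) v lev' R' U i \<and>
      t + 1000 * card R' \<le> 1000 * card (insert e R) + 2000 * card U + 1100 * K + 1900))"
proof -
  let ?Post = "\<lambda>t s'. \<exists>e \<in> E - R.
    (good lev (insert e R) \<and> stores E lev (insert e R) s' \<and> t \<le> 900) \<or>
    (\<exists>v lev' R' U i. v < n \<and> card {u. {v, u} \<in> insert e R \<and> lev v \<le> lev u} = \<Delta> + 1 \<and>
      good lev' R' \<and> stores E lev' R' s' \<and> promoted n K lev (insert e R) v lev' R' U i \<and>
      t + 1000 * card R' \<le> 1000 * card (insert e R) + 2000 * card U + 1100 * K + 1900)"
  let ?c = "Assign 9 (Reg 7) ;; Cond (Less (Reg 5) (degE 9)) Skip (Assign 9 (Reg 8)) ;;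
    Cond (Less (Reg 5) (degE 9)) promote_com Skip"
  have rest: "wp w ?c s1 (\<lambda>t s'. ?Post (360 + t) s')"
    if e: "{a, b} \<in> E - R" and ab: "fst s1 7 = a" "fst s1 8 = b" and I1: "stores E lev (insert {a, b} R) s1"
    for s1 a b
  proof -
    let ?R = "insert {a, b} R"
    define deg where "deg v = card {u. {v, u} \<in> ?R \<and> lev v \<le> lev u}" for v
    have ok: "edges_ok n ?R" using stores_E[OF I1] by metis
    have n: "a < n" "b < n" "a \<noteq> b" using edges_okD[OF ok, of a b] by auto
    have r5: "fst s1 5 = \<Delta>" using stores_E[OF I1] rep_D(3) by metis
    define v where "v = (if \<Delta> < deg a then a else b)"
    let ?s2 = "((fst s1)(9 := v), snd s1)"
    have vn: "v < n" using n by (simp add: v_def)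
    have I2: "stores E lev ?R ((fst s1)(9 := x), snd s1)" for x using I1 by (simp add: stores_reg)
    have d: "val w ((fst s1)(9 := x), snd s1) (degE 9) = deg x" if "x < n" for x
      using degE_val[OF I2[of x] _ that] by (simp add: deg_def)
    have tc: "test_cost (Less (Reg 5) (degE 9)) \<le> 30" by (simp add: degE_def exp_cost_AddrE)
    have sel: "wp w (Assign 9 (Reg 7) ;; Cond (Less (Reg 5) (degE 9)) Skip (Assign 9 (Reg 8))) s1
      (\<lambda>t s'. t \<le> 100 \<and> s' = ?s2)"
      using tc ab d[of a] n r5 by (auto simp: wp_simps v_def simp del: test_cost.simps)
    show ?thesis
    proof (cases "\<Delta> < deg v")
      case False
      have "good lev ?R" unfolding good_def
      proof (intro conjI allI impI)
        fix x assume x: "x < n"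
        show "card {u. {x, u} \<in> ?R \<and> lev x \<le> lev u} \<le> \<Delta>"
        proof (cases "x \<in> {a, b}")
          case True
          then show ?thesis using False unfolding v_def deg_def[symmetric] by (auto split: if_splits)
        next
          case F: False
          then have "{u. {x, u} \<in> ?R \<and> lev x \<le> lev u} = {u. {x, u} \<in> R \<and> lev x \<le> lev u}" by auto
          then show ?thesis using good x unfolding good_def by simp
        qed
      qed (use good in \<open>auto simp: good_def\<close>)
      then have "wp w (Cond (Less (Reg 5) (degE 9)) promote_com Skip) ?s2 (\<lambda>t s'. t \<le> 100 \<and> s' = ?s2)"
        using tc False d[OF vn] r5 by (simp add: wp_Cond wp_Skip del: test_cost.simps)
      then show ?thesis unfolding wp_Seq_assoc wp_Seq[of w "_ ;; _"]
      proof (intro wp_mono[OF sel], elim conjE, hypsubst, elim wp_mono conjE, goal_cases)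
        case (1 t1 s2 t2 s3)
        then show ?case using e I2[of v] \<open>good lev ?R\<close>
          by (intro bexI[of _ "{a, b}"] disjI1 conjI) simp_all
      qed
    next
      case True
      have "{a, b} = {v, if v = a then b else a}" by (auto simp: v_def)
      then obtain y where y: "{a, b} = {v, y}" by blast
      have Ry: "?R = insert {v, y} R" using y by simp
      have gi: "lev v \<le> lev y" "deg v = \<Delta> + 1"
        using good_insert[OF good ok[unfolded y] vn] True unfolding deg_def y by blast+
      have lev: "1 \<le> lev u \<and> lev u < K" if "u < n" for u using good that unfolding good_def by blast
      have pw: "wp w promote_com ?s2 (\<lambda>t s'. \<exists>lev' R' U i. stores E lev' R' s' \<and> promoted n K lev ?R v lev' R' U i \<and>
        t + 1000 * card R' \<le> 1000 * card ?R + 2000 * card U + 1100 * K + 1000)"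
        by (rule promote_wp[OF I2 _ vn lev]) auto
      have "wp w (Cond (Less (Reg 5) (degE 9)) promote_com Skip) ?s2
        (\<lambda>t s'. \<exists>lev' R' U i. stores E lev' R' s' \<and> promoted n K lev ?R v lev' R' U i \<and>
        t + 1000 * card R' \<le> 1000 * card ?R + 2000 * card U + 1100 * K + 1100)"
      proof -
        have h: "holds w ?s2 (Less (Reg 5) (degE 9))" using True d[OF vn] r5 by simp
        show ?thesis unfolding wp_Cond if_P[OF h]
        proof (rule wp_mono[OF pw], elim exE conjE)
          fix t s' lev' R' U i
          assume "stores E lev' R' s'" "promoted n K lev ?R v lev' R' U i" and
            t: "t + 1000 * card R' \<le> 1000 * card ?R + 2000 * card U + 1100 * K + 1000"
          moreover have "1 + test_cost (Less (Reg 5) (degE 9)) + t + 1000 * card R' \<le>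
            1000 * card ?R + 2000 * card U + 1100 * K + 1100" using t tc by linarith
          ultimately show "\<exists>lev' R' U i. stores E lev' R' s' \<and> promoted n K lev ?R v lev' R' U i \<and>
            1 + test_cost (Less (Reg 5) (degE 9)) + t + 1000 * card R' \<le>
            1000 * card ?R + 2000 * card U + 1100 * K + 1100" by blast
        qed
      qed
      then show ?thesis unfolding wp_Seq_assoc wp_Seq[of w "_ ;; _"]
      proof (intro wp_mono[OF sel], elim conjE, hypsubst, elim wp_mono exE conjE, goal_cases)
        case (1 t1 s2 t2 s3 lev' R' U i)
        have "good lev' R'" using 1 promoted_good[OF good Ry gi(1) vn ok] by blast
        moreover have "360 + (t1 + t2) + 1000 * card R' \<le> 1000 * card ?R + 2000 * card U + 1100 * K + 1900"
          using 1 by linarith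
        ultimately show ?case using 1 e gi(2) vn unfolding deg_def by blast
      qed
    qed
  qed
  show ?thesis unfolding body_com_def wp_Seq_assoc[of w pop_com] wp_Seq[of w "_ ;; _"]
  proof (rule wp_mono[OF pop_record_wp[OF stores ne]], elim exE conjE)
    fix t1 :: nat and s1 :: state and a b
    assume 1: "t1 \<le> (360 :: nat)" "{a, b} \<in> E - R" "fst s1 7 = a" "fst s1 8 = b" "stores E lev (insert {a, b} R) s1"
    show "wp w ?c s1 (\<lambda>t. ?Post (t1 + t))"
    proof (rule wp_mono[OF rest[OF 1(2-5)]], elim bexE)
      fix t2 :: nat and s2 :: state and e
      assume "e \<in> E - R" "(good lev (insert e R) \<and> stores E lev (insert e R) s2 \<and> 360 + t2 \<le> 900) \<or>
      (\<exists>v lev' R' U i. v < n \<and> card {u. {v, u} \<in> insert e R \<and> lev v \<le> lev u} = \<Delta> + 1 \<and>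
      good lev' R' \<and> stores E lev' R' s2 \<and> promoted n K lev (insert e R) v lev' R' U i \<and>
      360 + t2 + 1000 * card R' \<le> 1000 * card (insert e R) + 2000 * card U + 1100 * K + 1900)"
      moreover have "360 + t2 \<le> x \<Longrightarrow> t1 + t2 \<le> x" "360 + t2 + y \<le> x \<Longrightarrow> t1 + t2 + y \<le> x" for x y
        using 1(1) by simp_all
      ultimately show "?Post (t1 + t2) s2" by meson
    qed
  qed
qed

end

section \<open>The potential\<close>

definition bad :: "(nat \<times> nat) set \<Rightarrow> (nat \<Rightarrow> nat) \<Rightarrow> (nat \<times> nat) set" where
  "bad Ar lev = {(u, v). (u, v) \<in> Ar \<and> lev v \<le> lev u}"

text \<open>The weights pay, in units of \<open>2000\<close> steps, for one round per pending edge and balance as follows: with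
  \<open>g\<close> vertices lowered, a promotion costs at most \<open>2 (\<Delta> + 1) + 6\<alpha>g + \<alpha>K\<close> and changes the other summands
  by \<open>8D - 4 (\<Delta> + 1) + 8\<alpha>g\<close> and \<open>16\<alpha>K - 16\<alpha>g\<close>.\<close>

definition pot :: "nat \<Rightarrow> nat \<Rightarrow> nat set set \<Rightarrow> (nat \<times> nat) set \<Rightarrow> (nat \<Rightarrow> nat) \<Rightarrow> nat set set \<Rightarrow> nat" where
  "pot n \<alpha> E Ar lev R =
    8000 * card (bad Ar lev) + 2000 * card (E - R) + 32000 * (\<alpha> * (\<Sum>v<n. lev v - 1))"

text \<open>Having \<open>card U\<close> in place of \<open>card U - 1\<close> loses little and
  makes the bound valid also for sets with fewer than two vertices, which induce no edge.\<close>

lemma arboricity_bound: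
  assumes a: "arboricity n E \<le> \<alpha>" and E: "edges_ok n E" and U: "U \<subseteq> {..<n}"
  shows "card (induced E U) \<le> \<alpha> * card U"
proof (cases "2 \<le> card U")
  case True
  let ?f = "\<lambda>U. nat \<lceil>real (card (induced E U)) / (real (card U) - 1)\<rceil>"
  have fin: "finite {U. U \<subseteq> {..<n} \<and> 2 \<le> card U}" by (rule finite_subset[of _ "Pow {..<n}"]) auto
  have "?f U \<le> arboricity n E" unfolding arboricity_def
    by (rule Max_ge[OF finite_imageI[OF fin] imageI]) (use U True in simp)
  then have "?f U \<le> \<alpha>" using a by (rule le_trans)
  then have "real (card (induced E U)) / (real (card U) - 1) \<le> real \<alpha>"
    unfolding nat_le_iff ceiling_le_iff by simp
  moreover have "0 < real (card U) - 1" using True by linarith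
  ultimately have "real (card (induced E U)) \<le> real \<alpha> * (real (card U) - 1)"
    by (simp only: pos_divide_le_eq)
  also have "\<dots> \<le> real \<alpha> * real (card U)" by (intro mult_left_mono) auto
  also have "\<dots> = real (\<alpha> * card U)" by (rule of_nat_mult[symmetric])
  finally show ?thesis unfolding of_nat_le_iff .
next
  case False
  have "induced E U = {}"
  proof (rule ccontr)
    assume "induced E U \<noteq> {}"
    then obtain e where e: "e \<in> E" "e \<subseteq> U" by (auto simp: induced_def)
    then obtain x y where xy: "e = {x, y}" "x \<noteq> y" using E unfolding edges_ok_def by blast
    have "card {x, y} \<le> card U" using e xy U by (intro card_mono finite_subset[OF U]) auto
    then show False using False xy by simp
  qed
  then show ?thesis by simp
qed

lemma orientationD:
  assumes "is_orientation Ar E"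
  shows "(x, y) \<in> Ar \<Longrightarrow> {x, y} \<in> E"
    and "{x, y} \<in> E \<Longrightarrow> (x, y) \<in> Ar \<or> (y, x) \<in> Ar"
    and "(x, y) \<in> Ar \<Longrightarrow> (y, x) \<notin> Ar"
  using assms unfolding is_orientation_def by blast+

lemma arcs_finite:
  assumes "edges_ok n E" "is_orientation Ar E"
  shows "Ar \<subseteq> {..<n} \<times> {..<n}" "finite Ar"
proof -
  show "Ar \<subseteq> {..<n} \<times> {..<n}" using edges_okD[OF assms(1) orientationD(1)[OF assms(2)]] by auto
  then show "finite Ar" by (rule finite_subset) simp
qed

lemma orientation_inj:
  assumes "is_orientation Ar E"
  shows "inj_on (\<lambda>(x, y). {x, y}) Ar"
  unfolding inj_on_def using orientationD(3)[OF assms] by (auto simp: doubleton_eq_iff)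

lemma arcs_card_le:
  assumes E: "edges_ok n E" and o: "is_orientation Ar E"
  shows "card {(x, y). (x, y) \<in> Ar \<and> x \<in> U \<and> y \<in> U} \<le> card (induced E U)"
proof (rule card_inj_on_le)
  show "inj_on (\<lambda>(x, y). {x, y}) {(x, y). (x, y) \<in> Ar \<and> x \<in> U \<and> y \<in> U}"
    by (rule inj_on_subset[OF orientation_inj[OF o]]) auto
  show "(\<lambda>(x, y). {x, y}) ` {(x, y). (x, y) \<in> Ar \<and> x \<in> U \<and> y \<in> U} \<subseteq> induced E U"
    using orientationD(1)[OF o] unfolding induced_def by auto
  show "finite (induced E U)" using edges_ok_finite_card(1)[OF E] by (simp add: induced_def)
qed

text \<open>With the layers fixed, an arc that is bad after the update was bad before, or is the
  reversal of an old arc, or belongs to the updated edge. The inclusion \<open>sub\<close> treats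
  insertions and deletions alike.\<close>

lemma bad_change:
  assumes E: "edges_ok n E" "edges_ok n E'" and o: "is_orientation Ar E" "is_orientation Ar' E'"
    and sub: "E' \<subseteq> insert e E"
  shows "card (bad Ar' lev) \<le> card (bad Ar lev) + flips Ar Ar' + 1"
proof -
  have fin: "finite Ar" "finite Ar'" using arcs_finite E o by blast+
  let ?F = "{(x, y). (x, y) \<in> Ar' \<and> (y, x) \<in> Ar}" and ?N = "{(x, y). (x, y) \<in> Ar' \<and> {x, y} = e}"
  have F: "?F = prod.swap ` {(u, v). (u, v) \<in> Ar \<and> (v, u) \<in> Ar'}" by force
  have fF: "finite {(u, v). (u, v) \<in> Ar \<and> (v, u) \<in> Ar'}" by (rule finite_subset[OF _ fin(1)]) auto
  have cF: "card ?F \<le> flips Ar Ar'" unfolding F flips_def by (rule card_image_le[OF fF])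
  have cN: "card ?N \<le> 1"
  proof -
    have "inj_on (\<lambda>(x, y). {x, y}) ?N"
      by (rule inj_on_subset[OF orientation_inj[OF o(2)]]) auto
    then have "card ?N \<le> card {e}" by (rule card_inj_on_le) auto
    then show ?thesis by simp
  qed
  have "bad Ar' lev \<subseteq> bad Ar lev \<union> ?F \<union> ?N"
  proof
    fix p assume p: "p \<in> bad Ar' lev"
    obtain x y where xy: "p = (x, y)" by (cases p)
    have A: "(x, y) \<in> Ar'" "lev y \<le> lev x" using p xy by (auto simp: bad_def)
    show "p \<in> bad Ar lev \<union> ?F \<union> ?N"
    proof (cases "{x, y} = e \<or> (y, x) \<in> Ar")
      case True
      then show ?thesis using A xy by blast
    next
      case False
      have "{x, y} \<in> E'" by (rule orientationD(1)[OF o(2) A(1)])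
      then have "{x, y} \<in> E" using sub False by blast
      then have "(x, y) \<in> Ar" using orientationD(2)[OF o(1)] False by blast
      then show ?thesis using A xy by (auto simp: bad_def)
    qed
  qed
  moreover have "finite (bad Ar lev)" by (rule finite_subset[OF _ fin(1)]) (auto simp: bad_def)
  moreover have "finite ?F" "finite ?N" by (rule finite_subset[OF _ fin(2)], auto)+
  ultimately have "card (bad Ar' lev) \<le> card (bad Ar lev \<union> ?F \<union> ?N)" by (intro card_mono) auto
  also have "\<dots> \<le> card (bad Ar lev) + card ?F + card ?N"
    by (meson add_le_mono card_Un_le le_trans order_refl)
  finally show ?thesis using cF cN by linarith
qed

text \<open>In the balance given with the weights, the terms in \<alpha>g add up to -2\<alpha>g.
  What remains is 8D + 17\<alpha>K - 2(\<Delta> + 1), which is negative for \<Delta> = 4D +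
  9\<alpha>K; this is the origin of the two coefficients. The assumption
  \<open>1 \<le> \<alpha>\<close> absorbs the time proportional to \<open>card U\<close> and
  \<open>K\<close>, and the surplus of 50 pays for the test of the loop.\<close>

lemma promoted_pot:
  assumes E: "edges_ok n E" and o: "is_orientation Ar E" and D: "\<And>v. v < n \<Longrightarrow> out_degree Ar v \<le> D"
    and arb: "\<And>U. U \<subseteq> {..<n} \<Longrightarrow> card (induced E U) \<le> \<alpha> * card U" and \<alpha>: "1 \<le> \<alpha>"
    and \<Delta>: "\<Delta> = 4 * D + 9 * (\<alpha> * K)"
    and R0: "R0 \<subseteq> E" and e: "e \<in> E - R0" and lev: "\<And>v. v < n \<Longrightarrow> 1 \<le> lev v \<and> lev v < K" and v: "v < n"
    and deg: "card {u. {v, u} \<in> insert e R0 \<and> lev v \<le> lev u} = \<Delta> + 1"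
    and pr: "promoted n K lev (insert e R0) v lev' R' U i"
    and t: "t + 1000 * card R' \<le> 1000 * card (insert e R0) + 2000 * card U + 1100 * K + 1900"
  shows "t + 50 + pot n \<alpha> E Ar lev' R' \<le> pot n \<alpha> E Ar lev R0"
proof -
  let ?R = "insert e R0" and ?lv = "lev(v := K)"
  define N where "N = {u. {v, u} \<in> ?R \<and> lev v \<le> lev u}"
  have i: "1 \<le> i" "i < K" and U: "U = {u. u < n \<and> i \<le> ?lv u}"
    and cU: "card U < 2 * card {u. u < n \<and> i < ?lv u}"
    and lev'_eq: "lev' = (\<lambda>u. if u \<in> U then i else ?lv u)"
    and R': "R' \<subseteq> ?R - up_edges lev v" "\<forall>e \<in> ?R - up_edges lev v - R'. e \<subseteq> U"
    using pr unfolding promoted_def by blast+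
  have lev': "lev' u = (if u \<in> U then i else ?lv u)" for u unfolding lev'_eq by simp
  have vU: "v \<in> U" using i v U by simp
  have out: "lev' u = lev u" "lev u < i" if "u < n" "u \<notin> U" for u
  proof -
    have "u \<noteq> v" using that vU by blast
    then show "lev' u = lev u" using that(2) lev' by simp
    show "lev u < i" using that U \<open>u \<noteq> v\<close> by simp
  qed
  have Un: "U \<subseteq> {..<n}" using U by auto
  define g where "g = card {u. u < n \<and> i < ?lv u}"
  define ind where "ind = card (induced E U)"
  have RE: "?R \<subseteq> E" using R0 e by auto
  have okR: "edges_ok n ?R" by (rule edges_ok_subset[OF E RE])
  have finE: "finite E" using edges_ok_finite_card(1)[OF E] .
  have finR: "finite ?R" by (rule finite_subset[OF RE finE])
  have Nn: "N \<subseteq> {..<n}"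
  proof
    fix u assume "u \<in> N"
    then have "{v, u} \<in> ?R" unfolding N_def by (rule CollectE) (rule conjunct1)
    from edges_okD[OF okR this] show "u \<in> {..<n}" by simp
  qed
  have finN: "finite N" by (rule finite_subset[OF Nn]) simp
  have cN: "card N = \<Delta> + 1" using deg by (simp add: N_def)
  note Arn = arcs_finite(1)[OF E o]
  have finA: "finite Ar" by (rule arcs_finite(2)[OF E o])
  have ind: "ind \<le> \<alpha> * card U" unfolding ind_def by (rule arb[OF Un])

  \<comment> \<open>Of the \<Delta> + 1 edges detached at \<open>v\<close>, at most \<open>D\<close>
    leave \<open>v\<close>; the others enter it and were bad, and they form \<open>?Y\<close>. An
    arc that is bad afterwards lies inside \<open>U\<close>, or leaves \<open>v\<close>, or was bad
    and is outside \<open>?Y\<close>. One \<open>D\<close> is due to the arcs leaving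
    \<open>v\<close> that are missing in \<open>?Y\<close>, the other to those that may become
    bad.\<close>
  have b: "card (bad Ar lev') + (\<Delta> + 1) \<le> card (bad Ar lev) + 2 * D + ind"
  proof -
    let ?W = "{(x, y). (x, y) \<in> Ar \<and> x \<in> U \<and> y \<in> U}"
    let ?O = "{v} \<times> {w. (v, w) \<in> Ar}" and ?Y = "{u \<in> N. (u, v) \<in> Ar} \<times> {v}"
    have W: "card ?W \<le> ind" unfolding ind_def by (rule arcs_card_le[OF E o])
    have fo: "finite {w. (v, w) \<in> Ar}" by (rule finite_subset[of _ "{..<n}"]) (use Arn in auto)
    have O: "card {w. (v, w) \<in> Ar} \<le> D" using D[OF v] by (simp add: out_degree_def)
    have NY: "N \<subseteq> {u \<in> N. (u, v) \<in> Ar} \<union> {w. (v, w) \<in> Ar}"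
    proof
      fix u assume u: "u \<in> N"
      then have "{u, v} \<in> E" using RE by (auto simp: N_def insert_commute)
      then have "(u, v) \<in> Ar \<or> (v, u) \<in> Ar" by (rule orientationD(2)[OF o])
      then show "u \<in> {u \<in> N. (u, v) \<in> Ar} \<union> {w. (v, w) \<in> Ar}" using u by blast
    qed
    have "card N \<le> card ({u \<in> N. (u, v) \<in> Ar} \<union> {w. (v, w) \<in> Ar})"
      by (rule card_mono[OF _ NY]) (use finN fo in auto)
    also have "\<dots> \<le> card {u \<in> N. (u, v) \<in> Ar} + card {w. (v, w) \<in> Ar}" by (rule card_Un_le)
    finally have Y: "\<Delta> + 1 \<le> card ?Y + D" using O cN by (simp add: card_cartesian_product)
    have Yb: "?Y \<subseteq> bad Ar lev" by (auto simp: bad_def N_def)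
    have fb: "finite (bad Ar lev)" by (rule finite_subset[OF _ finA]) (auto simp: bad_def)
    have "bad Ar lev' \<subseteq> ?W \<union> ?O \<union> (bad Ar lev - ?Y)"
    proof (rule subsetI, rule ccontr)
      fix p assume p: "p \<in> bad Ar lev'" and np: "p \<notin> ?W \<union> ?O \<union> (bad Ar lev - ?Y)"
      obtain x y where xy: "p = (x, y)" by (cases p)
      have A: "(x, y) \<in> Ar" "lev' y \<le> lev' x" using p xy by (auto simp: bad_def)
      have nY: "(x, y) \<notin> bad Ar lev - ?Y" and nO: "(x, y) \<notin> ?O" and nW: "(x, y) \<notin> ?W"
        using np unfolding xy by blast+
      have n: "x < n" "y < n" using A(1) Arn by auto
      have xv: "x \<noteq> v" using nO A(1) by auto
      have yU: "y \<notin> U"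
      proof
        assume "y \<in> U"
        then have "x \<notin> U" "lev' y = i" using nW A(1) lev' by auto
        then show False using A(2) out[OF n(1)] by simp
      qed
      then have yv: "y \<noteq> v" using vU by blast
      have "lev y \<le> lev x"
      proof (cases "x \<in> U")
        case True
        then have "i \<le> lev x" using U xv by simp
        then show ?thesis using out(2)[OF n(2) yU] by simp
      next
        case False
        then show ?thesis using out(1)[OF n(2) yU] out(1)[OF n(1)] A(2) by simp
      qed
      then have "(x, y) \<in> bad Ar lev - ?Y" using A(1) yv by (auto simp: bad_def)
      then show False using nY by blast
    qed
    then have "card (bad Ar lev') \<le> card (?W \<union> ?O \<union> (bad Ar lev - ?Y))"
      by (rule card_mono[rotated]) (use fb fo finite_subset[OF _ finA, of ?W] in auto)
    also have "\<dots> \<le> card ?W + card ?O + card (bad Ar lev - ?Y)"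
      by (meson add_le_mono card_Un_le le_trans order_refl)
    finally have "card (bad Ar lev') \<le> ind + D + card (bad Ar lev - ?Y)"
      using W O by (simp add: card_cartesian_product)
    moreover have "card (bad Ar lev - ?Y) + card ?Y = card (bad Ar lev)"
      using card_Diff_subset[OF finite_subset[OF Yb fb] Yb] card_mono[OF fb Yb] by simp
    ultimately show ?thesis using Y by linarith
  qed

  \<comment> \<open>The edges that leave the record are the \<Delta> + 1 edges detached at
    \<open>v\<close> and edges inside \<open>U\<close>.\<close>
  have r: "card ?R \<le> card R' + (\<Delta> + 1) + ind"
  proof -
    have "?R \<subseteq> R' \<union> (\<lambda>u. {v, u}) ` N \<union> induced E U"
    proof
      fix e' assume e': "e' \<in> ?R"
      show "e' \<in> R' \<union> (\<lambda>u. {v, u}) ` N \<union> induced E U"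
      proof (cases "e' \<in> up_edges lev v")
        case True
        then show ?thesis using e' by (auto simp: up_edges_def N_def)
      next
        case False
        then show ?thesis using e' R'(2) RE by (auto simp: induced_def)
      qed
    qed
    then have "card ?R \<le> card (R' \<union> (\<lambda>u. {v, u}) ` N \<union> induced E U)"
      by (rule card_mono[rotated]) (use finN finE finite_subset[OF R'(1)] finR in \<open>auto simp: induced_def\<close>)
    also have "\<dots> \<le> card R' + card ((\<lambda>u. {v, u}) ` N) + ind" unfolding ind_def
      by (meson add_le_mono card_Un_le le_trans order_refl)
    finally show ?thesis using card_image_le[OF finN, of "\<lambda>u. {v, u}"] cN by linarith
  qed
  have R'E: "R' \<subseteq> E" using R'(1) RE by blast
  have p: "card (E - R') + card R' = card E" "card (E - R0) + card R0 = card E" "card ?R = Suc (card R0)"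
    using card_Diff_subset[of R' E] card_Diff_subset[of R0 E] card_mono[OF finE R'E] card_mono[OF finE R0]
      finite_subset[OF R'E finE] finite_subset[OF R0 finE] R'E R0 e by auto

  \<comment> \<open>Raising \<open>v\<close> to layer \<open>K\<close> adds at most \<open>K\<close>
    to the sum, and the collapse then lowers each of the \<open>g\<close> vertices above layer
    \<open>i\<close> by at least one.\<close>
  have s: "(\<Sum>u<n. lev' u - 1) + g \<le> (\<Sum>u<n. lev u - 1) + K"
  proof -
    have 1: "(\<Sum>u<n. ?lv u - 1) \<le> (\<Sum>u<n. lev u - 1) + K"
    proof -
      have "(\<Sum>u<n. ?lv u - 1) \<le> (\<Sum>u<n. (lev u - 1) + (if u = v then K else 0))"
        by (rule sum_mono) auto
      also have "\<dots> = (\<Sum>u<n. lev u - 1) + K" using v by (simp add: sum.distrib)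
      finally show ?thesis .
    qed
    have "g = (\<Sum>u<n. if i < ?lv u then 1 else 0)" unfolding g_def
      by (subst sum.inter_filter[symmetric]) (auto intro!: arg_cong[of _ _ card])
    then have "(\<Sum>u<n. lev' u - 1) + g = (\<Sum>u<n. (lev' u - 1) + (if i < ?lv u then 1 else 0))"
      by (simp only: sum.distrib)
    also have "\<dots> \<le> (\<Sum>u<n. ?lv u - 1)"
    proof (rule sum_mono)
      fix u assume "u \<in> {..<n}"
      then have "u < n" by simp
      show "(lev' u - 1) + (if i < ?lv u then 1 else 0) \<le> ?lv u - 1"
      proof (cases "u \<in> U")
        case True
        then have "i \<le> ?lv u" "lev' u = i" using U lev' by auto
        then show ?thesis using i(1) by auto
      next
        case False
        then have "\<not> i < ?lv u" "lev' u = ?lv u" using U lev' \<open>u < n\<close> by auto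
        then show ?thesis by simp
      qed
    qed
    finally show ?thesis using 1 by linarith
  qed
  define S S' where "S = (\<Sum>u<n. lev u - 1)" and "S' = (\<Sum>u<n. lev' u - 1)"
  have "\<alpha> * (S' + g) \<le> \<alpha> * (S + K)" using s unfolding S_def S'_def by (rule mult_le_mono2)
  then have s': "\<alpha> * S' + \<alpha> * g \<le> \<alpha> * S + \<alpha> * K" by (simp add: add_mult_distrib2)
  have "\<alpha> * card U \<le> \<alpha> * (2 * g)" using cU unfolding g_def by (intro mult_le_mono2) simp
  with ind have "ind \<le> \<alpha> * (2 * g)" by (rule le_trans)
  also have "\<dots> = 2 * (\<alpha> * g)" by (rule mult.left_commute)
  finally have ind': "ind \<le> 2 * (\<alpha> * g)" .
  have gk: "1 * g \<le> \<alpha> * g" "1 * K \<le> \<alpha> * K" by (rule mult_le_mono1[OF \<alpha>])+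
  show ?thesis unfolding pot_def S_def[symmetric] S'_def[symmetric]
    using b r p s' ind' gk t cU[folded g_def] \<Delta> by linarith
qed

section \<open>One update\<close>

text \<open>Between updates every edge is recorded. So after an insertion the new edge is the only
  pending one, and after a deletion there is none and the loop ends at once.\<close>

definition step_com :: com where
  "step_com =
    Cond (Equal (Reg 0) (Lit 1)) (push_com 1 2)
      (Assign 9 (Reg 1) ;; Assign 10 (Reg 2) ;; unrecord_com) ;;
    While (Less (Lit 0) (Reg 6)) body_com"

text \<open>Register 7 holds 2 ^ (K - 1) for the current value K of register 4. Zero memory already
  represents empty lists, so only the \<open>n\<close> vertices have to be entered into layer 1;
  clearing the quadratic space would not take linear time.\<close>

definition init_com :: com where
  "init_com =
    Assign 3 (Add (Reg 0) (Lit 2)) ;;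
    Assign 7 (Lit 1) ;;
    Assign 4 (Lit 1) ;;
    While (Neg (Less (Reg 0) (Reg 7)))
      (Assign 7 (Add (Reg 7) (Reg 7)) ;; Assign 4 (Add (Reg 4) (Lit 1))) ;;
    Assign 5 (Add (Mul (Lit 4) (Reg 2)) (Mul (Lit 9) (Mul (Reg 1) (Reg 4)))) ;;
    Assign 10 (Lit 1) ;;
    Assign 9 (Lit 0) ;;
    While (Less (Reg 9) (Reg 0))
      (ins_com 6 10 9 ;; Store (AddrE 9 (Reg 9) (Lit 0)) (Lit 1) ;; Assign 9 (Add (Reg 9) (Lit 1)))"

text \<open>When nothing is pending, the lists of family 0 are the adjacency lists of the subgraphs
  induced by the layers, so they can be handed out as they are.\<close>

definition lds_alg :: algorithm where
  "lds_alg = \<lparr>init = init_com, step = step_com,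
    layer_of = CellE 9 (Reg 0) (Lit 0), layer_size = sizeE 6 (Reg 0), layer_elem = CellE 7 (Reg 0) (Reg 1),
    degree = sizeE 0 (Reg 0), neighbor = CellE 1 (Reg 0) (Reg 1)\<rparr>"

text \<open>What the analysis uses about graph and orientation at one moment; the arboricity enters
  through its bound on induced edges.\<close>

definition fits :: "nat \<Rightarrow> nat \<Rightarrow> nat \<Rightarrow> nat set set \<Rightarrow> (nat \<times> nat) set \<Rightarrow> bool" where
  "fits n \<alpha> D E Ar \<longleftrightarrow> edges_ok n E \<and> is_orientation Ar E \<and> (\<forall>v<n. out_degree Ar v \<le> D) \<and>
    (\<forall>U \<subseteq> {..<n}. card (induced E U) \<le> \<alpha> * card U)"

context ram begin

text \<open>A round that merely records an edge gains the weight of one pending edge, and a round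
  with a promotion gains by \<open>promoted_pot\<close>. So every round lowers the potential by at
  least its own running time, which makes the potential the measure of the loop.\<close>

lemma loop_wp:
  assumes stores: "stores E lev R s" and good: "good lev R" and fits: "fits n \<alpha> D E Ar"
    and \<alpha>: "1 \<le> \<alpha>" and \<Delta>: "\<Delta> = 4 * D + 9 * (\<alpha> * K)"
  shows "wp w (While (Less (Lit 0) (Reg 6)) body_com) s (\<lambda>t s'. \<exists>lev'. stores E lev' E s' \<and> good lev' E \<and>
    t + pot n \<alpha> E Ar lev' E \<le> pot n \<alpha> E Ar lev R + 10)"
proof -
  define Inv where "Inv s' m \<longleftrightarrow> (\<exists>lev R. stores E lev R s' \<and> good lev R \<and> m = pot n \<alpha> E Ar lev R)" for s' m
  have E: "edges_ok n E" and o: "is_orientation Ar E" and D: "\<And>v. v < n \<Longrightarrow> out_degree Ar v \<le> D"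
    and arb: "\<And>U. U \<subseteq> {..<n} \<Longrightarrow> card (induced E U) \<le> \<alpha> * card U"
    using fits unfolding fits_def by blast+
  have 0: "Inv s (pot n \<alpha> E Ar lev R)" unfolding Inv_def using stores good by blast
  have "wp w (While (Less (Lit 0) (Reg 6)) body_com) s (\<lambda>t s'. \<exists>m'. Inv s' m' \<and>
    \<not> holds w s' (Less (Lit 0) (Reg 6)) \<and> t + m' \<le> pot n \<alpha> E Ar lev R + 1 + test_cost (Less (Lit 0) (Reg 6)))"
  proof (rule wp_While[where Inv = Inv, OF 0])
    fix s1 m assume "Inv s1 m" and h: "holds w s1 (Less (Lit 0) (Reg 6))"
    then obtain lv R1 where I1: "stores E lv R1 s1" and g1: "good lv R1" and m: "m = pot n \<alpha> E Ar lv R1"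
      unfolding Inv_def by blast
    have ne: "fst s1 6 > 0" using h by (simp add: small_lit)
    have R1: "R1 \<subseteq> E" "finite E" using stores_E[OF I1] by metis+
    have lev: "1 \<le> lv v \<and> lv v < K" if "v < n" for v using g1 that unfolding good_def by blast
    show "wp w body_com s1 (\<lambda>t s'. \<exists>m'. Inv s' m' \<and> 1 + test_cost (Less (Lit 0) (Reg 6)) + t + m' \<le> m)"
    proof (rule wp_mono[OF body_wp[OF I1 g1 ne]], elim bexE disjE conjE exE)
      fix t :: nat and s2 :: state and e
      assume e: "e \<in> E - R1" and *: "good lv (insert e R1)" "stores E lv (insert e R1) s2" "t \<le> 900"
      have "E - R1 - {e} = E - insert e R1" by blast
      then have "card (E - R1) = Suc (card (E - insert e R1))"
        using card_Suc_Diff1[of "E - R1" e] e R1(2) by simp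
      then have "1 + test_cost (Less (Lit 0) (Reg 6)) + t + pot n \<alpha> E Ar lv (insert e R1) \<le> m"
        using *(3) unfolding m pot_def by simp
      then show "\<exists>m'. Inv s2 m' \<and> 1 + test_cost (Less (Lit 0) (Reg 6)) + t + m' \<le> m"
        unfolding Inv_def using * by blast
    next
      fix t :: nat and s2 :: state and e v lev' R' U i
      assume e: "e \<in> E - R1" and v: "v < n"
        and deg: "card {u. {v, u} \<in> insert e R1 \<and> lv v \<le> lv u} = \<Delta> + 1"
        and *: "good lev' R'" "stores E lev' R' s2" and pr: "promoted n K lv (insert e R1) v lev' R' U i"
        and t: "t + 1000 * card R' \<le> 1000 * card (insert e R1) + 2000 * card U + 1100 * K + 1900"
      have "t + 50 + pot n \<alpha> E Ar lev' R' \<le> m" unfolding m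
        by (rule promoted_pot[OF E o D arb \<alpha> \<Delta> R1(1) e lev v deg pr t])
      then have "1 + test_cost (Less (Lit 0) (Reg 6)) + t + pot n \<alpha> E Ar lev' R' \<le> m" by simp
      then show "\<exists>m'. Inv s2 m' \<and> 1 + test_cost (Less (Lit 0) (Reg 6)) + t + m' \<le> m"
        unfolding Inv_def using * by blast
    qed
  qed
  then show ?thesis
  proof (rule wp_mono, elim exE conjE)
    fix t s1 m assume "Inv s1 m" and h: "\<not> holds w s1 (Less (Lit 0) (Reg 6))"
      and t: "t + m \<le> pot n \<alpha> E Ar lev R + 1 + test_cost (Less (Lit 0) (Reg 6))"
    then obtain lv R1 where I1: "stores E lv R1 s1" and g1: "good lv R1" and m: "m = pot n \<alpha> E Ar lv R1"
      unfolding Inv_def by blast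
    have "fst s1 6 = 0" using h by (simp add: small_lit)
    then have "card (E - R1) = 0" "R1 \<subseteq> E" "finite E" using stores_E[OF I1] rep_D(4) by metis+
    then have "R1 = E" by auto
    then show "\<exists>lev'. stores E lev' E s1 \<and> good lev' E \<and> t + pot n \<alpha> E Ar lev' E \<le> pot n \<alpha> E Ar lev R + 10"
      using I1 g1 m t by auto
  qed
qed

text \<open>The arguments of an update or a query occupy registers 0 to 2 and leave the permanent
  registers 3 to 6 alone.\<close>

lemma stores_with_args: "length xs \<le> 3 \<Longrightarrow> stores E lev R s \<Longrightarrow> stores E lev R (with_args xs s)"
  by (rule stores_cong[of _ s]) (auto simp: with_args_def)

lemma stores_full:
  assumes "stores E lev E s"
  shows "rep s (lists_of n lev E) lev []" "edges_ok n E"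
  using stores_E[OF assms] by (metis Diff_cancel card.empty length_0_conv, metis)

lemma good_mono:
  assumes "good lev R" "R' \<subseteq> R" "edges_ok n R"
  shows "good lev R'"
  unfolding good_def
proof (intro conjI allI impI)
  fix v assume v: "v < n"
  have "card {u. {v, u} \<in> R' \<and> lev v \<le> lev u} \<le> card {u. {v, u} \<in> R \<and> lev v \<le> lev u}"
    using assms(2) by (intro card_mono up_finite[OF assms(3)]) auto
  also have "\<dots> \<le> \<Delta>" using assms(1) v unfolding good_def by blast
  finally show "card {u. {v, u} \<in> R' \<and> lev v \<le> lev u} \<le> \<Delta>" .
qed (use assms(1) in \<open>auto simp: good_def\<close>)

text \<open>Apart from the flips, an update creates at most one bad arc, worth 8000, and at most one
  pending edge, worth 2000. The rest of the 11000 covers changing the lists or the stack and the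
  last test of the loop.\<close>

lemma step_wp:
  assumes stores: "stores E lev E s" and good: "good lev E" and u: "legal_update n E u"
    and fits: "fits n \<alpha> D E Ar" and fits': "fits n \<alpha> D (apply_update E u) Ar'"
    and \<alpha>: "1 \<le> \<alpha>" and \<Delta>: "\<Delta> = 4 * D + 9 * (\<alpha> * K)"
  shows "wp w step_com (with_args (update_args u) s)
    (\<lambda>t s'. \<exists>lev'. stores (apply_update E u) lev' (apply_update E u) s' \<and> good lev' (apply_update E u) \<and>
      t + pot n \<alpha> (apply_update E u) Ar' lev' (apply_update E u)
        \<le> pot n \<alpha> E Ar lev E + 8000 * flips Ar Ar' + 11000)"
proof -
  let ?E' = "apply_update E u" and ?s = "with_args (update_args u) s"
  note rep = stores_full(1)[OF stores] and ok = stores_full(2)[OF stores]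
  have ok': "edges_ok n ?E'" using fits' unfolding fits_def by blast
  have len: "length (update_args u) \<le> 3" by (cases u) auto
  have stores': "stores E lev E ?s" by (rule stores_with_args[OF len stores])
  note rep' = stores_full(1)[OF stores']
  \<comment> \<open>For a legal update the edge set fails to shrink exactly for an insertion, so the
    first argument can be expressed without a case distinction.\<close>
  obtain x y where xy: "update_args u = [if ?E' \<subseteq> E then 0 else 1, x, y]" "x < n" "y < n"
    and cases: "(u = Insert x y \<and> {x, y} \<notin> E \<and> ?E' = insert {x, y} E) \<or> (u = Delete x y \<and> ?E' = E - {{x, y}})"
    using u by (cases u) (auto dest: edges_okD[OF ok])
  have r: "fst ?s 0 = (if ?E' \<subseteq> E then 0 else 1)" "fst ?s 1 = x" "fst ?s 2 = y"
    using xy(1) by (auto simp: with_args_def)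
  let ?c = "Cond (Equal (Reg 0) (Lit 1)) (push_com 1 2) (Assign 9 (Reg 1) ;; Assign 10 (Reg 2) ;; unrecord_com)"
  have first: "wp w ?c ?s (\<lambda>t s'. t \<le> 700 \<and> stores ?E' lev (E \<inter> ?E') s')"
    using cases
  proof (elim disjE conjE)
    assume e: "{x, y} \<notin> E" "?E' = insert {x, y} E"
    then have h: "holds w ?s (Equal (Reg 0) (Lit 1))" using r small_lit[of 1] by auto
    have "length [] < n * n" using n2 by simp
    from push_wp[OF rep' this, of 1 2] have p: "wp w (push_com 1 2) ?s (\<lambda>t s'. t \<le> 60 \<and>
        (\<forall>r. r \<noteq> 6 \<longrightarrow> fst s' r = fst ?s r) \<and> rep s' (lists_of n lev E) lev [(x, y)])"
      unfolding r append_Nil by (auto elim: wp_mono)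
    have E: "E \<inter> ?E' = E" "?E' - E = {{x, y}}" unfolding e(2) using e(1) by blast+
    show ?thesis unfolding wp_Cond if_P[OF h] E
    proof (rule wp_mono[OF p], elim conjE)
      fix t s' assume "t \<le> (60::nat)" "rep s' (lists_of n lev E) lev [(x, y)]"
      then show "1 + test_cost (Equal (Reg 0) (Lit 1)) + t \<le> 700 \<and> stores ?E' lev E s'"
        unfolding stores_def E(2) using ok' e(2) by (auto intro!: exI[of _ "[(x, y)]"])
    qed
  next
    assume e: "?E' = E - {{x, y}}"
    then have sub: "?E' \<subseteq> E" by blast
    then have h: "\<not> holds w ?s (Equal (Reg 0) (Lit 1))" using r small_lit[of 1] by auto
    let ?s2 = "((fst ?s)(9 := x, 10 := y), snd ?s)"
    have J2: "rep ?s2 (lists_of n lev E) lev []"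
      using rep' rep_reg[of 9 ?s x] rep_reg[of 10 "((fst ?s)(9 := x), snd ?s)" y] by simp
    have E: "E \<inter> ?E' = ?E'" using sub by blast
    have v: "val w ?s (Reg 1) = x" "val w ((fst ?s)(9 := x), snd ?s) (Reg 2) = y" using r by auto
    show ?thesis unfolding wp_Cond if_not_P[OF h] E wp_Seq wp_Assign v fst_conv snd_conv
    proof (rule wp_mono[OF unrecord_wp[OF J2 _ xy(2) _ xy(3)]], goal_cases)
      case (3 t s')
      then have "rep s' (lists_of n lev ?E') lev []" using e by simp
      then have "stores ?E' lev ?E' s'" unfolding stores_def using ok' by auto
      then show ?case using 3 by simp
    qed auto
  qed
  have g: "good lev (E \<inter> ?E')" by (rule good_mono[OF good _ ok]) blast
  have pot: "pot n \<alpha> ?E' Ar' lev (E \<inter> ?E') \<le> pot n \<alpha> E Ar lev E + 8000 * flips Ar Ar' + 10000"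
  proof -
    have "card (bad Ar' lev) \<le> card (bad Ar lev) + flips Ar Ar' + 1"
      by (rule bad_change[of n E ?E' _ _ "{x, y}"]) (use fits fits' cases in \<open>auto simp: fits_def\<close>)
    moreover have "card (?E' - E \<inter> ?E') \<le> card {{x, y}}"
      by (rule card_mono) (use cases in auto)
    ultimately show ?thesis unfolding pot_def by simp
  qed
  show ?thesis unfolding step_com_def wp_Seq[of w ?c]
  proof (rule wp_mono[OF first], elim conjE)
    fix t1 s1 assume t1: "t1 \<le> (700::nat)" and I1: "stores ?E' lev (E \<inter> ?E') s1"
    show "wp w (While (Less (Lit 0) (Reg 6)) body_com) s1 (\<lambda>t s'. \<exists>lev'. stores ?E' lev' ?E' s' \<and>
      good lev' ?E' \<and> t1 + t + pot n \<alpha> ?E' Ar' lev' ?E' \<le> pot n \<alpha> E Ar lev E + 8000 * flips Ar Ar' + 11000)"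
    proof (rule wp_mono[OF loop_wp[OF I1 g fits' \<alpha> \<Delta>]], elim exE conjE)
      fix t s' lev'
      assume *: "stores ?E' lev' ?E' s'" "good lev' ?E'"
        and t: "t + pot n \<alpha> ?E' Ar' lev' ?E' \<le> pot n \<alpha> ?E' Ar' lev (E \<inter> ?E') + 10"
      have "t1 + t + pot n \<alpha> ?E' Ar' lev' ?E' \<le> pot n \<alpha> E Ar lev E + 8000 * flips Ar Ar' + 11000"
        using t t1 pot by linarith
      with * show "\<exists>lev'. stores ?E' lev' ?E' s' \<and> good lev' ?E' \<and>
        t1 + t + pot n \<alpha> ?E' Ar' lev' ?E' \<le> pot n \<alpha> E Ar lev E + 8000 * flips Ar Ar' + 11000" by blast
    qed
  qed
qed

end

section \<open>Initialisation and the amortised bound\<close>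

lemma slist_bij:
  assumes "slist n c el ps A"
  shows "bij_betw el {..<c} A"
  unfolding bij_betw_def
proof
  have e: "el j \<in> A" "ps (el j) = Suc j" if "j < c" for j using assms that unfolding slist_def by auto
  show "inj_on el {..<c}" by (rule inj_onI) (metis e(2) lessThan_iff nat.inject)
  show "el ` {..<c} = A"
  proof
    show "el ` {..<c} \<subseteq> A" using e(1) by blast
    show "A \<subseteq> el ` {..<c}"
    proof
      fix v assume "v \<in> A"
      then have "1 \<le> ps v" "ps v \<le> c" "el (ps v - 1) = v" using assms unfolding slist_def by auto
      then show "v \<in> el ` {..<c}" by (intro image_eqI[of _ _ "ps v - 1"]) auto
    qed
  qed
qed

context ram begin

lemma cell_with_args: "cell (with_args xs s) = cell s"
  by (simp add: cell_def with_args_def fun_eq_iff)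

lemma read_CellE:
  assumes s: "fst s 3 = Q" and a: "a < 16" and x: "x < Q"
  shows "read w s (CellE a (Reg 0) (Lit 0)) [x] = cell s a x 0"
    and "y \<le> n * n \<Longrightarrow> read w s (CellE a (Reg 0) (Reg 1)) [x, y] = cell s a x y"
proof -
  have 3: "fst (with_args xs s) 3 = Q" if "length xs \<le> 3" for xs using s that by (simp add: with_args_def)
  have r: "fst (with_args [x] s) 0 = x" "fst (with_args [x, y] s) 0 = x" "fst (with_args [x, y] s) (Suc 0) = y"
    by (simp_all add: with_args_def)
  show "read w s (CellE a (Reg 0) (Lit 0)) [x] = cell s a x 0"
    unfolding read_def using val_CellE[of "with_args [x] s" a "Reg 0" "Lit 0"] 3[of "[x]"] a x r
    by (simp add: cell_with_args del: val.simps(3))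
  show "read w s (CellE a (Reg 0) (Reg 1)) [x, y] = cell s a x y" if "y \<le> n * n"
    unfolding read_def using val_CellE[of "with_args [x, y] s" a "Reg 0" "Reg 1"] 3[of "[x, y]"] a x r that
    by (simp add: cell_with_args del: val.simps(3))
qed

text \<open>Once every edge is recorded, recorded degrees are true degrees, and \<open>good\<close>
  becomes the defining condition of the layers.\<close>

lemma represents:
  assumes stores: "stores E lev E s" and good: "good lev E"
  shows "represents_lds w lds_alg s n E K \<Delta>"
proof -
  note rep = stores_full(1)[OF stores] and ok = stores_full(2)[OF stores]
  note r3 = rep_D(1)[OF rep]
  let ?l = "\<lambda>v. read w s (CellE 9 (Reg 0) (Lit 0)) [v]"
  have l: "?l v = lev v" if "v < n" for v using read_CellE(1)[OF r3, of 9 v] rep_D(6)[OF rep that] that nQ by simp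
  have sub: "{v. v < n \<and> P v} \<subseteq> {..<n}" for P by auto
  have bij: "bij_betw (\<lambda>j. read w s (CellE (a + 1) (Reg 0) (Reg 1)) [x, j])
      {..<read w s (sizeE a (Reg 0)) [x]} (lists_of n lev E a x)" if a: "a \<in> {0,3,6}" and x: "x < Q" for a x
  proof -
    note sl = rep_D(5)[OF rep a x]
    have a6: "a < 16" "a + 1 < 16" using a by auto
    have c: "read w s (sizeE a (Reg 0)) [x] = cell s a x 0" by (rule read_CellE(1)[OF r3 a6(1) x])
    have "read w s (CellE (a + 1) (Reg 0) (Reg 1)) [x, j] = cell s (a + 1) x j" if "j < cell s a x 0" for j
      using that slist_card_le[OF sl] le_nn[of j] by (intro read_CellE(2)[OF r3 a6(2) x]) simp
    then show ?thesis unfolding c using slist_bij[OF sl] 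
      by (subst bij_betw_cong[where g = "cell s (a + 1) x"]) auto
  qed
  have lay: "layer n ?l i = {v. v < n \<and> lev v = i}" for i unfolding layer_def using l by auto
  have lds: "is_lds n E K \<Delta> ?l"
    unfolding is_lds_def
  proof (intro conjI allI impI)
    fix v assume v: "v < n"
    then show "?l v \<in> {1..K}" using good l[OF v] unfolding good_def by (auto intro: less_imp_le)
    have "{u. u < n \<and> {v, u} \<in> E \<and> ?l v \<le> ?l u} = {u. {v, u} \<in> E \<and> lev v \<le> lev u}"
      using l v edges_okD[OF ok] by auto
    then show "card {u. u < n \<and> {v, u} \<in> E \<and> ?l v \<le> ?l u} \<le> \<Delta>"
      using good v unfolding good_def by simp
  qed
  have 1: "bij_betw (\<lambda>j. read w s (CellE 7 (Reg 0) (Reg 1)) [i, j])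
      {..<read w s (sizeE 6 (Reg 0)) [i]} (layer n ?l i)" if "i \<le> K" for i
    using bij[of 6 i] that KQ unfolding lay by (simp add: lists_of_def)
  have 2: "bij_betw (\<lambda>j. read w s (CellE 1 (Reg 0) (Reg 1)) [v, j])
      {..<read w s (sizeE 0 (Reg 0)) [v]} {u. {v, u} \<in> induced E (layer n ?l i)}"
    if v: "v \<in> layer n ?l i" for i v
  proof -
    have "{u. {v, u} \<in> induced E (layer n ?l i)} = lists_of n lev E 0 v"
      using v edges_okD[OF ok] unfolding lay induced_def lists_of_def by auto
    then show ?thesis using bij[of 0 v] v nQ unfolding lay by simp
  qed
  show ?thesis unfolding represents_lds_def Let_def lds_alg_def algorithm.simps
    using lds 1 2 by auto
qed

text \<open>The bounds 2 ^ (K - 2) \<le> n < 2 ^ (K - 1) single out \<open>K\<close>, so the first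
  loop ends with exactly this value. The bound on \<Delta> excludes overflow in its
  computation.\<close>

lemma init_wp:
  assumes Q: "Q = n + 2" and K: "2 ^ (K - 2) \<le> n" and \<Delta>: "\<Delta> = 4 * D + 9 * (\<alpha> * K)" "\<Delta> < 2 ^ w"
  shows "wp w init_com (with_args [n, \<alpha>, D] zero_state)
    (\<lambda>t s'. t \<le> 1000 * n \<and> stores {} (\<lambda>v. if v < n then 1 else 0) {} s')"
proof -
  let ?z = "with_args [n, \<alpha>, D] zero_state"
  have z: "fst ?z 0 = n" "fst ?z 1 = \<alpha>" "fst ?z 2 = D" "snd ?z = (\<lambda>_. 0)" "\<And>r. 3 \<le> r \<Longrightarrow> fst ?z r = 0"
    by (auto simp: with_args_def zero_state_def)
  have Qw: "(n + 2) mod 2 ^ w = n + 2"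
  proof (rule small)
    \<comment> \<open>Stated with \<open>p\<close> in place of the product, so that linear
      arithmetic applies.\<close>
    have "n + 2 < 16 * (p + 1)" if "n \<le> p" for p using that by simp
    from this[OF le_square] show "n + 2 < 16 * (n * n + 1)" .
  qed
  let ?p = "Neg (Less (Reg 0) (Reg 7))"
  let ?c1 = "Assign 7 (Add (Reg 7) (Reg 7)) ;; Assign 4 (Add (Reg 4) (Lit 1))"
  let ?s1 = "((fst ?z)(3 := n + 2, 7 := 1, 4 := 1), snd ?z)"
  have Kn: "K \<le> n + 1" using KQ Q by simp
  define Inv1 where "Inv1 s m \<longleftrightarrow> (\<exists>j\<ge>1. j \<le> K \<and> fst s 4 = j \<and> fst s 7 = 2 ^ (j - 1) \<and> fst s 3 = Q \<and>
    (\<forall>r. r \<notin> {3,4,7} \<longrightarrow> fst s r = fst ?z r) \<and> snd s = snd ?z \<and> m = 20 * (K - j))" for s :: state and m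
  have i0: "Inv1 ?s1 (20 * (K - 1))"
    unfolding Inv1_def using K_pos Q by (intro exI[of _ 1]) auto
  have loop1: "wp w (While ?p ?c1) ?s1 (\<lambda>t s'. \<exists>m'. Inv1 s' m' \<and> \<not> holds w s' ?p \<and>
      t + m' \<le> 20 * (K - 1) + 1 + test_cost ?p)"
  proof (rule wp_While[where Inv = Inv1, OF i0])
    fix s m assume "Inv1 s m" and h: "holds w s ?p"
    then obtain j where j: "1 \<le> j" "j \<le> K" "fst s 4 = j" "fst s 7 = 2 ^ (j - 1)" "fst s 3 = Q"
      "\<forall>r. r \<notin> {3,4,7} \<longrightarrow> fst s r = fst ?z r" "snd s = snd ?z" "m = 20 * (K - j)" unfolding Inv1_def by blast
    have "fst s 0 = n" using j(6) z(1) by simp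
    then have le: "2 ^ (j - 1) \<le> n" using h j(4) by simp
    then have jK: "j < K" using K2 j(2) by (metis le_neq_implies_less not_le)
    have "2 * 2 ^ (j - 1) \<le> 2 * n" using le by simp
    also have "2 * n \<le> n * n" using n2 by (intro mult_le_mono1)
    finally have "(2 * 2 ^ (j - 1)) mod 2 ^ w = (2::nat) * 2 ^ (j - 1)" by (intro small) simp
    moreover have "(2::nat) * 2 ^ (j - 1) = 2 ^ j" using j(1) by (cases j) auto
    ultimately have v: "val w s (Add (Reg 7) (Reg 7)) = 2 ^ j" using j(4) by (simp add: mult_2)
    have "j \<le> n" using jK Kn by simp
    from small_n[OF this] have v2: "val w ((fst s)(7 := 2 ^ j), snd s) (Add (Reg 4) (Lit 1)) = Suc j"
      using j(3) small_lit[of 1] by simp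
    have "Inv1 ((fst s)(7 := 2 ^ j, 4 := Suc j), snd s) (20 * (K - Suc j))"
      unfolding Inv1_def using j jK by (intro exI[of _ "Suc j"]) auto
    moreover have "1 + test_cost ?p + (1 + exp_cost (Add (Reg 7) (Reg 7)) + (1 + exp_cost (Add (Reg 4) (Lit 1))))
      + 20 * (K - Suc j) \<le> m" using j(8) jK by simp
    ultimately show "wp w ?c1 s (\<lambda>t s'. \<exists>m'. Inv1 s' m' \<and> 1 + test_cost ?p + t + m' \<le> m)"
      unfolding wp_Seq wp_Assign v fst_conv snd_conv v2 by blast
  qed
  define lv where "lv j v = (if v < j then 1 else 0::nat)" for j v :: nat
  define A where "A j a x = (if a = 6 \<and> x = 1 then {..<j} else {})" for j a x :: nat
  define Inv2 where "Inv2 s m \<longleftrightarrow> (\<exists>j\<le>n. fst s 9 = j \<and> fst s 10 = 1 \<and> fst s 0 = n \<and> rep s (A j) (lv j) [] \<and>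
    m = 150 * (n - j))" for s m
  let ?p2 = "Less (Reg 9) (Reg 0)"
  let ?c2 = "ins_com 6 10 9 ;; Store (AddrE 9 (Reg 9) (Lit 0)) (Lit 1) ;; Assign 9 (Add (Reg 9) (Lit 1))"
  have loop2: "wp w (While ?p2 ?c2) s (\<lambda>t s'. \<exists>m'. Inv2 s' m' \<and> \<not> holds w s' ?p2 \<and>
      t + m' \<le> m + 1 + test_cost ?p2)" if "Inv2 s m" for s m
  proof (rule wp_While[where Inv = Inv2, OF that])
    fix s m assume "Inv2 s m" and h: "holds w s ?p2"
    then obtain j where j: "j \<le> n" "fst s 9 = j" "fst s 10 = 1" "fst s 0 = n" "rep s (A j) (lv j) []"
      "m = 150 * (n - j)" unfolding Inv2_def by blast
    have jn: "j < n" using h j(2,4) by simp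
    have Q1: "1 < Q" "j < Q" using n2 nQ jn by auto
    have "set_list (A j) 6 1 (insert j (A j 6 1)) = A (Suc j)"
      by (auto simp: fun_eq_iff set_list_def A_def less_Suc_eq)
    then have ins: "wp w (ins_com 6 10 9) s (\<lambda>t s'. t \<le> 90 \<and> fst s' = fst s \<and> rep s' (A (Suc j)) (lv j) [])"
      using ins_wp[OF j(5), of 6 10 9] j(2,3) jn Q1 by (simp add: A_def)
    show "wp w ?c2 s (\<lambda>t s'. \<exists>m'. Inv2 s' m' \<and> 1 + test_cost ?p2 + t + m' \<le> m)"
      unfolding wp_Seq
    proof (rule wp_mono[OF ins], elim conjE)
      fix t s1 assume t: "t \<le> (90::nat)" and f: "fst s1 = fst s" and J1: "rep s1 (A (Suc j)) (lv j) []"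
      let ?s2 = "(fst s1, (snd s1)(addr 9 j 0 := 1))"
      have r: "fst s1 9 = j" "fst s1 3 = Q" using f j(2) rep_D(1)[OF J1] by auto
      have v: "val w s1 (AddrE 9 (Reg 9) (Lit 0)) = addr 9 j 0" "val w s1 (Lit 1) = 1"
        using val_AddrE[OF r(2), of 9 "Reg 9" "Lit 0"] r(1) Q1 small_lit[of 1] by simp_all
      have v2: "val w ?s2 (Add (Reg 9) (Lit 1)) = Suc j"
        using r small_lit[of 1] small_n[of j] jn by simp
      have "(lv j)(j := 1) = lv (Suc j)" by (auto simp: lv_def fun_eq_iff)
      then have "rep ?s2 (A (Suc j)) (lv (Suc j)) []" using rep_store_lev[OF J1 jn, of 1] by simp
      then have "rep ((fst ?s2)(9 := Suc j), snd ?s2) (A (Suc j)) (lv (Suc j)) []" by (subst rep_reg) auto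
      then have "Inv2 ((fst ?s2)(9 := Suc j), snd ?s2) (150 * (n - Suc j))"
        unfolding Inv2_def using jn f j by (intro exI[of _ "Suc j"]) auto
      moreover have "1 + test_cost ?p2 + (t + (1 + exp_cost (AddrE 9 (Reg 9) (Lit 0)) + exp_cost (Lit 1) +
          (1 + exp_cost (Add (Reg 9) (Lit 1))))) + 150 * (n - Suc j) \<le> m"
        using t j(6) jn by (simp add: exp_cost_AddrE)
      ultimately show "wp w (Store (AddrE 9 (Reg 9) (Lit 0)) (Lit 1)) s1 (\<lambda>t1 s'.
          wp w (Assign 9 (Add (Reg 9) (Lit 1))) s' (\<lambda>t2 s'. \<exists>m'. Inv2 s' m' \<and>
            1 + test_cost ?p2 + (t + (t1 + t2)) + m' \<le> m))"
        unfolding wp_Store wp_Assign v v2 by blast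
    qed
  qed
  have v: "val w ?z (Add (Reg 0) (Lit 2)) = n + 2" using z(1) Qw small_lit[of 2] by simp
  have one: "val w s (Lit 1) = 1" "val w s (Lit 0) = 0" for s using small_lit[of 1] by auto
  show ?thesis unfolding init_com_def wp_Seq wp_Assign v one fst_conv snd_conv
  proof (rule wp_mono[OF loop1], elim exE conjE)
    fix t1 s1 m1 assume "Inv1 s1 m1" and h: "\<not> holds w s1 ?p" and t1: "t1 + m1 \<le> 20 * (K - 1) + 1 + test_cost ?p"
    then obtain j where j: "1 \<le> j" "j \<le> K" "fst s1 4 = j" "fst s1 7 = 2 ^ (j - 1)" "fst s1 3 = Q"
      "\<forall>r. r \<notin> {3,4,7} \<longrightarrow> fst s1 r = fst ?z r" "snd s1 = snd ?z" unfolding Inv1_def by blast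
    have s1: "fst s1 0 = n" "fst s1 1 = \<alpha>" "fst s1 2 = D" "fst s1 6 = 0" using j(6) z by auto
    have lt: "n < 2 ^ (j - 1)" using h s1(1) j(4) by simp
    have jK: "j = K"
    proof (rule ccontr)
      assume "j \<noteq> K"
      then have "j - 1 \<le> K - 2" using j(2) by simp
      then have "(2::nat) ^ (j - 1) \<le> 2 ^ (K - 2)" by (rule power_increasing) simp
      with K lt show False by linarith
    qed
    have b: "4 * D < 2 ^ w" "9 * (\<alpha> * K) < 2 ^ w" "\<alpha> * K < 2 ^ w" "4 * D + 9 * (\<alpha> * K) < 2 ^ w"
      using \<Delta> by linarith+
    let ?e = "Add (Mul (Lit 4) (Reg 2)) (Mul (Lit 9) (Mul (Reg 1) (Reg 4)))"
    have ve: "val w s1 ?e = \<Delta>" using s1 j(3) jK b \<Delta>(1) small_lit[of 4] small_lit[of 9] by simp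
    let ?s2 = "((fst s1)(5 := \<Delta>, 10 := 1, 9 := 0), snd s1)"
    have "cell ?s2 a x = (\<lambda>_. 0)" for a x using j(7) z(4) by (simp add: cell_def fun_eq_iff)
    then have "rep ?s2 (A 0) (lv 0) []" unfolding rep_def using j jK s1
      by (simp add: A_def lv_def slist_def)
    then have i2: "Inv2 ?s2 (150 * n)" unfolding Inv2_def using s1 by (intro exI[of _ 0]) simp
    show "wp w (While ?p2 ?c2) ((fst s1)(5 := val w s1 ?e, 10 := 1, 9 := 0), snd s1) (\<lambda>t5 s'.
        1 + exp_cost (Add (Reg 0) (Lit 2)) + (1 + exp_cost (Lit 1) + (1 + exp_cost (Lit 1) +
          (t1 + (1 + exp_cost ?e + (1 + exp_cost (Lit 1) + (1 + exp_cost (Lit 0) + t5)))))) \<le> 1000 * n \<and>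
        stores {} (\<lambda>v. if v < n then 1 else 0) {} s')"
      unfolding ve
    proof (rule wp_mono[OF loop2[OF i2]], elim exE conjE)
      fix t5 s' m' assume "Inv2 s' m'" and h: "\<not> holds w s' ?p2" and t5: "t5 + m' \<le> 150 * n + 1 + test_cost ?p2"
      then obtain j where j: "j \<le> n" "fst s' 9 = j" "fst s' 0 = n" "rep s' (A j) (lv j) []" unfolding Inv2_def by blast
      have jn: "j = n" using h j(1-3) by simp
      have "A n = lists_of n (lv n) {}" by (auto simp: fun_eq_iff A_def lists_of_def lv_def)
      then have "rep s' (lists_of n (lv n) {}) (lv n) []" using j(4) jn by simp
      then have "stores {} (lv n) {} s'" unfolding stores_def edges_ok_def by auto
      then have I0: "stores {} (\<lambda>v. if v < n then 1 else 0) {} s'" unfolding lv_def .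
      have "20 * (K - 1) \<le> 20 * n" using Kn by simp
      moreover have "test_cost ?p = 4" "test_cost ?p2 = 3" "exp_cost ?e = 9" by simp_all
      ultimately have "t1 + t5 \<le> 170 * n + 9" using t1 t5 by linarith
      then show "1 + exp_cost (Add (Reg 0) (Lit 2)) + (1 + exp_cost (Lit 1) + (1 + exp_cost (Lit 1) +
            (t1 + (1 + exp_cost ?e + (1 + exp_cost (Lit 1) + (1 + exp_cost (Lit 0) + t5)))))) \<le> 1000 * n \<and>
          stores {} (\<lambda>v. if v < n then 1 else 0) {} s'" using n2 I0 by simp
    qed
  qed
qed

end

section \<open>Sequences of updates and the graphs they produce\<close>

lemma run_append:
  assumes "run w c s us t1 s1" "exec w c (with_args (update_args u) s1) t2 s2"
  shows "run w c s (us @ [u]) (t1 + t2) s2"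
  using assms
proof (induction rule: run.induct)
  case (Nil s)
  from run.Cons[OF Nil run.Nil] show ?case by simp
next
  case (Cons u' s t1 s1 us t2' s2')
  from run.Cons[OF Cons.hyps(1) Cons.IH[OF Cons.prems]] show ?case by (simp add: add.assoc)
qed

lemma dynamic_graph_snoc:
  assumes "dynamic_graph n \<alpha> (us @ [u])"
  shows "dynamic_graph n \<alpha> us" "legal_update n (graph_after us) u" "arboricity n (graph_after (us @ [u])) \<le> \<alpha>"
proof -
  have L: "\<forall>i < length (us @ [u]). legal_update n (graph_after (take i (us @ [u]))) ((us @ [u]) ! i)"
    and A: "\<forall>i \<le> length (us @ [u]). arboricity n (graph_after (take i (us @ [u]))) \<le> \<alpha>"
    using assms unfolding dynamic_graph_def by blast+
  show "dynamic_graph n \<alpha> us" unfolding dynamic_graph_def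
  proof (intro conjI allI impI)
    fix i assume i: "i < length us"
    then show "legal_update n (graph_after (take i us)) (us ! i)"
      using L[rule_format, of i] by (simp add: nth_append)
  next
    fix i assume i: "i \<le> length us"
    then show "arboricity n (graph_after (take i us)) \<le> \<alpha>" using A[rule_format, of i] by simp
  qed
  show "legal_update n (graph_after us) u" using L[rule_format, of "length us"] by simp
  show "arboricity n (graph_after (us @ [u])) \<le> \<alpha>" using A[rule_format, of "length (us @ [u])"] by simp
qed

lemma graph_after_snoc: "graph_after (us @ [u]) = apply_update (graph_after us) u"
  by (simp add: graph_after_def)

lemma dynamic_graph_edges_ok: "dynamic_graph n \<alpha> us \<Longrightarrow> edges_ok n (graph_after us)"
proof (induction us rule: rev_induct)
  case Nil
  then show ?case by (simp add: graph_after_def edges_ok_def)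
next
  case (snoc u us)
  then have "edges_ok n (graph_after us)" "legal_update n (graph_after us) u"
    using dynamic_graph_snoc by blast+
  then show ?case unfolding graph_after_snoc edges_ok_def by (cases u) auto
qed

lemma dynamic_graph_fits:
  assumes "maintains_orientation A'' n \<alpha> D F" and dg: "dynamic_graph n \<alpha> us"
  shows "fits n \<alpha> D (graph_after us) (A'' us)"
proof -
  have "arboricity n (graph_after us) \<le> \<alpha>" using dg unfolding dynamic_graph_def
    by (metis order_refl take_all)
  then show ?thesis using assms arboricity_bound dynamic_graph_edges_ok[OF dg]
    unfolding fits_def maintains_orientation_def by blast
qed

lemma fits_alpha_pos:
  assumes "fits n \<alpha> D E Ar" "E \<noteq> {}"
  shows "1 \<le> \<alpha>"
proof (rule ccontr)
  assume "\<not> 1 \<le> \<alpha>"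
  then have \<alpha>: "\<alpha> = 0" by simp
  obtain e where e: "e \<in> E" using assms(2) by blast
  have E: "edges_ok n E" using assms(1) unfolding fits_def by blast
  obtain x y where "e = {x, y}" "x < n" "y < n" using E e unfolding edges_ok_def by blast
  then have "e \<subseteq> {..<n}" by simp
  then have "card (induced E e) \<le> \<alpha> * card e" using assms(1) unfolding fits_def by blast
  then have "card (induced E e) = 0" using \<alpha> by simp
  moreover have "finite (induced E e)" using edges_ok_finite_card(1)[OF E] by (simp add: induced_def)
  ultimately have "induced E e = {}" by simp
  then show False using e by (auto simp: induced_def)
qed

section \<open>The number of layers and the word length\<close>

lemma levels_exist: "2 \<le> n \<Longrightarrow> \<exists>K\<ge>2. n < 2 ^ (K - 1) \<and> 2 ^ (K - 2) \<le> (n :: nat)"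
proof -
  assume n: "2 \<le> n"
  define m where "m = (LEAST m. n < 2 ^ m)"
  have ex: "n < 2 ^ n" by (rule less_exp)
  have m: "n < 2 ^ m" unfolding m_def by (rule LeastI[of "\<lambda>m. n < 2 ^ m", OF ex])
  have m0: "m \<noteq> 0" using m n by (cases "m = 0") simp_all
  have "\<not> n < 2 ^ (m - 1)" using not_less_Least[of "m - 1" "\<lambda>m. n < 2 ^ m"] m0 unfolding m_def by simp
  then show ?thesis using m m0 by (intro exI[of _ "Suc m"] conjI) (simp_all add: not_less)
qed

text \<open>From ln 2 \<ge> 1/2 one gets K - 2 \<le> 2 ln n, and since 1 \<le> 2 ln n for n \<ge> 2,
  the remaining 2 is at most 4 ln n.\<close>

lemma levels_le:
  assumes "2 ^ (K - 2) \<le> n" "2 \<le> n"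
  shows "real K \<le> 6 * ln (real n)"
proof -
  have "ln (1 / 2 :: real) \<le> 1 / 2 - 1" by (rule ln_le_minus_one) simp
  then have l2: "ln (2 :: real) \<ge> 1 / 2" by (simp add: ln_div)
  have "real (2 ^ (K - 2)) \<le> real n" using assms(1) by (rule of_nat_mono)
  then have "ln (2 ^ (K - 2)) \<le> ln (real n)" using assms(2) by simp
  then have 1: "real (K - 2) * ln 2 \<le> ln (real n)" by (simp add: ln_realpow)
  have "ln 2 \<le> ln (real n)" using assms(2) by simp
  then have 2: "1 \<le> 2 * ln (real n)" using l2 by linarith
  have "real (K - 2) * (1 / 2) \<le> real (K - 2) * ln 2" using l2 by (intro mult_left_mono) auto
  then have "real (K - 2) \<le> 2 * ln (real n)" using 1 by linarith
  then show ?thesis using 2 by linarith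
qed

text \<open>As \<open>N\<close> is at least 2, a constant factor 2 ^ j is at most N ^ j. The
  addresses thus need 6 + 3 powers of \<open>N\<close> and the degree threshold 5 + 2, so the
  exponent 10 is enough.\<close>

lemma word_bounds:
  assumes n: "2 \<le> n" and w: "(n + \<alpha> + D) ^ 10 \<le> 2 ^ w" and K: "2 ^ (K - 2) \<le> n"
  shows "K < n + 2" "16 * (n + 2) * (n * n + 1) \<le> 2 ^ w" "4 * D + 9 * (\<alpha> * K) < 2 ^ w"
proof -
  define N where "N = n + \<alpha> + D"
  have N: "2 \<le> N" "n \<le> N" "\<alpha> \<le> N" "D \<le> N" using n by (auto simp: N_def)
  have pow: "2 ^ j * N ^ i \<le> N ^ (j + i)" for i j
    unfolding power_add using N(1) by (intro mult_le_mono1 power_mono) auto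
  have "K - 2 < n" using K less_exp[of "K - 2"] by linarith
  then show Kn: "K < n + 2" by simp
  have "n + 2 \<le> 2 * N" "K \<le> 2 * N" using N n Kn by linarith+
  moreover have "1 * 1 \<le> N * N" using N by (intro mult_le_mono) auto
  then have "n * n + 1 \<le> 2 * (N * N)" using mult_le_mono[OF N(2,2)] by linarith
  ultimately have "16 * (n + 2) * (n * n + 1) \<le> 16 * (2 * N) * (2 * (N * N))"
    by (intro mult_le_mono) auto
  also have "\<dots> = 2 ^ 6 * N ^ 3" by (simp add: power3_eq_cube)
  also have "\<dots> \<le> N ^ (6 + 3)" by (rule pow)
  also have "\<dots> \<le> N ^ 10" using N by (intro power_increasing) auto
  also have "\<dots> \<le> 2 ^ w" using w by (simp add: N_def)
  finally show "16 * (n + 2) * (n * n + 1) \<le> 2 ^ w" .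
  have "\<alpha> * K \<le> N * (2 * N)" using N \<open>K \<le> 2 * N\<close> by (intro mult_le_mono) auto
  moreover have "D * 1 \<le> N * N" "1 * 1 \<le> N * N" using N by (intro mult_le_mono; simp)+
  ultimately have "4 * D + 9 * (\<alpha> * K) < 32 * (N * N)" by linarith
  also have "\<dots> = 2 ^ 5 * N ^ 2" by (simp add: power2_eq_square)
  also have "\<dots> \<le> N ^ (5 + 2)" by (rule pow)
  also have "\<dots> \<le> N ^ 10" using N by (intro power_increasing) auto
  also have "\<dots> \<le> 2 ^ w" using w by (simp add: N_def)
  finally show "4 * D + 9 * (\<alpha> * K) < 2 ^ w" .
qed

section \<open>Summation over all updates\<close>

context ram begin

text \<open>The potential telescopes along the updates. It starts at zero: there are no edges, hence
  no arcs, and all vertices are in layer 1, where they contribute nothing to the sum of the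
  layers.\<close>

lemma run_wp:
  assumes mo: "maintains_orientation A'' n \<alpha> D F" and \<Delta>: "\<Delta> = 4 * D + 9 * (\<alpha> * K)"
    and I0: "stores {} (\<lambda>v. if v < n then 1 else 0) {} s0" and K: "1 < K"
    and dg: "dynamic_graph n \<alpha> us"
  shows "\<exists>t s lev. run w step_com s0 us t s \<and> stores (graph_after us) lev (graph_after us) s \<and>
    good lev (graph_after us) \<and>
    t + pot n \<alpha> (graph_after us) (A'' us) lev (graph_after us)
      \<le> 11000 * length us + 8000 * (\<Sum>i < length us. flips (A'' (take i us)) (A'' (take (Suc i) us)))"
  using dg
proof (induction us rule: rev_induct)
  case Nil
  have "is_orientation (A'' []) {}"
    using dynamic_graph_fits[OF mo Nil] unfolding fits_def by (simp add: graph_after_def)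
  then have "A'' [] = {}" unfolding is_orientation_def by auto
  then have "pot n \<alpha> {} (A'' []) (\<lambda>v. if v < n then 1 else 0) {} = 0" by (simp add: pot_def bad_def)
  then show ?case using I0 K run.Nil[of w step_com s0]
    by (intro exI[of _ 0] exI[of _ s0] exI[of _ "\<lambda>v. if v < n then 1 else 0"])
      (simp add: graph_after_def good_def)
next
  case (snoc u us)
  let ?E = "graph_after us" and ?E' = "graph_after (us @ [u])"
  note dg = dynamic_graph_snoc[OF snoc.prems]
  obtain t s lev where 1: "run w step_com s0 us t s" "stores ?E lev ?E s" "good lev ?E"
    "t + pot n \<alpha> ?E (A'' us) lev ?E
      \<le> 11000 * length us + 8000 * (\<Sum>i < length us. flips (A'' (take i us)) (A'' (take (Suc i) us)))"
    using snoc.IH[OF dg(1)] by blast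
  have fits: "fits n \<alpha> D ?E (A'' us)" "fits n \<alpha> D ?E' (A'' (us @ [u]))"
    by (rule dynamic_graph_fits[OF mo dg(1)], rule dynamic_graph_fits[OF mo snoc.prems])
  \<comment> \<open>An insertion leaves an edge and a deletion presupposes one. Either graph having
    an edge excludes \<alpha> = 0, so the analysis of the step may assume
    \<open>1 \<le> \<alpha>\<close>.\<close>
  have "?E \<noteq> {} \<or> ?E' \<noteq> {}" using dg(2) unfolding graph_after_snoc by (cases u) auto
  then have \<alpha>: "1 \<le> \<alpha>" using fits_alpha_pos[OF fits(1)] fits_alpha_pos[OF fits(2)] by blast
  obtain t2 s2 lev2 where 2: "exec w step_com (with_args (update_args u) s) t2 s2"
    "stores ?E' lev2 ?E' s2" "good lev2 ?E'"
    "t2 + pot n \<alpha> ?E' (A'' (us @ [u])) lev2 ?E'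
      \<le> pot n \<alpha> ?E (A'' us) lev ?E + 8000 * flips (A'' us) (A'' (us @ [u])) + 11000"
    using step_wp[OF 1(2,3) dg(2) fits(1) fits(2)[unfolded graph_after_snoc] \<alpha> \<Delta>]
    unfolding wp_def graph_after_snoc by blast
  have "(\<Sum>i < length (us @ [u]). flips (A'' (take i (us @ [u]))) (A'' (take (Suc i) (us @ [u])))) =
    (\<Sum>i < length us. flips (A'' (take i us)) (A'' (take (Suc i) us))) + flips (A'' us) (A'' (us @ [u]))"
    by simp
  then have "t + t2 + pot n \<alpha> ?E' (A'' (us @ [u])) lev2 ?E' \<le> 11000 * length (us @ [u]) +
    8000 * (\<Sum>i < length (us @ [u]). flips (A'' (take i (us @ [u]))) (A'' (take (Suc i) (us @ [u]))))"
    using 1(4) 2(4) by simp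
  then show ?case using run_append[OF 1(1) 2(1)] 2(2,3) by blast
qed

end

theorem theorem5:
  shows "\<exists>(A :: algorithm) (C :: real) (c :: nat). 0 < C \<and>
    (\<forall>(n :: nat) (\<alpha> :: nat) (D :: nat) (F :: real) (w :: nat).
      2 \<le> n \<longrightarrow>
      (n + \<alpha> + D) ^ c \<le> 2 ^ w \<longrightarrow>
      (\<exists>A''. maintains_orientation A'' n \<alpha> D F) \<longrightarrow>
      (\<exists>(k :: nat) (\<Delta> :: nat).
        real k \<le> C * ln (real n) \<and>
        real \<Delta> \<le> C * (real D + real \<alpha> * ln (real n)) \<and>
        maintains_lds w A n \<alpha> D k \<Delta> (C * real n) (C * max 1 F)))"
proof (rule exI[of _ lds_alg], rule exI[of _ 20000], rule exI[of _ 10], intro conjI allI impI)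
  fix n \<alpha> D w :: nat and F :: real
  assume n: "2 \<le> n" and w: "(n + \<alpha> + D) ^ 10 \<le> 2 ^ w" and "\<exists>A''. maintains_orientation A'' n \<alpha> D F"
  then obtain A'' where mo: "maintains_orientation A'' n \<alpha> D F" by blast
  obtain K where K: "2 \<le> K" "n < 2 ^ (K - 1)" "2 ^ (K - 2) \<le> n" using levels_exist[OF n] by blast
  note wb = word_bounds[OF n w K(3)]
  define \<Delta> where "\<Delta> = 4 * D + 9 * (\<alpha> * K)"
  \<comment> \<open>As \<open>K < n + 2\<close>, this many columns suffice for the vertices and for
    the layers.\<close>
  interpret ram w n "n + 2" K \<Delta>
    by unfold_locales (use n wb K in auto)
  have ln: "real K \<le> 6 * ln (real n)" "0 \<le> ln (real n)" using levels_le[OF K(3) n] n by auto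
  obtain t0 s0 where init: "exec w init_com (with_args [n, \<alpha>, D] zero_state) t0 s0" "t0 \<le> 1000 * n"
    "stores {} (\<lambda>v. if v < n then 1 else 0) {} s0"
    using init_wp[OF refl K(3) \<Delta>_def wb(3)[folded \<Delta>_def]] unfolding wp_def by blast
  have "maintains_lds w lds_alg n \<alpha> D K \<Delta> (20000 * real n) (20000 * max 1 F)"
    unfolding maintains_lds_def
  proof (rule exI[of _ t0], rule exI[of _ s0], intro conjI allI impI)
    show "exec w (init lds_alg) (with_args [n, \<alpha>, D] zero_state) t0 s0" using init(1) by (simp add: lds_alg_def)
    show "real t0 \<le> 20000 * real n" using init(2) by linarith
    fix us assume dg: "dynamic_graph n \<alpha> us"
    let ?fl = "\<Sum>i < length us. flips (A'' (take i us)) (A'' (take (Suc i) us))"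
    have "1 < K" using K(1) by linarith
    then obtain t s lev where 1: "run w step_com s0 us t s" "stores (graph_after us) lev (graph_after us) s"
      "good lev (graph_after us)"
      "t + pot n \<alpha> (graph_after us) (A'' us) lev (graph_after us) \<le> 11000 * length us + 8000 * ?fl"
      using run_wp[OF mo \<Delta>_def init(3) _ dg] by blast
    have t: "t \<le> 11000 * length us + 8000 * ?fl" using 1(4) by (rule add_leD1)
    have fl: "real ?fl \<le> F * real (length us)" using mo dg unfolding maintains_orientation_def by blast
    \<comment> \<open>The 11000 steps per update do not scale with \<open>F\<close>, which may be
      below 1. Against \<open>max 1 F\<close> both summands together cost at most 19000 per update,
      within the constant 20000.\<close>
    have "F * real (length us) \<le> max 1 F * real (length us)" "1 * real (length us) \<le> max 1 F * real (length us)"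
      by (intro mult_right_mono; simp)+
    moreover have "real t \<le> 11000 * real (length us) + 8000 * real ?fl"
      using of_nat_mono[OF t, where ?'a = real] by (simp only: of_nat_add of_nat_mult of_nat_numeral)
    ultimately have "real t \<le> 20000 * max 1 F * real (length us)" using fl by linarith
    moreover have "run w (step lds_alg) s0 us t s" using 1(1) by (simp add: lds_alg_def)
    ultimately show "\<exists>t s. run w (step lds_alg) s0 us t s \<and> real t \<le> 20000 * max 1 F * real (length us) \<and>
        represents_lds w lds_alg s n (graph_after us) K \<Delta>"
      using represents[OF 1(2,3)] by blast
  qed
  moreover have "real K \<le> 20000 * ln (real n)" using ln by linarith
  moreover have "real \<Delta> \<le> 20000 * (real D + real \<alpha> * ln (real n))"
  proof -
    have "real \<alpha> * real K \<le> real \<alpha> * (6 * ln (real n))" using ln(1) by (intro mult_left_mono) auto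
    moreover have "0 \<le> real \<alpha> * ln (real n)" using ln(2) by simp
    ultimately show ?thesis unfolding \<Delta>_def by simp
  qed
  ultimately show "\<exists>(k :: nat) (\<Delta> :: nat). real k \<le> 20000 * ln (real n) \<and>
      real \<Delta> \<le> 20000 * (real D + real \<alpha> * ln (real n)) \<and>
      maintains_lds w lds_alg n \<alpha> D k \<Delta> (20000 * real n) (20000 * max 1 F)" by blast
qed simp

end
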